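(* Let $\Phi\in\{B_n,C_n,D_n\}$ and fix any $\mathbf s\in{\rm Score}(\Phi)$. Let $t_{\rm mix}$ be the mixing time of lazy simple random walk on the Coxeter interchange graph ${\rm IntGr}(\Phi,\mathbf s)$. Then $t_{\rm mix}=O(n^3\log n)$ if $\Phi=B_n$ or $\Phi=D_n$, and $t_{\rm mix}=O(n^4\log n)$ if $\Phi=C_n$, where the implied constants do not depend on $n$ or $\mathbf s$.
   Context: Signed graphs. Let $[n]=\{1,\dots,n\}$ and let $\mathbf e_1,\dots,\mathbf e_n$ be the standard basis of $\mathbb R^n$. A signed graph on $[n]$ has signed edges of four kinds: negative edges $e^-_{ij}$ and positive edges $e^+_{ij}$ between distinct vertices $i,j$, half edges $e^h_i$ (one endpoint $i$) and loops $e^\ell_i$ at a vertex $i$. Each signed edge $e$ has a vector $\mathbf e$: $\mathbf e^{\pm}_{ij}=\mathbf e_i\pm\mathbf e_j$ (for $i>j$), $\mathbf e^h_i=\mathbf e_i$, $\mathbf e^\ell_i=2\mathbf e_i$. The complete signed graph $\mathcal K_{D_n}$ contains all negative and all positive edges (one of each per pair); $\mathcal K_{B_n}$ contains these plus all half edges $e^h_i$; $\mathcal K_{C_n}$ contains all negative and positive edges plus all loops $e^\ell_i$. Coxeter tournaments. A Coxeter tournament $\mathcal T$ on a signed graph $\mathcal S$ is a family $(w_e)_{e\in E(\mathcal S)}$ with $w_e\in\{0,1\}$ (each edge is a "game" and $w_e$ its outcome). Its score sequence is $\mathbf s(\mathcal T)=\sum_{e}(w_e-\tfrac12)\mathbf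 e$. A sub-tournament is the restriction of $\mathcal T$ to a subset of its games; it is neutral if the sum of $(w_e-\frac12)\mathbf e$ over its games is $\mathbf 0$. For a sub-tournament $\mathcal X\subseteq\mathcal T$, $\mathcal T*\mathcal X$ is obtained from $\mathcal T$ by replacing $w_e$ by $1-w_e$ for each game $e$ of $\mathcal X$. ${\rm Score}(\Phi)$ is the set of score sequences of Coxeter tournaments on $\mathcal K_\Phi$, and ${\rm Tour}(\Phi,\mathbf s)$ the set of Coxeter tournaments on $\mathcal K_\Phi$ with score sequence $\mathbf s$. Generators. A copy of a type-$\Phi$ generator in $\mathcal T$ is a neutral sub-tournament $\mathcal G$ whose set of games is one of: (a) (neutral triangle, all types) either three negative edges joining three distinct vertices pairwise (cyclic triangle), or, for three distinct vertices, one negative edge on one pair and positive edges on the two other pairs (balanced triangle); (b) (neutral pair, only for $\Phi=B_n$) a negative edge or a positive edge between $i\neq j$ together with the half edges $e^h_i,e^h_j$; (c) (neutral clover, only for $\Phi=C_n$) $e^-_{ij},e^+_{ij}$ and the loop $e^\ell_i$ for some $i\neq j$. Interchange graph. ${\rm IntGr}(\Phi,\mathbf s)$ is the multigraph with vertex set ${\rm Tour}(\Phi,\mathbf s)$ in which $\mathcal T_1,\mathcal T_2$ are joined iff $\mathcal T_2=\mathcal T_1*\mathcal G$ for a copy $\mathcal G$ of a type-$\Phi$ generator in $\mathcal T_1$; they are joined by a double edge if $\mathcal G$ is a neutral clover and by a single edge otherwise. Random walk. Lazy simple random walk on a finite multigraph: at each step it stays put with probability $1/2$, and otherwise moves across an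 edge chosen uniformly among the edges incident to the current vertex (double edges counted twice). The mixing time is $t_{\rm mix}=\min\{t\ge0:\max_x \frac12\sum_y|P^t(x,y)-\pi(y)|\le 1/4\}$, where $P^t$ is the $t$-step transition probability and $\pi$ the stationary distribution. *)

theory Defs
  imports Complex_Main "HOL-Library.FuncSet" "HOL-Library.Extended_Real"
begin

(* NegEdge i j and PosEdge i j are only used with i > j, so that each unordered pair of
   vertices carries one negative and one positive edge. *)
datatype sedge = NegEdge nat nat | PosEdge nat nat | HalfEdge nat | Loop nat

definition neg_edge :: "nat \<Rightarrow> nat \<Rightarrow> sedge" where
  "neg_edge i j = NegEdge (max i j) (min i j)"

definition pos_edge :: "nat \<Rightarrow> nat \<Rightarrow> sedge" where
  "pos_edge i j = PosEdge (max i j) (min i j)"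

(* Vectors of R^n are functions nat => real with coordinates indexed by 1..n; every vector
   that occurs below vanishes outside 1..n. *)
definition basis_vec :: "nat \<Rightarrow> nat \<Rightarrow> real" where
  "basis_vec i = (\<lambda>k. if k = i then 1 else 0)"

fun edge_vec :: "sedge \<Rightarrow> nat \<Rightarrow> real" where
  "edge_vec (NegEdge i j) = (\<lambda>k. basis_vec i k - basis_vec j k)"
| "edge_vec (PosEdge i j) = (\<lambda>k. basis_vec i k + basis_vec j k)"
| "edge_vec (HalfEdge i) = basis_vec i"
| "edge_vec (Loop i) = (\<lambda>k. 2 * basis_vec i k)"

datatype coxeter_type = TypeB | TypeC | TypeD

definition complete_D :: "nat \<Rightarrow> sedge set" where
  "complete_D n = {NegEdge i j | i j. i \<in> {1..n} \<and> j \<in> {1..n} \<and> i > j}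
                \<union> {PosEdge i j | i j. i \<in> {1..n} \<and> j \<in> {1..n} \<and> i > j}"

fun complete_graph :: "coxeter_type \<Rightarrow> nat \<Rightarrow> sedge set" where
  "complete_graph TypeB n = complete_D n \<union> HalfEdge ` {1..n}"
| "complete_graph TypeC n = complete_D n \<union> Loop ` {1..n}"
| "complete_graph TypeD n = complete_D n"

type_synonym tournament = "sedge \<Rightarrow> nat"

definition tournaments :: "sedge set \<Rightarrow> tournament set" where
  "tournaments E = (E \<rightarrow>\<^sub>E {0, 1})"

(* A sub-tournament of w is given by its set X of games; this is its score. *)
definition score_on :: "sedge set \<Rightarrow> tournament \<Rightarrow> nat \<Rightarrow> real" where
  "score_on X w = (\<lambda>k. \<Sum>e\<in>X. (real (w e) - 1 / 2) * edge_vec e k)"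

definition Score :: "coxeter_type \<Rightarrow> nat \<Rightarrow> (nat \<Rightarrow> real) set" where
  "Score \<Phi> n = score_on (complete_graph \<Phi> n) ` tournaments (complete_graph \<Phi> n)"

definition Tour :: "coxeter_type \<Rightarrow> nat \<Rightarrow> (nat \<Rightarrow> real) \<Rightarrow> tournament set" where
  "Tour \<Phi> n s = {w \<in> tournaments (complete_graph \<Phi> n). score_on (complete_graph \<Phi> n) w = s}"

definition neutral :: "tournament \<Rightarrow> sedge set \<Rightarrow> bool" where
  "neutral w X \<longleftrightarrow> score_on X w = (\<lambda>_. 0)"

definition reverse_games :: "tournament \<Rightarrow> sedge set \<Rightarrow> tournament" where
  "reverse_games w X = (\<lambda>e. if e \<in> X then 1 - w e else w e)"

definition triangles :: "nat \<Rightarrow> sedge set set" where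
  "triangles n =
     {{neg_edge i j, neg_edge j k, neg_edge i k} | i j k.
        {i, j, k} \<subseteq> {1..n} \<and> distinct [i, j, k]}
   \<union> {{neg_edge i j, pos_edge j k, pos_edge i k} | i j k.
        {i, j, k} \<subseteq> {1..n} \<and> distinct [i, j, k]}"

definition pairs :: "nat \<Rightarrow> sedge set set" where
  "pairs n =
     {{neg_edge i j, HalfEdge i, HalfEdge j} | i j. {i, j} \<subseteq> {1..n} \<and> i \<noteq> j}
   \<union> {{pos_edge i j, HalfEdge i, HalfEdge j} | i j. {i, j} \<subseteq> {1..n} \<and> i \<noteq> j}"

definition clovers :: "nat \<Rightarrow> sedge set set" where
  "clovers n = {{neg_edge i j, pos_edge i j, Loop i} | i j. {i, j} \<subseteq> {1..n} \<and> i \<noteq> j}"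

fun generator_games :: "coxeter_type \<Rightarrow> nat \<Rightarrow> sedge set set" where
  "generator_games TypeB n = triangles n \<union> pairs n"
| "generator_games TypeC n = triangles n \<union> clovers n"
| "generator_games TypeD n = triangles n"

definition generator_copies :: "coxeter_type \<Rightarrow> nat \<Rightarrow> tournament \<Rightarrow> sedge set set" where
  "generator_copies \<Phi> n w = {G \<in> generator_games \<Phi> n. neutral w G}"

(* Number of edges between two vertices of the interchange graph. The generator G is the set
   of games on which w1 and w2 differ, so at most one G joins them. *)
definition int_mult :: "coxeter_type \<Rightarrow> nat \<Rightarrow> tournament \<Rightarrow> tournament \<Rightarrow> nat" where
  "int_mult \<Phi> n w1 w2 =
     (if \<exists>G \<in> generator_copies \<Phi> n w1. w2 = reverse_games w1 G
      then (if \<exists>G \<in> generator_copies \<Phi> n w1. w2 = reverse_games w1 G \<and> G \<in> clovers n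
            then 2 else 1)
      else 0)"

(* A finite multigraph is given by its vertex set V and its edge multiplicities m.
   At an isolated vertex the walk stays put. *)
definition lazy_walk :: "'a set \<Rightarrow> ('a \<Rightarrow> 'a \<Rightarrow> nat) \<Rightarrow> 'a \<Rightarrow> 'a \<Rightarrow> real" where
  "lazy_walk V m x y =
     (let d = (\<Sum>z\<in>V. m x z)
      in if d = 0 then of_bool (x = y)
         else 1 / 2 * of_bool (x = y) + 1 / 2 * (real (m x y) / real d))"

primrec trans_pow :: "'a set \<Rightarrow> ('a \<Rightarrow> 'a \<Rightarrow> real) \<Rightarrow> nat \<Rightarrow> 'a \<Rightarrow> 'a \<Rightarrow> real" where
  "trans_pow V P 0 x y = of_bool (x = y)"
| "trans_pow V P (Suc t) x y = (\<Sum>z\<in>V. trans_pow V P t x z * P z y)"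

definition is_stationary :: "'a set \<Rightarrow> ('a \<Rightarrow> 'a \<Rightarrow> real) \<Rightarrow> ('a \<Rightarrow> real) \<Rightarrow> bool" where
  "is_stationary V P \<pi> \<longleftrightarrow>
     (\<forall>x\<in>V. \<pi> x \<ge> 0) \<and> (\<forall>x. x \<notin> V \<longrightarrow> \<pi> x = 0) \<and> (\<Sum>x\<in>V. \<pi> x) = 1 \<and>
     (\<forall>y\<in>V. (\<Sum>x\<in>V. \<pi> x * P x y) = \<pi> y)"

definition stationary_dist :: "'a set \<Rightarrow> ('a \<Rightarrow> 'a \<Rightarrow> real) \<Rightarrow> 'a \<Rightarrow> real" where
  "stationary_dist V P = (THE \<pi>. is_stationary V P \<pi>)"

(* The value is infinite if the total variation distance never drops to 1/4. *)
definition mixing_time :: "'a set \<Rightarrow> ('a \<Rightarrow> 'a \<Rightarrow> real) \<Rightarrow> enat" where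
  "mixing_time V P =
     Inf {enat t | t.
       (MAX x\<in>V. 1 / 2 * (\<Sum>y\<in>V. \<bar>trans_pow V P t x y - stationary_dist V P y\<bar>)) \<le> 1 / 4}"

definition t_mix :: "coxeter_type \<Rightarrow> nat \<Rightarrow> (nat \<Rightarrow> real) \<Rightarrow> enat" where
  "t_mix \<Phi> n s = mixing_time (Tour \<Phi> n s) (lazy_walk (Tour \<Phi> n s) (int_mult \<Phi> n))"

end

theory Submission
  imports Defs
begin

text \<open>
  Put $e_{-i} = -e_i$ and $e_0 = 0$. All games are then differences $e_p - e_q$ of signed vertices
  $p, q$, and a Coxeter tournament is a tournament on the signed vertices that is invariant under
  reversing all arrows and negating all vertices: half edges join a vertex to $0$ (type B), loops
  join $i$ to $-i$ (type C). The neutral generators are exactly the cyclic triangles of signed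
  vertices; a clover is a cyclic triangle containing an antipodal pair.

  Mixing is shown by path coupling in its dual form: if $f$ changes by at most \<open>\<alpha>\<close> along triangle
  edges and by at most \<open>\<beta>\<close> along clover edges of the interchange graph, then one step of the walk
  shrinks these bounds by a factor \<open>1 - \<kappa>\<close>. Let $y$ arise from $x$ by reversing a cyclic triangle
  $pqr$. Generators disjoint from $pqr$ are common to $x$ and $y$. Those meeting it are grouped by
  their fourth vertex $t$. The four-vertex tournament $pqrt$ has at most one further cyclic triangle
  $G$ in $x$, then exactly one, $G'$, in $y$, and the reversals of $G$ in $x$ and of $G'$ in $y$
  differ by the fourth triangle, so they are still adjacent. This applies also to
  $t \in \{-p, -q, -r\}$ in types B and D, where the games on three pairs of signed vertices form a
  $K_4$ again ($D_3 = A_3$), and gives \<open>\<kappa>\<close> equal to one over the degree. In type C the triple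
  $t \in \{-p, -q, -r\}$ costs an excess of $4\beta - 2\alpha$, against a gain of $2\alpha$; the
  weights $\alpha = n$, $\beta = n - 1$ leave enough, and lose the additional factor $n$. The same
  matching, applied to constant functions, shows that the interchange graph is regular.

  For connectivity, the arrows on which two tournaments of equal score differ sum to zero. If they
  were closed under composition, then replacing two arrows at an obtuse angle by their composition
  would produce ever shorter zero sums. So there are arrows $p \to q \to r$ of the difference with
  $p \to r$ not in it, and reversing the triangle $pqr$, in one of the two tournaments, brings them
  closer.
\<close>

section \<open>Mixing times by contraction\<close>

definition markov_op :: "'a set \<Rightarrow> ('a \<Rightarrow> 'a \<Rightarrow> real) \<Rightarrow> ('a \<Rightarrow> real) \<Rightarrow> 'a \<Rightarrow> real" where
  "markov_op V P f x = (\<Sum>y\<in>V. P x y * f y)"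

lemma trans_pow_Suc_op:
  "(\<Sum>y\<in>V. trans_pow V P (Suc t) x y * f y) = (\<Sum>z\<in>V. trans_pow V P t x z * markov_op V P f z)"
proof -
  have "(\<Sum>y\<in>V. trans_pow V P (Suc t) x y * f y)
      = (\<Sum>y\<in>V. \<Sum>z\<in>V. trans_pow V P t x z * P z y * f y)"
    by (simp add: sum_distrib_right)
  also have "\<dots> = (\<Sum>z\<in>V. \<Sum>y\<in>V. trans_pow V P t x z * P z y * f y)"
    by (rule sum.swap)
  finally show ?thesis
    by (simp add: markov_op_def sum_distrib_left mult.assoc)
qed

text \<open>The predicate \<open>L c f\<close> stands for a seminorm bound that one step of the walk
  shrinks by the factor \<open>1 - \<kappa>\<close>. Indicators satisfy it with
  \<open>c = 1\<close>, so after \<open>t\<close> steps the probability of any event varies by at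
  most \<open>(1 - \<kappa>) ^ t * D\<close> over the starting points, and total variation distance
  is the largest such deviation from equilibrium. Column sums equal to one make the uniform
  distribution stationary; its uniqueness follows from the same contraction.\<close>

lemma mixing_time_le_contraction:
  fixes V :: "'a set" and P :: "'a \<Rightarrow> 'a \<Rightarrow> real" and L :: "real \<Rightarrow> ('a \<Rightarrow> real) \<Rightarrow> bool"
  assumes fin: "finite V" and ne: "V \<noteq> {}"
    and rows: "\<And>x. x \<in> V \<Longrightarrow> (\<Sum>y\<in>V. P x y) = 1"
    and cols: "\<And>y. y \<in> V \<Longrightarrow> (\<Sum>x\<in>V. P x y) = 1"
    and kappa: "0 < \<kappa>" "\<kappa> \<le> 1"
    and contr: "\<And>c f. 0 \<le> c \<Longrightarrow> L c f \<Longrightarrow> L ((1 - \<kappa>) * c) (markov_op V P f)"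
    and diam: "\<And>c f x y. 0 \<le> c \<Longrightarrow> L c f \<Longrightarrow> x \<in> V \<Longrightarrow> y \<in> V \<Longrightarrow> \<bar>f x - f y\<bar> \<le> D * c"
    and ind: "\<And>A. L 1 (\<lambda>x. of_bool (x \<in> A))"
    and t: "(1 - \<kappa>) ^ t * D \<le> 1 / 4"
  shows "mixing_time V P \<le> enat t"
proof -
  define Q where "Q t f x = (\<Sum>y\<in>V. trans_pow V P t x y * f y)" for t f x
  have Q0: "Q 0 f x = f x" if "x \<in> V" for f x
  proof -
    have "Q 0 f x = (\<Sum>y\<in>V. if x = y then f y else 0)"
      unfolding Q_def by (rule sum.cong) auto
    then show ?thesis using that fin by simp
  qed
  have QS: "Q (Suc t) f x = Q t (markov_op V P f) x" for t f x
    unfolding Q_def by (rule trans_pow_Suc_op)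
  have osc: "\<bar>Q t f x - Q t f y\<bar> \<le> (1 - \<kappa>) ^ t * D * c"
    if "0 \<le> c" "L c f" "x \<in> V" "y \<in> V" for t c f x y
    using that(1,2)
  proof (induction t arbitrary: c f)
    case 0
    then show ?case using diam[of c f x y] that(3,4) by (simp add: Q0)
  next
    case (Suc t)
    have "\<bar>Q t (markov_op V P f) x - Q t (markov_op V P f) y\<bar> \<le> (1 - \<kappa>) ^ t * D * ((1 - \<kappa>) * c)"
      by (rule Suc.IH) (use Suc.prems contr kappa in auto)
    then show ?case by (simp add: QS algebra_simps)
  qed
  have stat_Q: "(\<Sum>x\<in>V. \<pi> x * Q t f x) = (\<Sum>x\<in>V. \<pi> x * f x)" if "is_stationary V P \<pi>" for \<pi> t f
  proof (induction t arbitrary: f)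
    case 0
    then show ?case by (simp add: Q0)
  next
    case (Suc t)
    have "(\<Sum>x\<in>V. \<pi> x * Q (Suc t) f x) = (\<Sum>x\<in>V. \<pi> x * markov_op V P f x)"
      by (simp add: QS Suc.IH)
    also have "\<dots> = (\<Sum>x\<in>V. \<Sum>y\<in>V. \<pi> x * P x y * f y)"
      by (simp add: markov_op_def sum_distrib_left mult.assoc)
    also have "\<dots> = (\<Sum>y\<in>V. \<Sum>x\<in>V. \<pi> x * P x y * f y)"
      by (rule sum.swap)
    also have "\<dots> = (\<Sum>y\<in>V. \<pi> y * f y)"
      using that by (simp add: is_stationary_def flip: sum_distrib_right)
    finally show ?case .
  qed
  have near: "\<bar>Q t f x - (\<Sum>z\<in>V. \<pi> z * f z)\<bar> \<le> (1 - \<kappa>) ^ t * D"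
    if "is_stationary V P \<pi>" "L 1 f" "x \<in> V" for \<pi> f x t
  proof -
    have one: "(\<Sum>z\<in>V. \<pi> z) = 1" and nn: "\<And>z. z \<in> V \<Longrightarrow> \<pi> z \<ge> 0"
      using that(1) by (auto simp: is_stationary_def)
    \<comment> \<open>The constant \<open>Q t f x\<close> is also written as an average over
      \<open>\<pi>\<close>, so that the oscillation bound applies to each summand.\<close>
    have "Q t f x - (\<Sum>z\<in>V. \<pi> z * f z) = (\<Sum>z\<in>V. \<pi> z) * Q t f x - (\<Sum>z\<in>V. \<pi> z * Q t f z)"
      by (simp add: one stat_Q[OF that(1)])
    also have "\<dots> = (\<Sum>z\<in>V. \<pi> z * (Q t f x - Q t f z))"
      by (simp add: sum_distrib_right right_diff_distrib sum_subtractf)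
    also have "\<bar>\<dots>\<bar> \<le> (\<Sum>z\<in>V. \<bar>\<pi> z * (Q t f x - Q t f z)\<bar>)"
      by (rule sum_abs)
    also have "\<dots> \<le> (\<Sum>z\<in>V. \<pi> z * ((1 - \<kappa>) ^ t * D))"
    proof (rule sum_mono)
      fix z assume "z \<in> V"
      then show "\<bar>\<pi> z * (Q t f x - Q t f z)\<bar> \<le> \<pi> z * ((1 - \<kappa>) ^ t * D)"
        using osc[of 1 f x z t] that nn[of z] by (simp add: abs_mult mult_left_mono)
    qed
    also have "\<dots> = (1 - \<kappa>) ^ t * D"
      by (simp add: one flip: sum_distrib_right)
    finally show ?thesis .
  qed
  define u where "u x = (if x \<in> V then 1 / real (card V) else 0)" for x
  have cpos: "real (card V) > 0" using fin ne by (simp add: card_gt_0_iff)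
  have ust: "is_stationary V P u"
    unfolding is_stationary_def
  proof (intro conjI ballI allI impI)
    show "(\<Sum>x\<in>V. u x) = 1" using cpos by (simp add: u_def)
    fix y assume "y \<in> V"
    have "(\<Sum>x\<in>V. u x * P x y) = 1 / real (card V) * (\<Sum>x\<in>V. P x y)"
      by (simp add: u_def sum_distrib_left)
    then show "(\<Sum>x\<in>V. u x * P x y) = u y" using cols \<open>y \<in> V\<close> by (simp add: u_def)
  qed (auto simp: u_def)
  have "(\<lambda>t. (1 - \<kappa>) ^ t) \<longlonglongrightarrow> 0"
    by (rule LIMSEQ_power_zero) (use kappa in auto)
  then have lim0: "(\<lambda>t. 2 * ((1 - \<kappa>) ^ t * D)) \<longlonglongrightarrow> 0"
    by (rule tendsto_mult_right_zero[OF tendsto_mult_left_zero])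
  have uniq: "\<pi> = u" if "is_stationary V P \<pi>" for \<pi>
  proof
    fix y
    show "\<pi> y = u y"
    proof (cases "y \<in> V")
      case False
      then show ?thesis using that by (simp add: is_stationary_def u_def)
    next
      case True
      \<comment> \<open>Testing against the indicator of \<open>y\<close> reads off the mass at
        \<open>y\<close>. Both stationary distributions stay within
        \<open>(1 - \<kappa>) ^ t * D\<close> of the same number \<open>Q t g y\<close> for every
        \<open>t\<close>, hence agree in the limit.\<close>
      define g where "g x = (of_bool (x \<in> {y}) :: real)" for x
      have Lg: "L 1 g" unfolding g_def by (rule ind)
      have gs: "(\<Sum>z\<in>V. \<rho> z * g z) = \<rho> y" for \<rho>
      proof -
        have "(\<Sum>z\<in>V. \<rho> z * g z) = (\<Sum>z\<in>V. if z = y then \<rho> z else 0)"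
          by (rule sum.cong) (auto simp: g_def)
        then show ?thesis using True fin by simp
      qed
      have "\<bar>\<pi> y - u y\<bar> \<le> 2 * ((1 - \<kappa>) ^ t * D)" for t
        using near[OF that Lg True, of t] near[OF ust Lg True, of t] by (simp add: gs)
      then have "\<bar>\<pi> y - u y\<bar> \<le> 0"
        by (intro LIMSEQ_le_const[OF lim0]) auto
      then show ?thesis by simp
    qed
  qed
  have sd: "stationary_dist V P = u"
    unfolding stationary_dist_def using ust uniq by (rule the_equality)
  have mass: "(\<Sum>y\<in>V. trans_pow V P t x y) = 1" if "x \<in> V" for x t
  proof (induction t)
    case 0
    then show ?case using Q0[OF that, of "\<lambda>_. 1"] by (simp add: Q_def)
  next
    case (Suc t)
    then show ?case using trans_pow_Suc_op[of V P t x "\<lambda>_. 1"] by (simp add: markov_op_def rows)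
  qed
  have tv: "1 / 2 * (\<Sum>y\<in>V. \<bar>trans_pow V P t x y - u y\<bar>) \<le> 1 / 4" if "x \<in> V" for x
  proof -
    \<comment> \<open>The event on which the \<open>t\<close>-step law is at least the uniform one.
      As the differences \<open>h\<close> sum to zero, half of their absolute sum is the difference
      of the two probabilities of this event.\<close>
    define A where "A = {y. trans_pow V P t x y \<ge> u y}"
    define h where "h y = trans_pow V P t x y - u y" for y
    have h0: "(\<Sum>y\<in>V. h y) = 0"
      using mass[OF that, of t] ust by (simp add: h_def sum_subtractf is_stationary_def)
    have "(\<Sum>y\<in>V. \<bar>h y\<bar>) = (\<Sum>y\<in>V. 2 * (h y * of_bool (y \<in> A)) - h y)"
      by (rule sum.cong) (auto simp: h_def A_def)
    also have "\<dots> = 2 * (\<Sum>y\<in>V. h y * of_bool (y \<in> A))"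
      by (simp only: sum_subtractf h0 sum_distrib_left)
    also have "(\<Sum>y\<in>V. h y * of_bool (y \<in> A)) = Q t (\<lambda>y. of_bool (y \<in> A)) x - (\<Sum>z\<in>V. u z * of_bool (z \<in> A))"
      by (simp only: Q_def h_def left_diff_distrib sum_subtractf)
    also have "\<dots> \<le> 1 / 4"
      using near[OF ust ind that, of t A] t by linarith
    finally show ?thesis by (simp add: h_def)
  qed
  have "(MAX x\<in>V. 1 / 2 * (\<Sum>y\<in>V. \<bar>trans_pow V P t x y - stationary_dist V P y\<bar>)) \<le> 1 / 4"
    unfolding sd
  proof (rule Max.boundedI)
    fix a assume "a \<in> (\<lambda>x. 1 / 2 * (\<Sum>y\<in>V. \<bar>trans_pow V P t x y - u y\<bar>)) ` V"
    then show "a \<le> 1 / 4" using tv by (elim imageE) (simp only:)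
  qed (use fin ne in auto)
  then show ?thesis
    unfolding mixing_time_def by (intro Inf_lower) auto
qed

section \<open>Signed vertices\<close>

text \<open>The game with vector $\pm(e_p - e_q)$, where $e_{-i} = -e_i$ and $e_0 = 0$.\<close>

definition game :: "int \<Rightarrow> int \<Rightarrow> sedge" where
  "game p q =
     (if p = 0 then HalfEdge (nat \<bar>q\<bar>)
      else if q = 0 then HalfEdge (nat \<bar>p\<bar>)
      else if q = - p then Loop (nat \<bar>p\<bar>)
      else if (p > 0) = (q > 0) then neg_edge (nat \<bar>p\<bar>) (nat \<bar>q\<bar>)
      else pos_edge (nat \<bar>p\<bar>) (nat \<bar>q\<bar>))"

text \<open>For negative \<open>p\<close> the second term gives the entry -1 at coordinate
  \<open>- p\<close>; for \<open>p = 0\<close> the two terms cancel.\<close>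

definition signed_vec :: "int \<Rightarrow> nat \<Rightarrow> real" where
  "signed_vec p k = of_bool (int k = p) - of_bool (int k = - p)"

text \<open>The inner product of the vectors of two signed vertices; the terms cancel as soon as one
  of them is \<open>0\<close>.\<close>

definition vertex_inner :: "int \<Rightarrow> int \<Rightarrow> real" where
  "vertex_inner p q = of_bool (p = q) - of_bool (p = - q)"

definition triple :: "int \<Rightarrow> int \<Rightarrow> int \<Rightarrow> sedge set" where
  "triple p q r = {game p q, game q r, game r p}"

lemma game_commute: "game p q = game q p"
  by (auto simp: game_def neg_edge_def pos_edge_def max.commute min.commute)

lemma game_minus: "game (- p) (- q) = game p q"
  by (auto simp: game_def)

lemma neg_edge_eq_iff: "neg_edge i j = neg_edge k l \<longleftrightarrow> (k = i \<and> l = j) \<or> (k = j \<and> l = i)"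
  by (auto simp: neg_edge_def max_def min_def split: if_splits)

lemma pos_edge_eq_iff: "pos_edge i j = pos_edge k l \<longleftrightarrow> (k = i \<and> l = j) \<or> (k = j \<and> l = i)"
  by (auto simp: pos_edge_def max_def min_def split: if_splits)

lemma edge_distinct [simp]:
  "neg_edge i j \<noteq> pos_edge k l" "pos_edge i j \<noteq> neg_edge k l"
  "neg_edge i j \<noteq> HalfEdge k" "neg_edge i j \<noteq> Loop k"
  "pos_edge i j \<noteq> HalfEdge k" "pos_edge i j \<noteq> Loop k"
  "HalfEdge k \<noteq> neg_edge i j" "Loop k \<noteq> neg_edge i j"
  "HalfEdge k \<noteq> pos_edge i j" "Loop k \<noteq> pos_edge i j"
  by (auto simp: neg_edge_def pos_edge_def)

lemma edge_in_complete_D: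
  assumes "i \<in> {1..n}" "j \<in> {1..n}" "i \<noteq> j"
  shows "neg_edge i j \<in> complete_D n" "pos_edge i j \<in> complete_D n"
  using assms by (auto simp: complete_D_def neg_edge_def pos_edge_def max_def min_def)

lemma nat_abs_eq_iff: "nat \<bar>a\<bar> = nat \<bar>b\<bar> \<longleftrightarrow> b = a \<or> b = - a"
  by auto

text \<open>The kind of the edge records whether a zero, an antipodal pair or a change of sign is
  involved, and its endpoints record the absolute values. Only the order and a common sign remain
  open.\<close>

lemma game_eqD:
  assumes "game p q = game p' q'" "p \<noteq> q" "p' \<noteq> q'"
  shows "(p' = p \<and> q' = q) \<or> (p' = q \<and> q' = p) \<or> (p' = - p \<and> q' = - q) \<or> (p' = - q \<and> q' = - p)"
proof -
  show ?thesis using assms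
    by (simp add: game_def neg_edge_eq_iff pos_edge_eq_iff nat_abs_eq_iff split: if_split_asm) (smt (verit))+
qed

lemma signed_vec_0 [simp]: "signed_vec 0 k = 0"
  by (simp add: signed_vec_def)

lemma signed_vec_minus: "signed_vec (- p) k = - signed_vec p k"
  by (simp add: signed_vec_def)

lemma basis_vec_nat_abs: "p \<noteq> 0 \<Longrightarrow> basis_vec (nat \<bar>p\<bar>) k = (if p > 0 then signed_vec p k else - signed_vec p k)"
  by (auto simp: basis_vec_def signed_vec_def)

text \<open>For two negative vertices the larger one has the smaller absolute value, and the two
  changes of sign cancel; so in every case the edge vector is the larger signed vertex minus the
  smaller one.\<close>

lemma edge_vec_game:
  assumes "p \<noteq> q"
  shows "edge_vec (game p q) k = (if p > q then 1 else - 1) * (signed_vec p k - signed_vec q k)"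
proof -
  have n: "edge_vec (neg_edge (nat \<bar>a\<bar>) (nat \<bar>b\<bar>)) k =
      (if \<bar>a\<bar> > \<bar>b\<bar> then 1 else - 1) * (basis_vec (nat \<bar>a\<bar>) k - basis_vec (nat \<bar>b\<bar>) k)"
    if "\<bar>a\<bar> \<noteq> \<bar>b\<bar>" for a b
    using that by (auto simp: neg_edge_def max_def min_def)
  have p: "edge_vec (pos_edge (nat \<bar>a\<bar>) (nat \<bar>b\<bar>)) k = basis_vec (nat \<bar>a\<bar>) k + basis_vec (nat \<bar>b\<bar>) k" for a b
    by (auto simp: pos_edge_def max_def min_def)
  consider "p = 0" | "q = 0" "p \<noteq> 0" | "q = - p" "p \<noteq> 0" "q \<noteq> 0"
    | "q \<noteq> - p" "p \<noteq> 0" "q \<noteq> 0" "(p > 0) = (q > 0)"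
    | "q \<noteq> - p" "p \<noteq> 0" "q \<noteq> 0" "(p > 0) \<noteq> (q > 0)" by blast
  then show ?thesis
  proof cases
    case 1
    then show ?thesis using assms by (simp add: game_def basis_vec_nat_abs)
  next
    case 2
    then show ?thesis by (simp add: game_def basis_vec_nat_abs)
  next
    case 3
    then show ?thesis by (simp add: game_def basis_vec_nat_abs signed_vec_minus)
  next
    case 4
    then have "\<bar>p\<bar> \<noteq> \<bar>q\<bar>" using assms by auto
    then show ?thesis using 4 assms by (auto simp: game_def n basis_vec_nat_abs)
  next
    case 5
    then show ?thesis using assms by (auto simp: game_def p basis_vec_nat_abs)
  qed
qed

lemma signed_vec_nat_abs: "signed_vec q (nat \<bar>p\<bar>) = (if p < 0 then - vertex_inner p q else vertex_inner p q)"
  by (auto simp: signed_vec_def vertex_inner_def)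

lemma triple_rotate: "triple q r p = triple p q r"
  by (auto simp: triple_def)

lemma triple_flip: "triple r q p = triple p q r"
  using game_commute by (auto simp: triple_def)

lemma triple_minus: "triple (- p) (- q) (- r) = triple p q r"
  by (simp add: triple_def game_minus)

section \<open>Games, arrows and generators on the signed vertices of each type\<close>

locale coxeter =
  fixes \<Phi> :: coxeter_type and n :: nat
begin

definition verts :: "int set" where
  "verts = {p. \<bar>p\<bar> \<le> int n \<and> (p = 0 \<longrightarrow> \<Phi> = TypeB)}"

definition joined :: "int \<Rightarrow> int \<Rightarrow> bool" where
  "joined p q \<longleftrightarrow> p \<in> verts \<and> q \<in> verts \<and> p \<noteq> q \<and> (p = - q \<longrightarrow> \<Phi> = TypeC)"

text \<open>In the tournament, the game of $e_p - e_q$ contributes $+\frac12(e_p - e_q)$ to the score. The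
  vector of the game is $e_p - e_q$ rather than $e_q - e_p$ if and only if $p > q$.\<close>

definition arrow :: "tournament \<Rightarrow> int \<Rightarrow> int \<Rightarrow> bool" where
  "arrow w p q \<longleftrightarrow> joined p q \<and> w (game p q) = (if p > q then 1 else 0)"

lemma finite_verts [simp]: "finite verts"
  by (rule finite_subset[of _ "{- int n..int n}"]) (auto simp: coxeter.verts_def)

lemma uminus_verts [simp]: "- p \<in> verts \<longleftrightarrow> p \<in> verts"
  by (auto simp: coxeter.verts_def)

lemma joined_sym: "joined p q \<longleftrightarrow> joined q p"
  by (auto simp: coxeter.joined_def)

lemma joined_minus: "joined (- p) (- q) \<longleftrightarrow> joined p q"
  by (auto simp: coxeter.joined_def)

lemma joined_neq: "joined p q \<Longrightarrow> p \<noteq> q"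
  by (simp add: coxeter.joined_def)

lemma arrow_joined: "arrow w p q \<Longrightarrow> joined p q"
  by (simp add: arrow_def)

lemma arrow_mirror: "arrow w (- q) (- p) \<longleftrightarrow> arrow w p q"
  using joined_minus[of q p] joined_sym[of q p] game_minus[of q p] game_commute[of p q]
  by (auto simp: arrow_def)

lemma mem_complete_graph:
  "e \<in> complete_graph \<Phi> n \<longleftrightarrow> (\<exists>p q. joined p q \<and> e = game p q)"
proof
  assume "e \<in> complete_graph \<Phi> n"
  then consider i j where "e = NegEdge i j" "i \<in> {1..n}" "j \<in> {1..n}" "i > j"
    | i j where "e = PosEdge i j" "i \<in> {1..n}" "j \<in> {1..n}" "i > j"
    | i where "e = HalfEdge i" "i \<in> {1..n}" "\<Phi> = TypeB"
    | i where "e = Loop i" "i \<in> {1..n}" "\<Phi> = TypeC"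
    by (cases \<Phi>) (auto simp: complete_D_def)
  then show "\<exists>p q. joined p q \<and> e = game p q"
  proof cases
    case 1
    then have "joined (int i) (int j) \<and> e = game (int i) (int j)"
      by (auto simp: coxeter.joined_def coxeter.verts_def game_def neg_edge_def)
    then show ?thesis by blast
  next
    case 2
    then have "joined (int i) (- int j) \<and> e = game (int i) (- int j)"
      by (auto simp: coxeter.joined_def coxeter.verts_def game_def pos_edge_def)
    then show ?thesis by blast
  next
    case 3
    then have "joined (int i) 0 \<and> e = game (int i) 0"
      by (auto simp: coxeter.joined_def coxeter.verts_def game_def)
    then show ?thesis by blast
  next
    case 4
    then have "joined (int i) (- int i) \<and> e = game (int i) (- int i)"
      by (auto simp: coxeter.joined_def coxeter.verts_def game_def)
    then show ?thesis by blast
  qed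
next
  assume "\<exists>p q. joined p q \<and> e = game p q"
  then obtain p q where *: "joined p q" "e = game p q" by blast
  have r: "nat \<bar>a\<bar> \<in> {1..n}" if "a \<in> verts" "a \<noteq> 0" for a
    using that by (auto simp: coxeter.verts_def)
  have ne: "neg_edge (nat \<bar>a\<bar>) (nat \<bar>b\<bar>) \<in> complete_D n" "pos_edge (nat \<bar>a\<bar>) (nat \<bar>b\<bar>) \<in> complete_D n"
    if "a \<in> verts" "b \<in> verts" "a \<noteq> 0" "b \<noteq> 0" "\<bar>a\<bar> \<noteq> \<bar>b\<bar>" for a b
  proof -
    have *: "nat \<bar>a\<bar> \<noteq> nat \<bar>b\<bar>" using that(5) by simp
    show "neg_edge (nat \<bar>a\<bar>) (nat \<bar>b\<bar>) \<in> complete_D n" "pos_edge (nat \<bar>a\<bar>) (nat \<bar>b\<bar>) \<in> complete_D n"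
      by (rule edge_in_complete_D[OF r[OF that(1,3)] r[OF that(2,4)] *])+
  qed
  have D: "complete_D n \<subseteq> complete_graph \<Phi> n" by (cases \<Phi>) auto
  have z: "p = 0 \<or> q = 0 \<Longrightarrow> \<Phi> = TypeB" using *(1) by (auto simp: coxeter.joined_def coxeter.verts_def)
  have v: "p \<in> verts" "q \<in> verts" "p \<noteq> q" "p = - q \<Longrightarrow> \<Phi> = TypeC"
    using *(1) by (auto simp: coxeter.joined_def)
  consider "p = 0" "q \<noteq> 0" | "q = 0" "p \<noteq> 0" | "q = - p" "p \<noteq> 0" "q \<noteq> 0"
    | "\<bar>p\<bar> \<noteq> \<bar>q\<bar>" "p \<noteq> 0" "q \<noteq> 0" using v(3) by linarith
  then show "e \<in> complete_graph \<Phi> n"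
  proof cases
    case 4
    then show ?thesis using ne[OF v(1,2)] D *(2) by (auto simp: game_def)
  qed (use r[OF v(1)] r[OF v(2)] z v(4) *(2) in \<open>auto simp: game_def\<close>)
qed

text \<open>A half edge is a game with \<open>0\<close>, a loop a game between antipodes, and a
  positive edge is obtained by giving one end a minus sign. With suitable signs each of the five
  shapes of generators closes up to a triangle.\<close>

lemma generator_gamesE:
  assumes "G \<in> generator_games \<Phi> n"
  obtains p q r where "joined p q" "joined q r" "joined r p" "G = triple p q r"
proof -
  have neg: "game (int i) (int j) = neg_edge i j" if "i \<noteq> 0" "j \<noteq> 0" "i \<noteq> j" for i j
    using that by (auto simp: game_def)
  have pos: "game (int i) (- int j) = pos_edge i j" "game (- int i) (int j) = pos_edge i j"
    if "i \<noteq> 0" "j \<noteq> 0" "i \<noteq> j" for i j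
    using that by (auto simp: game_def)
  have c: "neg_edge i j = neg_edge j i" "pos_edge i j = pos_edge j i" for i j
    by (auto simp: neg_edge_eq_iff pos_edge_eq_iff)
  have v: "int i \<in> verts" if "i \<in> {1..n}" for i using that by (auto simp: coxeter.verts_def)
  consider i j k where "G = {neg_edge i j, neg_edge j k, neg_edge i k}"
      "{i, j, k} \<subseteq> {1..n}" "distinct [i, j, k]"
    | i j k where "G = {neg_edge i j, pos_edge j k, pos_edge i k}"
      "{i, j, k} \<subseteq> {1..n}" "distinct [i, j, k]"
    | i j where "\<Phi> = TypeB" "G = {neg_edge i j, HalfEdge i, HalfEdge j}" "{i, j} \<subseteq> {1..n}" "i \<noteq> j"
    | i j where "\<Phi> = TypeB" "G = {pos_edge i j, HalfEdge i, HalfEdge j}" "{i, j} \<subseteq> {1..n}" "i \<noteq> j"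
    | i j where "\<Phi> = TypeC" "G = {neg_edge i j, pos_edge i j, Loop i}" "{i, j} \<subseteq> {1..n}" "i \<noteq> j"
    using assms by (cases \<Phi>) (simp_all add: triangles_def pairs_def clovers_def, blast+)
  then show thesis
  proof cases
    case 1
    show thesis
    proof (rule that[of "int i" "int j" "int k"])
      show "G = triple (int i) (int j) (int k)"
        using 1 by (auto simp: triple_def neg c)
    qed (use 1 v in \<open>auto simp: coxeter.joined_def coxeter.uminus_verts\<close>)
  next
    case 2
    show thesis
    proof (rule that[of "int i" "int j" "- int k"])
      show "G = triple (int i) (int j) (- int k)"
        using 2 by (auto simp: triple_def neg pos c)
    qed (use 2 v in \<open>auto simp: coxeter.joined_def coxeter.uminus_verts\<close>)
  next
    case 3
    then have "0 \<in> verts" by (simp add: coxeter.verts_def)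
    show thesis
    proof (rule that[of "int i" "int j" 0])
      show "G = triple (int i) (int j) 0"
        using 3 by (auto simp: triple_def neg game_def)
    qed (use 3 v \<open>0 \<in> verts\<close> in \<open>auto simp: coxeter.joined_def coxeter.uminus_verts\<close>)
  next
    case 4
    then have "0 \<in> verts" by (simp add: coxeter.verts_def)
    show thesis
    proof (rule that[of "int i" "- int j" 0])
      show "G = triple (int i) (- int j) 0"
        using 4 by (auto simp: triple_def pos game_def)
    qed (use 4 v \<open>0 \<in> verts\<close> in \<open>auto simp: coxeter.joined_def coxeter.uminus_verts\<close>)
  next
    case 5
    show thesis
    proof (rule that[of "int i" "- int i" "int j"])
      show "G = triple (int i) (- int i) (int j)"
        using 5 by (auto simp: triple_def neg pos c game_def)
    qed (use 5 v in \<open>auto simp: coxeter.joined_def coxeter.uminus_verts\<close>)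
  qed
qed

lemma triple_in_clovers:
  assumes "joined p (- p)" "joined p r" "joined r (- p)"
  shows "triple p (- p) r \<in> clovers n"
proof -
  have C: "\<Phi> = TypeC" using assms(1) by (auto simp: coxeter.joined_def)
  have v: "p \<noteq> 0" "r \<noteq> 0" "\<bar>p\<bar> \<noteq> \<bar>r\<bar>" "nat \<bar>p\<bar> \<in> {1..n}" "nat \<bar>r\<bar> \<in> {1..n}" "nat \<bar>p\<bar> \<noteq> nat \<bar>r\<bar>"
    using assms C by (auto simp: coxeter.joined_def coxeter.verts_def)
  have c: "neg_edge i j = neg_edge j i" "pos_edge i j = pos_edge j i" for i j
    by (auto simp: neg_edge_eq_iff pos_edge_eq_iff)
  have "triple p (- p) r = {neg_edge (nat \<bar>p\<bar>) (nat \<bar>r\<bar>), pos_edge (nat \<bar>p\<bar>) (nat \<bar>r\<bar>), Loop (nat \<bar>p\<bar>)}"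
    using v by (auto simp: triple_def game_def c)
  then show ?thesis using v(4-6) unfolding clovers_def by blast
qed

text \<open>Rotation moves a zero or an antipodal pair to a fixed place, which gives a neutral pair
  or a clover. Otherwise the signs decide: three equal signs give three negative edges, and one
  deviating sign gives one negative and two positive edges.\<close>

lemma triple_in_generator_games:
  assumes "joined p q" "joined q r" "joined r p"
  shows "triple p q r \<in> generator_games \<Phi> n"
proof -
  have c: "neg_edge i j = neg_edge j i" "pos_edge i j = pos_edge j i" for i j
    by (auto simp: neg_edge_eq_iff pos_edge_eq_iff)
  have zero: "triple a b 0 \<in> generator_games \<Phi> n" if "joined a b" "joined b 0" "joined 0 a" for a b
  proof -
    have v: "\<Phi> = TypeB" "a \<noteq> 0" "b \<noteq> 0" "\<bar>a\<bar> \<noteq> \<bar>b\<bar>" "nat \<bar>a\<bar> \<in> {1..n}" "nat \<bar>b\<bar> \<in> {1..n}"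
      "nat \<bar>a\<bar> \<noteq> nat \<bar>b\<bar>"
      using that by (auto simp: coxeter.joined_def coxeter.verts_def)
    have "triple a b 0 = {neg_edge (nat \<bar>a\<bar>) (nat \<bar>b\<bar>), HalfEdge (nat \<bar>a\<bar>), HalfEdge (nat \<bar>b\<bar>)} \<or>
       triple a b 0 = {pos_edge (nat \<bar>a\<bar>) (nat \<bar>b\<bar>), HalfEdge (nat \<bar>a\<bar>), HalfEdge (nat \<bar>b\<bar>)}"
      using v by (auto simp: triple_def game_def)
    then have "triple a b 0 \<in> pairs n" using v(5-7) unfolding pairs_def by blast
    then show ?thesis using v(1) by simp
  qed
  have anti: "triple a (- a) b \<in> generator_games \<Phi> n" if "joined a (- a)" "joined a b" "joined b (- a)" for a b
  proof -
    have "\<Phi> = TypeC" using that(1) by (auto simp: coxeter.joined_def)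
    then show ?thesis using triple_in_clovers[OF that] by simp
  qed
  have r1: "triple q r p = triple p q r" and r2: "triple r p q = triple p q r"
    by (auto simp: triple_def)
  consider "r = 0" | "p = 0" | "q = 0" | "q = - p" | "r = - q" | "p = - r"
    | "p \<noteq> 0" "q \<noteq> 0" "r \<noteq> 0" "q \<noteq> - p" "r \<noteq> - q" "p \<noteq> - r" by blast
  then show ?thesis
  proof cases
    case 1
    then show ?thesis using zero[of p q] assms by simp
  next
    case 2
    then show ?thesis using zero[of q r] assms r1 by simp
  next
    case 3
    then show ?thesis using zero[of r p] assms r2 by simp
  next
    case 4
    then show ?thesis using anti[of p r] assms joined_sym by auto
  next
    case 5
    then show ?thesis using anti[of q p] assms joined_sym r1 by auto
  next
    case 6
    then show ?thesis using anti[of r q] assms joined_sym r2 by auto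
  next
    case 7
    let ?i = "nat \<bar>p\<bar>" and ?j = "nat \<bar>q\<bar>" and ?k = "nat \<bar>r\<bar>"
    have v: "{?i, ?j, ?k} \<subseteq> {1..n}" "distinct [?i, ?j, ?k]"
    proof -
      have "nat \<bar>a\<bar> \<in> {1..n}" if "a \<in> verts" "a \<noteq> 0" for a
        using that by (auto simp: verts_def)
      then show "{?i, ?j, ?k} \<subseteq> {1..n}" using 7 assms unfolding joined_def by blast
      show "distinct [?i, ?j, ?k]"
        using 7 assms unfolding joined_def distinct.simps list.set nat_abs_eq_iff
        by (metis empty_iff insert_iff minus_minus nat_abs_eq_iff)
    qed
    have v': "{?j, ?k, ?i} \<subseteq> {1..n}" "distinct [?j, ?k, ?i]" "{?k, ?i, ?j} \<subseteq> {1..n}" "distinct [?k, ?i, ?j]"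
      using v by auto
    have "triple p q r = {neg_edge ?i ?j, neg_edge ?j ?k, neg_edge ?i ?k} \<or>
      triple p q r = {neg_edge ?i ?j, pos_edge ?j ?k, pos_edge ?i ?k} \<or>
      triple p q r = {neg_edge ?j ?k, pos_edge ?k ?i, pos_edge ?j ?i} \<or>
      triple p q r = {neg_edge ?k ?i, pos_edge ?i ?j, pos_edge ?k ?j}"
    proof -
      have "game p q = (if (p > 0) = (q > 0) then neg_edge ?i ?j else pos_edge ?i ?j)"
        "game q r = (if (q > 0) = (r > 0) then neg_edge ?j ?k else pos_edge ?j ?k)"
        "game r p = (if (r > 0) = (p > 0) then neg_edge ?k ?i else pos_edge ?k ?i)"
        using 7 by (simp_all add: game_def)
      then show ?thesis
        unfolding triple_def
        by (cases "p > 0"; cases "q > 0"; cases "r > 0")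
          (simp_all only: simp_thms if_True if_False insert_commute c[of ?k ?i] c[of ?j ?i] c[of ?k ?j])
    qed
    then have "triple p q r \<in> triangles n"
      using v v' unfolding triangles_def by blast
    then show ?thesis by (cases \<Phi>) auto
  qed
qed

text \<open>Every clover contains a loop, and a loop is a game between antipodes.\<close>

lemma triple_not_clover:
  assumes "p \<noteq> - q" "q \<noteq> - r" "r \<noteq> - p"
  shows "triple p q r \<notin> clovers n"
proof
  assume "triple p q r \<in> clovers n"
  then obtain i where "Loop i \<in> triple p q r" by (auto simp: clovers_def)
  then show False using assms by (auto simp: triple_def game_def split: if_splits)
qed

end

section \<open>Reversal of games, scores and neutrality\<close>

lemma reverse_games_in_tournaments:
  assumes "w \<in> tournaments E" "X \<subseteq> E"
  shows "reverse_games w X \<in> tournaments E"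
proof -
  have "reverse_games w X e \<in> {0, 1}" if "e \<in> E" for e
    using assms that by (auto simp: tournaments_def reverse_games_def PiE_def Pi_def)
  moreover have "reverse_games w X e = undefined" if "e \<notin> E" for e
    using assms that by (auto simp: tournaments_def reverse_games_def PiE_def extensional_def)
  ultimately show ?thesis by (auto simp: tournaments_def PiE_def extensional_def)
qed

lemma tournament_le_1: "w \<in> tournaments E \<Longrightarrow> e \<in> E \<Longrightarrow> w e \<le> 1"
  by (fastforce simp: tournaments_def PiE_def Pi_def)

lemma tournament_eqI:
  assumes "w \<in> tournaments E" "w' \<in> tournaments E" "\<And>e. e \<in> E \<Longrightarrow> w e = w' e"
  shows "w = w'"
  using assms unfolding tournaments_def by (rule PiE_ext)

lemma score_on_reverse_games:
  assumes "w \<in> tournaments E" "X \<subseteq> E" "finite E"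
  shows "score_on E (reverse_games w X) k = score_on E w k - 2 * score_on X w k"
proof -
  have "score_on E (reverse_games w X) k
    = (\<Sum>e\<in>E. (real (w e) - 1 / 2) * edge_vec e k
        - (if e \<in> X then 2 * ((real (w e) - 1 / 2) * edge_vec e k) else 0))"
    unfolding score_on_def
  proof (rule sum.cong)
    fix e assume "e \<in> E"
    then have "w e \<le> 1" using assms tournament_le_1 by blast
    then show "(real (reverse_games w X e) - 1 / 2) * edge_vec e k
      = (real (w e) - 1 / 2) * edge_vec e k - (if e \<in> X then 2 * ((real (w e) - 1 / 2) * edge_vec e k) else 0)"
      by (simp add: reverse_games_def of_nat_diff algebra_simps)
  qed simp
  also have "\<dots> = score_on E w k - 2 * score_on X w k"
    using assms by (simp add: score_on_def sum_subtractf sum.inter_restrict[symmetric] Int_absorb1 sum_distrib_left)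
  finally show ?thesis .
qed

context coxeter
begin

abbreviation "games \<equiv> complete_graph \<Phi> n"

lemma finite_games: "finite games"
proof -
  have "games \<subseteq> (\<lambda>(p, q). game p q) ` (verts \<times> verts)"
    by (auto simp: mem_complete_graph joined_def)
  then show ?thesis by (rule finite_subset) simp
qed

lemma game_in_games: "joined p q \<Longrightarrow> game p q \<in> games"
  using mem_complete_graph by blast

lemma generator_subset_games: "G \<in> generator_games \<Phi> n \<Longrightarrow> G \<subseteq> games"
  by (elim generator_gamesE) (auto simp: triple_def game_in_games)

lemma games_distinct_triple:
  assumes "joined p q" "joined q r" "joined r p"
  shows "game p q \<noteq> game q r" "game q r \<noteq> game r p" "game r p \<noteq> game p q"
proof -
  have "game a b \<noteq> game b c" if "joined a b" "joined b c" "joined c a" for a b c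
  proof
    assume "game a b = game b c"
    \<comment> \<open>The case that survives distinctness has \<open>b = 0\<close> and
      \<open>c = - a\<close>. But \<open>0\<close> is a vertex only in type B, and antipodes are
      joined only in type C.\<close>
    from game_eqD[OF this] that show False
      by (auto simp: joined_def verts_def)
  qed
  then show "game p q \<noteq> game q r" "game q r \<noteq> game r p" "game r p \<noteq> game p q"
    using assms by blast+
qed

lemma not_arrow_iff:
  assumes "w \<in> tournaments games" "joined p q"
  shows "\<not> arrow w p q \<longleftrightarrow> arrow w q p"
proof -
  have "w (game p q) \<in> {0, 1}"
    using assms game_in_games by (auto simp: tournaments_def PiE_def Pi_def)
  then show ?thesis
    using assms(2) joined_sym[of p q] game_commute[of p q] joined_neq[OF assms(2)]
    by (auto simp: arrow_def)
qed

lemma arrow_asym: "arrow w p q \<Longrightarrow> \<not> arrow w q p"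
  using game_commute[of p q] joined_neq[of p q] by (auto simp: arrow_def split: if_splits)

lemma arrow_game_eqD:
  assumes "arrow w p q" "arrow w p' q'" "game p q = game p' q'"
  shows "(p' = p \<and> q' = q) \<or> (p' = - q \<and> q' = - p)"
  using game_eqD[OF assms(3)] arrow_asym[of w p q] assms(1,2) arrow_mirror[of w p q]
    joined_neq[OF arrow_joined[OF assms(1)]] joined_neq[OF arrow_joined[OF assms(2)]]
  by auto

lemma arrow_reverse_games:
  assumes "w \<in> tournaments games" "joined p q"
  shows "arrow (reverse_games w X) p q \<longleftrightarrow> (if game p q \<in> X then arrow w q p else arrow w p q)"
proof -
  have "w (game p q) \<in> {0, 1}"
    using assms game_in_games by (auto simp: tournaments_def PiE_def Pi_def)
  then show ?thesis
    using assms(2) joined_sym[of p q] game_commute[of p q] joined_neq[OF assms(2)]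
    by (auto simp: arrow_def reverse_games_def)
qed

lemma arrow_vec:
  assumes "w \<in> tournaments games" "joined p q"
  shows "(real (w (game p q)) - 1 / 2) * edge_vec (game p q) k =
    (if arrow w p q then 1 / 2 else - 1 / 2) * (signed_vec p k - signed_vec q k)"
proof -
  have "w (game p q) \<in> {0, 1}"
    using assms game_in_games by (auto simp: tournaments_def PiE_def Pi_def)
  then show ?thesis
    using assms(2) joined_neq[OF assms(2)]
    by (auto simp: arrow_def edge_vec_game)
qed

text \<open>The three difference vectors around a triangle sum to zero, and up to scaling this is
  their only linear relation. So the contributions cancel exactly when their signs agree, that is,
  when the triangle is cyclic.\<close>

lemma neutral_triple_iff:
  assumes w: "w \<in> tournaments games" and j: "joined p q" "joined q r" "joined r p"
  shows "neutral w (triple p q r) \<longleftrightarrow>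
    (arrow w p q \<and> arrow w q r \<and> arrow w r p) \<or> (arrow w q p \<and> arrow w r q \<and> arrow w p r)"
proof -
  define s where "s a b = (if arrow w a b then 1 / 2 else - 1 / 2 :: real)" for a b
  have sc: "score_on (triple p q r) w k =
      s p q * (signed_vec p k - signed_vec q k) + s q r * (signed_vec q k - signed_vec r k)
      + s r p * (signed_vec r k - signed_vec p k)" for k
    using games_distinct_triple[OF j] arrow_vec[OF w j(1), of k] arrow_vec[OF w j(2), of k]
      arrow_vec[OF w j(3), of k]
    by (simp add: score_on_def triple_def s_def)
  have eq: "s p q = s q r \<and> s q r = s r p" if "neutral w (triple p q r)"
  proof -
    \<comment> \<open>The coordinate at \<open>nat \<bar>a\<bar>\<close> is, up to sign, the inner
      product with the vector of \<open>a\<close>; taking \<open>a\<close> to be \<open>p\<close>,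
      \<open>q\<close> and \<open>r\<close> gives enough equations.\<close>
    have "s p q * (vertex_inner a p - vertex_inner a q) + s q r * (vertex_inner a q - vertex_inner a r)
      + s r p * (vertex_inner a r - vertex_inner a p) = 0" for a
    proof -
      have "score_on (triple p q r) w (nat \<bar>a\<bar>) = 0" using that by (simp add: neutral_def)
      then show ?thesis unfolding sc signed_vec_nat_abs by (auto simp: algebra_simps split: if_splits)
    qed
    from this[of p] this[of q] this[of r] j show ?thesis
      by (auto simp: vertex_inner_def joined_def verts_def of_bool_def split: if_splits)
  qed
  show ?thesis
  proof
    assume "neutral w (triple p q r)"
    then have "arrow w p q = arrow w q r \<and> arrow w q r = arrow w r p"
      using eq by (auto simp: s_def split: if_splits)
    then show "(arrow w p q \<and> arrow w q r \<and> arrow w r p) \<or> (arrow w q p \<and> arrow w r q \<and> arrow w p r)"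
      using not_arrow_iff[OF w] j by blast
  next
    assume "(arrow w p q \<and> arrow w q r \<and> arrow w r p) \<or> (arrow w q p \<and> arrow w r q \<and> arrow w p r)"
    then have "s p q = s q r" "s r p = s q r" using arrow_asym by (auto simp: s_def)
    then show "neutral w (triple p q r)" by (simp add: neutral_def sc fun_eq_iff algebra_simps)
  qed
qed

lemma Tour_tournaments: "w \<in> Tour \<Phi> n s \<Longrightarrow> w \<in> tournaments games"
  by (simp add: Tour_def)

text \<open>Reversal changes the score by minus twice that of \<open>X\<close>. Later arguments can
  therefore test neutrality by looking at the reversed tournament only.\<close>

lemma reverse_in_Tour_iff:
  assumes "w \<in> Tour \<Phi> n s" "X \<subseteq> games"
  shows "reverse_games w X \<in> Tour \<Phi> n s \<longleftrightarrow> neutral w X"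
  using assms reverse_games_in_tournaments[of w games X] score_on_reverse_games[of w games X, OF _ _ finite_games]
  by (auto simp: Tour_def neutral_def fun_eq_iff)

lemma reverse_triple_in_Tour_iff:
  assumes "w \<in> Tour \<Phi> n s" "joined p q" "joined q r" "joined r p"
  shows "reverse_games w (triple p q r) \<in> Tour \<Phi> n s \<longleftrightarrow>
    (arrow w p q \<and> arrow w q r \<and> arrow w r p) \<or> (arrow w q p \<and> arrow w r q \<and> arrow w p r)"
  using reverse_in_Tour_iff[OF assms(1) generator_subset_games[OF triple_in_generator_games[OF assms(2-4)]]]
    neutral_triple_iff[OF Tour_tournaments[OF assms(1)] assms(2-4)] by simp

section \<open>Connectivity\<close>

definition arrow_vector :: "int \<times> int \<Rightarrow> nat \<Rightarrow> real" where
  "arrow_vector a k = signed_vec (fst a) k - signed_vec (snd a) k"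

text \<open>The inner product of the two arrow vectors, expanded into inner products of signed
  vertices.\<close>

definition arrow_inner :: "int \<times> int \<Rightarrow> int \<times> int \<Rightarrow> real" where
  "arrow_inner a b = vertex_inner (fst a) (fst b) - vertex_inner (fst a) (snd b)
     - vertex_inner (snd a) (fst b) + vertex_inner (snd a) (snd b)"

lemma arrow_inner_self_pos:
  assumes "joined p q"
  shows "arrow_inner (p, q) (p, q) > 0"
  using assms by (auto simp: arrow_inner_def vertex_inner_def joined_def)

lemma sum_list_arrow_inner:
  assumes "\<And>k. (\<Sum>b\<leftarrow>M. arrow_vector b k) = 0"
  shows "(\<Sum>b\<leftarrow>M. arrow_inner a b) = 0"
proof -
  have "(\<Sum>b\<leftarrow>M. vertex_inner c (fst b) - vertex_inner c (snd b)) = 0" for c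
  proof -
    have "(\<Sum>b\<leftarrow>M. vertex_inner c (fst b) - vertex_inner c (snd b))
        = (if c < 0 then - 1 else 1) * (\<Sum>b\<leftarrow>M. arrow_vector b (nat \<bar>c\<bar>))"
      unfolding arrow_vector_def signed_vec_nat_abs
      by (induction M) (auto simp: algebra_simps)
    then show ?thesis using assms by simp
  qed
  from this[of "fst a"] this[of "snd a"] show ?thesis
    by (simp add: arrow_inner_def sum_list_addf sum_list_subtractf)
qed

text \<open>A negative inner product needs a coincidence of the head of one arrow with the tail of
  the other, possibly after mirroring, which leaves the arrow vector unchanged. The outer ends
  cannot be distinct antipodes outside type C: the two arrows would then be orthogonal, or at an
  acute angle if the middle vertex is \<open>0\<close>.\<close>

lemma obtuse_arrows_consecutive:
  assumes "joined p q" "joined p' q'" "arrow_inner (p, q) (p', q') < 0"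
  obtains a b c where "(a, b) = (p, q) \<or> (a, b) = (- q, - p)" "(b, c) = (p', q') \<or> (b, c) = (- q', - p')"
    "c = a \<or> joined a c"
proof -
  consider "q = p'" | "q = - q'" | "p = - p'" | "p = q'"
    using assms(3) by (auto simp: arrow_inner_def vertex_inner_def of_bool_def split: if_splits)
  then show thesis
  proof cases
    case 1
    show thesis by (rule that[of p q q']) (use 1 assms in \<open>auto simp: joined_def arrow_inner_def vertex_inner_def of_bool_def split: if_splits\<close>)
  next
    case 2
    show thesis by (rule that[of p q "- p'"]) (use 2 assms in \<open>auto simp: joined_def arrow_inner_def vertex_inner_def of_bool_def split: if_splits\<close>)
  next
    case 3
    show thesis by (rule that[of "- q" "- p" "q'"]) (use 3 assms in \<open>auto simp: joined_def arrow_inner_def vertex_inner_def of_bool_def split: if_splits\<close>)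
  next
    case 4
    show thesis by (rule that[of "- q" "- p" "- p'"]) (use 4 assms in \<open>auto simp: joined_def arrow_inner_def vertex_inner_def of_bool_def split: if_splits\<close>)
  qed
qed

text \<open>A zero sum could always be shortened: some arrow is obtuse to the first one, and
  replacing these two by their composition, which lies in \<open>A\<close> by closedness, keeps the
  sum.\<close>

lemma closed_arrows_sum_nonzero:
  assumes A: "\<And>p q. (p, q) \<in> A \<Longrightarrow> joined p q \<and> (q, p) \<notin> A \<and> (- q, - p) \<in> A"
    and closed: "\<And>p q r. (p, q) \<in> A \<Longrightarrow> (q, r) \<in> A \<Longrightarrow> joined p r \<Longrightarrow> (p, r) \<in> A"
    and M: "set M \<subseteq> A" "M \<noteq> []"
  shows "\<exists>k. (\<Sum>b\<leftarrow>M. arrow_vector b k) \<noteq> 0"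
  using M
proof (induction "length M" arbitrary: M rule: less_induct)
  case less
  obtain p q M' where M': "M = (p, q) # M'" using less.prems(2) by (cases M) auto
  have pq: "(p, q) \<in> A" "joined p q" using M' less.prems A by auto
  show ?case
  proof (rule ccontr)
    assume "\<not> ?thesis"
    then have z: "(\<Sum>b\<leftarrow>M. arrow_vector b k) = 0" for k by blast
    \<comment> \<open>The inner products with the first arrow add up to zero, and its own is
      positive.\<close>
    have "\<exists>b\<in>set M'. arrow_inner (p, q) b < 0"
    proof (rule ccontr)
      assume "\<not> ?thesis"
      then have "(\<Sum>b\<leftarrow>M'. arrow_inner (p, q) b) \<ge> 0"
        by (intro sum_list_nonneg) (auto simp: not_less)
      then show False
        using sum_list_arrow_inner[OF z, of "(p, q)"] arrow_inner_self_pos[OF pq(2)] M' by simp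
    qed
    then obtain p' q' where b: "(p', q') \<in> set M'" "arrow_inner (p, q) (p', q') < 0" by auto
    have b': "(p', q') \<in> A" "joined p' q'" using b M' less.prems A by auto
    obtain a e c where ace: "(a, e) = (p, q) \<or> (a, e) = (- q, - p)" "(e, c) = (p', q') \<or> (e, c) = (- q', - p')"
      "c = a \<or> joined a c"
      using obtuse_arrows_consecutive[OF pq(2) b'(2) b(2)] by blast
    have "(a, e) \<in> A" "(e, c) \<in> A" using ace(1,2) pq(1) b'(1) A by auto
    \<comment> \<open>The case \<open>c = a\<close> cannot occur, because \<open>A\<close> never
      contains an arrow together with its reverse.\<close>
    then have ac: "(a, c) \<in> A" using closed ace(3) A by blast
    have v: "arrow_vector (a, c) k = arrow_vector (p, q) k + arrow_vector (p', q') k" for k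
      using ace(1,2) by (auto simp: arrow_vector_def signed_vec_minus)
    let ?M = "(a, c) # remove1 (p', q') M'"
    have "\<exists>k. (\<Sum>b\<leftarrow>?M. arrow_vector b k) \<noteq> 0"
    proof (rule less.hyps)
      show "length ?M < length M" using b(1) length_pos_if_in_set[OF b(1)] M' by (simp add: length_remove1)
      show "set ?M \<subseteq> A" using ac less.prems(1) M' set_remove1_subset[of "(p', q')" M'] by auto
    qed simp
    moreover have "(\<Sum>b\<leftarrow>?M. arrow_vector b k) = 0" for k
      using z[of k] sum_list_map_remove1[OF b(1), of "\<lambda>b. arrow_vector b k"] M' v[of k] by simp
    ultimately show False by blast
  qed
qed

definition beaten :: "tournament \<Rightarrow> tournament \<Rightarrow> (int \<times> int) set" where
  "beaten x y = {(p, q). arrow x p q \<and> arrow y q p}"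

lemma exists_nontransitive_path:
  assumes x: "x \<in> Tour \<Phi> n s" and y: "y \<in> Tour \<Phi> n s" and ne: "x \<noteq> y"
  obtains p q r where "(p, q) \<in> beaten x y" "(q, r) \<in> beaten x y" "joined p r" "(p, r) \<notin> beaten x y"
proof (rule ccontr)
  note witness = that
  assume "\<not> thesis"
  then have closed: "(p, r) \<in> beaten x y"
    if "(p, q) \<in> beaten x y" "(q, r) \<in> beaten x y" "joined p r" for p q r
    using that witness by blast
  note xt = Tour_tournaments[OF x] and yt = Tour_tournaments[OF y]
  define B where "B = {e \<in> games. x e \<noteq> y e}"
  have finB: "finite B" using finite_games by (simp add: B_def)
  have Bne: "B \<noteq> {}" using tournament_eqI[OF xt yt] ne by (auto simp: B_def)
  have "\<exists>a. a \<in> beaten x y \<and> game (fst a) (snd a) = e" if "e \<in> B" for e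
  proof -
    from that have e: "e \<in> games" "x e \<noteq> y e" by (auto simp: B_def)
    then obtain p q where pq: "joined p q" "e = game p q" using mem_complete_graph by blast
    have le: "x e \<le> 1" "y e \<le> 1" using e xt yt tournament_le_1 by blast+
    have "(p, q) \<in> beaten x y \<or> (q, p) \<in> beaten x y"
      using pq e le game_commute[of p q] joined_sym[of p q] joined_neq[OF pq(1)]
      by (auto simp: beaten_def arrow_def)
    then show ?thesis using pq game_commute[of p q] by force
  qed
  \<comment> \<open>Each differing game carries two mirrored arrows with the same vector;
    \<open>a\<close> selects one of them, so that every game is counted once in the sum.\<close>
  then obtain a where a: "\<And>e. e \<in> B \<Longrightarrow> a e \<in> beaten x y" "\<And>e. e \<in> B \<Longrightarrow> game (fst (a e)) (snd (a e)) = e"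
    by metis
  obtain l where l: "set l = B" "distinct l" using finite_distinct_list[OF finB] by blast
  have "\<exists>k. (\<Sum>b\<leftarrow>map a l. arrow_vector b k) \<noteq> 0"
  proof (rule closed_arrows_sum_nonzero[of "beaten x y"])
    show "joined p q \<and> (q, p) \<notin> beaten x y \<and> (- q, - p) \<in> beaten x y" if "(p, q) \<in> beaten x y" for p q
      using that arrow_joined arrow_asym arrow_mirror[of x q p] arrow_mirror[of y p q]
      by (auto simp: beaten_def arrow_mirror)
    show "set (map a l) \<subseteq> beaten x y" using a(1) l(1) by auto
    show "map a l \<noteq> []" using l(1) Bne by auto
  qed (use closed in blast)
  moreover have "(\<Sum>b\<leftarrow>map a l. arrow_vector b k) = 0" for k
  proof -
    have "(\<Sum>b\<leftarrow>map a l. arrow_vector b k) = (\<Sum>e\<in>B. arrow_vector (a e) k)"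
      using l by (simp add: sum_list_distinct_conv_sum_set o_def)
    also have "\<dots> = (\<Sum>e\<in>B. (real (x e) - 1 / 2) * edge_vec e k - (real (y e) - 1 / 2) * edge_vec e k)"
    proof (rule sum.cong)
      fix e assume e: "e \<in> B"
      obtain p q where pq: "a e = (p, q)" by force
      have ar: "arrow x p q" "arrow y q p" "e = game p q"
        using a[OF e] pq by (auto simp: beaten_def)
      \<comment> \<open>The game contributes one half of the arrow vector to the score of
        \<open>x\<close> and minus one half to that of \<open>y\<close>, so the difference is the
        whole vector.\<close>
      show "arrow_vector (a e) k = (real (x e) - 1 / 2) * edge_vec e k - (real (y e) - 1 / 2) * edge_vec e k"
        using arrow_vec[OF xt arrow_joined[OF ar(1)], of k] arrow_vec[OF yt arrow_joined[OF ar(1)], of k]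
          ar arrow_asym[OF ar(2)] pq by (simp add: arrow_vector_def algebra_simps)
    qed simp
    also have "\<dots> = (\<Sum>e\<in>games. (real (x e) - 1 / 2) * edge_vec e k - (real (y e) - 1 / 2) * edge_vec e k)"
      by (rule sum.mono_neutral_left) (auto simp: B_def finite_games)
    also have "\<dots> = score_on games x k - score_on games y k"
      by (simp add: score_on_def sum_subtractf)
    also have "\<dots> = 0" using x y by (simp add: Tour_def)
    finally show ?thesis .
  qed
  ultimately show False by blast
qed

section \<open>Lipschitz functions and distances in the interchange graph\<close>

definition lipschitz :: "(nat \<Rightarrow> real) \<Rightarrow> real \<Rightarrow> real \<Rightarrow> (tournament \<Rightarrow> real) \<Rightarrow> bool" where
  "lipschitz s \<alpha> \<beta> f \<longleftrightarrow> (\<forall>u\<in>Tour \<Phi> n s. \<forall>G\<in>generator_games \<Phi> n. reverse_games u G \<in> Tour \<Phi> n s \<longrightarrow>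
     \<bar>f u - f (reverse_games u G)\<bar> \<le> (if G \<in> clovers n then \<beta> else \<alpha>))"

text \<open>Induction on the number of differing games. Reversing the triangle of a nontransitive
  path, in \<open>x\<close> or in \<open>y\<close>, settles two of these games and creates at most
  one new one, at cost at most \<open>\<alpha>\<close>.\<close>

lemma lipschitz_imp_diam:
  assumes lip: "lipschitz s \<alpha> \<beta> f" and ab: "\<beta> \<le> \<alpha>"
    and x: "x \<in> Tour \<Phi> n s" and y: "y \<in> Tour \<Phi> n s"
  shows "\<bar>f x - f y\<bar> \<le> \<alpha> * card {e \<in> games. x e \<noteq> y e}"
  using x y
proof (induction "card {e \<in> games. x e \<noteq> y e}" arbitrary: x y rule: less_induct)
  case less
  show ?case
  proof (cases "x = y")
    case True
    then show ?thesis by simp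
  next
    case False
    define B where "B u v = {e \<in> games. u e \<noteq> v e}" for u v :: tournament
    note xt = Tour_tournaments[OF less.prems(1)] and yt = Tour_tournaments[OF less.prems(2)]
    obtain p q r where pq: "(p, q) \<in> beaten x y" and qr: "(q, r) \<in> beaten x y"
      and pr: "joined p r" "(p, r) \<notin> beaten x y"
      using exists_nontransitive_path[OF less.prems False] by blast
    let ?T = "triple p q r"
    have j: "joined p q" "joined q r" "joined r p"
      using pq qr pr arrow_joined joined_sym by (auto simp: beaten_def)
    have T: "?T \<in> generator_games \<Phi> n" by (rule triple_in_generator_games[OF j])
    have lipT: "\<bar>f u - f (reverse_games u ?T)\<bar> \<le> \<alpha>"
      if "u \<in> Tour \<Phi> n s" "reverse_games u ?T \<in> Tour \<Phi> n s" for u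
      using lip that T ab unfolding lipschitz_def by (smt (verit))
    have g: "game p q \<in> B x y" "game q r \<in> B x y"
      using pq qr j game_commute[of p q] game_commute[of q r] joined_neq[OF j(1)] joined_neq[OF j(2)] game_in_games
      by (auto simp: B_def beaten_def arrow_def)
    have sub: "B (reverse_games x ?T) y \<subseteq> insert (game r p) (B x y - {game p q, game q r})"
      "B x (reverse_games y ?T) \<subseteq> insert (game r p) (B x y - {game p q, game q r})"
    proof -
      have flip: "1 - x e = y e \<and> 1 - y e = x e" if "e \<in> B x y" for e
        using that tournament_le_1[OF xt, of e] tournament_le_1[OF yt, of e] by (auto simp: B_def)
      show "B (reverse_games x ?T) y \<subseteq> insert (game r p) (B x y - {game p q, game q r})"
        "B x (reverse_games y ?T) \<subseteq> insert (game r p) (B x y - {game p q, game q r})"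
        using flip[OF g(1)] flip[OF g(2)] by (auto simp: B_def reverse_games_def triple_def)
    qed
    have "finite (B x y)" using finite_games by (simp add: B_def)
    moreover have "card {game p q, game q r} = 2" using games_distinct_triple(1)[OF j] by simp
    moreover have "{game p q, game q r} \<subseteq> B x y" using g by simp
    ultimately have "2 \<le> card (B x y)" "card (B x y - {game p q, game q r}) = card (B x y) - 2"
      by (metis card_mono) (use \<open>{game p q, game q r} \<subseteq> B x y\<close> \<open>card {game p q, game q r} = 2\<close> in
        \<open>simp only: card_Diff_subset finite.intros\<close>)
    then have "card (insert (game r p) (B x y - {game p q, game q r})) < card (B x y)"
      using card_insert_le_m1[of "card (B x y) - 1" "B x y - {game p q, game q r}" "game r p"] by linarith
    then have small: "card (B (reverse_games x ?T) y) < card (B x y)"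
      "card (B x (reverse_games y ?T)) < card (B x y)"
      using sub \<open>finite (B x y)\<close> by (meson card_mono finite.insertI finite_Diff le_less_trans)+
    have step: "\<alpha> + \<alpha> * card (B u v) \<le> \<alpha> * card (B x y)" if "card (B u v) < card (B x y)" "0 \<le> \<alpha>" for u v
    proof -
      have "\<alpha> * (1 + real (card (B u v))) \<le> \<alpha> * real (card (B x y))"
        using that by (intro mult_left_mono) auto
      then show ?thesis by (simp add: algebra_simps)
    qed
    \<comment> \<open>If \<open>x\<close> has the arrow from \<open>r\<close> to \<open>p\<close>,
      the triangle is cyclic in \<open>x\<close>. Otherwise \<open>x\<close> has the arrow from
      \<open>p\<close> to \<open>r\<close>, and so has \<open>y\<close> because
      \<open>(p, r)\<close> is not beaten; then the triangle is cyclic in \<open>y\<close>.\<close>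
    show ?thesis
    proof (cases "arrow x r p")
      case True
      then have V: "reverse_games x ?T \<in> Tour \<Phi> n s"
        using reverse_triple_in_Tour_iff[OF less.prems(1) j] pq qr by (auto simp: beaten_def)
      have "\<bar>f (reverse_games x ?T) - f y\<bar> \<le> \<alpha> * card (B (reverse_games x ?T) y)"
        using less.hyps[OF _ V less.prems(2)] small by (simp add: B_def)
      then show ?thesis
        using lipT[OF less.prems(1) V] step[OF small(1)] unfolding B_def by linarith
    next
      case False
      then have "arrow x p r" using not_arrow_iff[OF xt j(3)] by simp
      then have "arrow y p r" using pr not_arrow_iff[OF yt pr(1)] by (auto simp: beaten_def)
      then have V: "reverse_games y ?T \<in> Tour \<Phi> n s"
        using reverse_triple_in_Tour_iff[OF less.prems(2) j] pq qr by (auto simp: beaten_def)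
      have "\<bar>f x - f (reverse_games y ?T)\<bar> \<le> \<alpha> * card (B x (reverse_games y ?T))"
        using less.hyps[OF _ less.prems(1) V] small by (simp add: B_def)
      then show ?thesis
        using lipT[OF less.prems(2) V] step[OF small(2)] unfolding B_def by linarith
    qed
  qed
qed

end

lemma game_eq_iff:
  assumes "p \<noteq> q" "p' \<noteq> q'"
  shows "game p q = game p' q' \<longleftrightarrow>
    (p' = p \<and> q' = q) \<or> (p' = q \<and> q' = p) \<or> (p' = - p \<and> q' = - q) \<or> (p' = - q \<and> q' = - p)"
  using game_eqD[OF _ assms] game_commute[of p q] game_minus[of p q] game_minus[of q p] by metis

section \<open>Generators meeting a given generator\<close>

definition gen_mult :: "nat \<Rightarrow> sedge set \<Rightarrow> real" where
  "gen_mult n G = (if G \<in> clovers n then 2 else 1)"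

context coxeter
begin

text \<open>For \<open>x\<close> in the fibre these are its neutral generators, by
  \<open>reverse_in_Tour_iff\<close>.\<close>

definition gens :: "(nat \<Rightarrow> real) \<Rightarrow> tournament \<Rightarrow> sedge set set" where
  "gens s x = {G \<in> generator_games \<Phi> n. reverse_games x G \<in> Tour \<Phi> n s}"

definition touching :: "(nat \<Rightarrow> real) \<Rightarrow> tournament \<Rightarrow> sedge set \<Rightarrow> sedge set set" where
  "touching s x D = {G \<in> gens s x. G \<inter> D \<noteq> {} \<and> G \<noteq> D}"

text \<open>The adjacency operator of the interchange multigraph applied to \<open>f\<close>; for
  the constant one it is the degree.\<close>

definition gen_sum :: "(nat \<Rightarrow> real) \<Rightarrow> (tournament \<Rightarrow> real) \<Rightarrow> tournament \<Rightarrow> real" where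
  "gen_sum s f x = (\<Sum>G\<in>gens s x. gen_mult n G * f (reverse_games x G))"

text \<open>The term of the generator, if there is one, that closes the arrow $a \to b$ by the vertex $t$.\<close>

definition closing :: "tournament \<Rightarrow> (sedge set \<Rightarrow> real) \<Rightarrow> int \<Rightarrow> int \<Rightarrow> int \<Rightarrow> real" where
  "closing x F a b t = (if arrow x b t \<and> arrow x t a then F (triple a b t) else 0)"

definition closings :: "tournament \<Rightarrow> (sedge set \<Rightarrow> real) \<Rightarrow> int \<Rightarrow> int \<Rightarrow> int \<Rightarrow> int \<Rightarrow> real" where
  "closings x F p q r t = closing x F p q t + closing x F q r t + closing x F r p t"

lemma closings_rotate: "closings x F q r p t = closings x F p q r t"
  by (simp add: closings_def)

lemma finite_generator_games: "finite (generator_games \<Phi> n)"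
  by (rule finite_subset[of _ "Pow games"]) (use generator_subset_games finite_games in auto)

lemma finite_gens [simp]: "finite (gens s x)"
  using finite_generator_games by (simp add: gens_def)

lemma finite_touching [simp]: "finite (touching s x D)"
  by (simp add: touching_def)

lemma triple_in_gens:
  assumes "x \<in> Tour \<Phi> n s" "arrow x p q" "arrow x q r" "arrow x r p"
  shows "triple p q r \<in> gens s x"
  using assms reverse_triple_in_Tour_iff[OF assms(1)] triple_in_generator_games arrow_joined
  by (simp add: gens_def)

lemma gensE:
  assumes "x \<in> Tour \<Phi> n s" "G \<in> gens s x"
  obtains p q r where "arrow x p q" "arrow x q r" "arrow x r p" "G = triple p q r"
proof -
  obtain p q r where j: "joined p q" "joined q r" "joined r p" "G = triple p q r"
    using assms(2) generator_gamesE unfolding gens_def by blast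
  then have "(arrow x p q \<and> arrow x q r \<and> arrow x r p) \<or> (arrow x q p \<and> arrow x r q \<and> arrow x p r)"
    using reverse_triple_in_Tour_iff[OF assms(1) j(1-3)] assms(2) by (simp add: gens_def)
  then show thesis using that[of p q r] that[of r q p] j(4) triple_flip by blast
qed

text \<open>A game carries an arrow and its mirror image. If the cycle of \<open>G\<close> runs
  through the mirror image of the given arrow, negating the third vertex represents \<open>G\<close>
  through the arrow itself.\<close>

lemma gens_containing_arrow:
  assumes x: "x \<in> Tour \<Phi> n s" and G: "G \<in> gens s x" and ab: "arrow x a b" "game a b \<in> G"
  obtains t where "G = triple a b t" "arrow x b t" "arrow x t a"
proof -
  obtain p q r where pqr: "arrow x p q" "arrow x q r" "arrow x r p" "G = triple p q r"
    using gensE[OF x G] by blast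
  note witness = that
  have main: thesis if "arrow x u v" "arrow x v w" "arrow x w u" "G = triple u v w" "game a b = game u v" for u v w
  proof -
    from arrow_game_eqD[OF ab(1) that(1,5)] consider "u = a" "v = b" | "u = - b" "v = - a" by blast
    then show thesis
    proof cases
      case 1
      then show thesis using witness[of w] that by simp
    next
      case 2
      have "G = triple a b (- w)"
        using that(4) 2 triple_minus[of a b "- w"] triple_flip[of "- a" "- b" w] triple_rotate
        by (metis minus_minus)
      moreover have "arrow x b (- w)" "arrow x (- w) a"
        using that(2,3) 2 arrow_mirror[of x "- b" w] arrow_mirror[of x w "- a"] by simp_all
      ultimately show thesis using witness[of "- w"] by simp
    qed
  qed
  from ab(2) pqr(4) consider "game a b = game p q" | "game a b = game q r" | "game a b = game r p"
    by (auto simp: triple_def)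
  then show thesis
    by cases (use main[of p q r] main[of q r p] main[of r p q] pqr triple_rotate in auto)
qed

text \<open>A generator sharing a game with the triangle closes one of its three arrows by a further
  vertex, and the third vertex of the triangle would give the triangle back. As no two of
  \<open>p\<close>, \<open>q\<close>, \<open>r\<close> are antipodal, the closing vertex is
  determined by the generator, and the generator meets the triangle in one game only; so nothing is
  counted twice.\<close>

lemma sum_touching_triangle:
  assumes x: "x \<in> Tour \<Phi> n s" and c: "arrow x p q" "arrow x q r" "arrow x r p"
    and nc: "p \<noteq> - q" "q \<noteq> - r" "r \<noteq> - p"
  shows "(\<Sum>G\<in>touching s x (triple p q r). F G) = (\<Sum>t\<in>verts - {p, q, r}. closings x F p q r t)"
proof -
  let ?D = "triple p q r"
  define S where "S a b = {t \<in> verts - {p, q, r}. arrow x b t \<and> arrow x t a}" for a b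
  define T where "T a b = triple a b ` S a b" for a b
  have j: "joined p q" "joined q r" "joined r p" using c arrow_joined by blast+
  note Dd = games_distinct_triple[OF j]
  have int: "triple a b t \<inter> triple a b d = {game a b}"
    if "arrow x a b" "arrow x b d" "arrow x d a" "arrow x b t" "arrow x t a" "t \<noteq> d"
      "a \<noteq> - b" "b \<noteq> - d" "d \<noteq> - a" for a b d t
  proof -
    have jj: "a \<noteq> b" "b \<noteq> d" "d \<noteq> a" "b \<noteq> t" "t \<noteq> a"
      using that arrow_joined joined_neq by blast+
    have "game b d \<noteq> game b t" "game b d \<noteq> game t a" "game d a \<noteq> game b t" "game d a \<noteq> game t a"
      \<comment> \<open>Games carrying arrows of the same tournament coincide only for equal or
        mirrored arrows. Equality would force \<open>t = d\<close> or a repeated vertex, and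
        mirroring an antipodal pair in the triangle.\<close>
      using arrow_game_eqD[OF that(2,4)] arrow_game_eqD[OF that(2,5)] arrow_game_eqD[OF that(3,4)]
        arrow_game_eqD[OF that(3,5)] that(6-9) jj by auto
    moreover have "game a b \<noteq> game b d" "game d a \<noteq> game a b"
      using games_distinct_triple[of a b d] that arrow_joined by blast+
    ultimately show ?thesis by (auto simp: triple_def)
  qed
  have T: "T a b \<subseteq> {G \<in> gens s x. G \<inter> ?D = {game a b}}"
    if abd: "arrow x a b" "arrow x b d" "arrow x d a" "a \<noteq> - b" "b \<noteq> - d" "d \<noteq> - a"
      "?D = triple a b d" "d \<in> {p, q, r}" for a b d
  proof
    fix G assume "G \<in> T a b"
    then obtain t where t: "t \<in> S a b" "G = triple a b t" by (auto simp: T_def)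
    have "triple a b t \<inter> triple a b d = {game a b}"
      using int[of a b d t] that t(1) by (auto simp: S_def)
    then show "G \<in> {G \<in> gens s x. G \<inter> ?D = {game a b}}"
      using triple_in_gens[OF x abd(1), of t] t abd(7) by (simp add: S_def)
  qed
  have r: "?D = triple q r p" "?D = triple r p q" using triple_rotate by auto
  note T1 = T[OF c nc refl] and T2 = T[OF c(2,3,1) nc(2,3,1) r(1)] and T3 = T[OF c(3,1,2) nc(3,1,2) r(2)]
  have un: "touching s x ?D = T p q \<union> T q r \<union> T r p"
  proof
    show "T p q \<union> T q r \<union> T r p \<subseteq> touching s x ?D"
    proof
      fix G assume "G \<in> T p q \<union> T q r \<union> T r p"
      then have "G \<in> gens s x" "G \<inter> ?D = {game p q} \<or> G \<inter> ?D = {game q r} \<or> G \<inter> ?D = {game r p}"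
        using T1 T2 T3 by auto
      moreover have "?D \<noteq> {game p q}" "?D \<noteq> {game q r}" "?D \<noteq> {game r p}"
        using Dd by (auto simp: triple_def)
      ultimately show "G \<in> touching s x ?D" by (auto simp: touching_def)
    qed
    show "touching s x ?D \<subseteq> T p q \<union> T q r \<union> T r p"
    proof
      fix G assume G: "G \<in> touching s x ?D"
      then have G': "G \<in> gens s x" "G \<noteq> ?D" "game p q \<in> G \<or> game q r \<in> G \<or> game r p \<in> G"
        by (auto simp: touching_def triple_def)
      have mem: "G \<in> T a b"
        if m: "game a b \<in> G" "arrow x a b" "{p, q, r} = {a, b, d}" "?D = triple a b d" for a b d
      proof -
        obtain t where t: "G = triple a b t" "arrow x b t" "arrow x t a"
          using gens_containing_arrow[OF x G'(1) m(2,1)] by blast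
        have "t \<noteq> d" using t(1) that(4) G'(2) by auto
        moreover have "t \<noteq> a" "t \<noteq> b" "t \<in> verts"
          using t arrow_joined joined_def by blast+
        ultimately have "t \<in> S a b" using t that(3) by (auto simp: S_def)
        then show ?thesis using t(1) by (auto simp: T_def)
      qed
      show "G \<in> T p q \<union> T q r \<union> T r p"
        using G'(3) mem[of p q r] mem[of q r p] mem[of r p q] c r by blast
    qed
  qed
  have fin: "finite (S a b)" "finite (T a b)" for a b by (auto simp: S_def T_def)
  have dis: "T p q \<inter> T q r = {}" "(T p q \<union> T q r) \<inter> T r p = {}"
    using T1 T2 T3 Dd by (blast, blast)
  have one: "(\<Sum>G\<in>T a b. F G) = (\<Sum>t\<in>verts - {p, q, r}. closing x F a b t)"
    if "arrow x a b" "a \<noteq> - b" for a b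
  proof -
    have "inj_on (triple a b) (S a b)"
    proof (rule inj_onI)
      fix t t' assume t: "t \<in> S a b" "t' \<in> S a b" "triple a b t = triple a b t'"
      have ar: "arrow x b t" "arrow x t a" "arrow x b t'" "arrow x t' a" using t by (auto simp: S_def)
      have ne: "t' \<noteq> b" "t' \<noteq> a" using ar arrow_joined joined_neq by blast+
      have "game a b \<noteq> game b t" using games_distinct_triple[of a b t] ar that arrow_joined by blast
      moreover have "game b t \<in> triple a b t'" using t(3) by (metis insertCI triple_def)
      ultimately have "game b t = game b t' \<or> game b t = game t' a"
        by (auto simp: triple_def)
      then show "t = t'"
        using arrow_game_eqD[OF ar(1,3)] arrow_game_eqD[OF ar(1,4)] that(2) ne by (metis minus_minus)
    qed
    then have "(\<Sum>G\<in>T a b. F G) = (\<Sum>t\<in>S a b. F (triple a b t))"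
      unfolding T_def by (simp add: sum.reindex)
    also have "\<dots> = (\<Sum>t\<in>verts - {p, q, r}. closing x F a b t)"
      unfolding S_def closing_def by (rule sum.inter_filter) simp
    finally show ?thesis .
  qed
  show ?thesis
    unfolding un closings_def
    by (simp add: sum.union_disjoint fin dis sum.distrib one c nc)
qed

text \<open>The vertices $t$ and $-t$ close the arrow $p \to -p$ to the same clover; this absorbs the
  multiplicity two of clovers.\<close>

lemma sum_touching_clover:
  assumes x: "x \<in> Tour \<Phi> n s" and c: "arrow x p (- p)" "arrow x (- p) r" "arrow x r p"
  shows "(\<Sum>G\<in>touching s x (triple p (- p) r). gen_mult n G * F G)
    = (\<Sum>t\<in>verts - {p, - p, r, - r}. closings x F p (- p) r t)"
proof -
  let ?D = "triple p (- p) r" and ?W = "verts - {p, - p, r, - r}"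
  define S where "S a b = {t \<in> ?W. arrow x b t \<and> arrow x t a}" for a b
  define T where "T a b = triple a b ` S a b" for a b
  have j: "joined p (- p)" "joined (- p) r" "joined r p" using c arrow_joined by blast+
  have C: "\<Phi> = TypeC" using j(1) by (auto simp: joined_def)
  have nz: "a \<noteq> 0" if "a \<in> verts" for a using that C by (auto simp: coxeter.verts_def)
  have ne: "p \<noteq> 0" "r \<noteq> 0" "p \<noteq> r" "p \<noteq> - r" "r \<noteq> - p" "- p \<noteq> r" "- r \<noteq> p"
    using j nz by (auto simp: coxeter.joined_def)
  have loop: "(- p = p) = False" "(p = - p) = False" "(- r = r) = False" "(r = - r) = False" using ne by auto
  \<comment> \<open>The vertex \<open>- r\<close> closes the arrow from \<open>p\<close> to
    \<open>- p\<close> to the clover \<open>?D\<close> again, so it is left out together with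
    \<open>r\<close>.\<close>
  have D2: "?D = triple p (- p) (- r)"
    using triple_minus[of p "- p" r] triple_flip[of p "- p" "- r"] triple_rotate by (metis minus_minus)
  have Wne: "t \<noteq> 0" "t \<noteq> p" "t \<noteq> - p" "t \<noteq> r" "t \<noteq> - r" "- t \<noteq> p" "- t \<noteq> - p" "- t \<noteq> r" "- t \<noteq> - r"
     "p \<noteq> t" "- p \<noteq> t" "r \<noteq> t" "- r \<noteq> t" "p \<noteq> - t" "r \<noteq> - t" "t \<noteq> - t" "- t \<noteq> t"
    if "t \<in> ?W" for t
    using that nz by auto
  have int: "triple p (- p) t \<inter> ?D = {game p (- p)}" "triple (- p) r t \<inter> ?D = {game (- p) r}"
    "triple r p t \<inter> ?D = {game r p}" if "t \<in> ?W" for t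
    using ne Wne[OF that] loop by (auto simp: triple_def game_eq_iff)
  have dD: "game p (- p) \<noteq> game (- p) r" "game (- p) r \<noteq> game r p" "game r p \<noteq> game p (- p)"
    using games_distinct_triple[OF j] by auto
  have un: "touching s x ?D = T p (- p) \<union> T (- p) r \<union> T r p"
  proof
    show "T p (- p) \<union> T (- p) r \<union> T r p \<subseteq> touching s x ?D"
    proof
      fix G assume "G \<in> T p (- p) \<union> T (- p) r \<union> T r p"
      then have "G \<in> gens s x" "G \<inter> ?D = {game p (- p)} \<or> G \<inter> ?D = {game (- p) r} \<or> G \<inter> ?D = {game r p}"
      proof -
        from \<open>G \<in> _\<close> consider t where "t \<in> S p (- p)" "G = triple p (- p) t"
          | t where "t \<in> S (- p) r" "G = triple (- p) r t" | t where "t \<in> S r p" "G = triple r p t"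
          by (auto simp: T_def)
        then have "G \<in> gens s x \<and> (G \<inter> ?D = {game p (- p)} \<or> G \<inter> ?D = {game (- p) r} \<or> G \<inter> ?D = {game r p})"
        proof cases
          case (1 t)
          then show ?thesis using int(1)[of t] triple_in_gens[OF x c(1), of t] by (simp add: S_def)
        next
          case (2 t)
          then show ?thesis using int(2)[of t] triple_in_gens[OF x c(2), of t] by (simp add: S_def)
        next
          case (3 t)
          then show ?thesis using int(3)[of t] triple_in_gens[OF x c(3), of t] by (simp add: S_def)
        qed
        then show "G \<in> gens s x" "G \<inter> ?D = {game p (- p)} \<or> G \<inter> ?D = {game (- p) r} \<or> G \<inter> ?D = {game r p}"
          by blast+
      qed
      moreover have "?D \<noteq> {game p (- p)}" "?D \<noteq> {game (- p) r}" "?D \<noteq> {game r p}"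
        using dD by (auto simp: triple_def)
      ultimately show "G \<in> touching s x ?D" by (auto simp: touching_def)
    qed
    show "touching s x ?D \<subseteq> T p (- p) \<union> T (- p) r \<union> T r p"
    proof
      fix G assume G: "G \<in> touching s x ?D"
      then have G': "G \<in> gens s x" "G \<noteq> ?D" "game p (- p) \<in> G \<or> game (- p) r \<in> G \<or> game r p \<in> G"
        by (auto simp: touching_def triple_def)
      have tv: "t \<in> verts - {a, b}" if "arrow x b t" "arrow x t a" for a b t
        using that arrow_joined[of x b t] arrow_joined[of x t a] by (auto simp: joined_def)
      from G'(3) consider "game p (- p) \<in> G" | "game (- p) r \<in> G" | "game r p \<in> G" by blast
      then show "G \<in> T p (- p) \<union> T (- p) r \<union> T r p"
      proof cases
        case 1
        obtain t where t: "G = triple p (- p) t" "arrow x (- p) t" "arrow x t p"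
          using gens_containing_arrow[OF x G'(1) c(1) 1] by blast
        then have "t \<in> S p (- p)" using tv[OF t(2,3)] G'(2) D2 by (auto simp: S_def)
        then show ?thesis using t(1) by (auto simp: T_def)
      next
        case 2
        obtain t where t: "G = triple (- p) r t" "arrow x r t" "arrow x t (- p)"
          using gens_containing_arrow[OF x G'(1) c(2) 2] by blast
        have "t \<noteq> p" using t(1) G'(2) triple_rotate by auto
        \<comment> \<open>An arrow from \<open>- r\<close> to \<open>- p\<close> would be the mirror
          image of one from \<open>p\<close> to \<open>r\<close>, against the cycle.\<close>
        moreover have "t \<noteq> - r" using t(3) arrow_mirror[of x r p] arrow_asym[OF c(3)] by auto
        ultimately have "t \<in> S (- p) r" using tv[OF t(2,3)] t by (auto simp: S_def)
        then show ?thesis using t(1) by (auto simp: T_def)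
      next
        case 3
        obtain t where t: "G = triple r p t" "arrow x p t" "arrow x t r"
          using gens_containing_arrow[OF x G'(1) c(3) 3] by blast
        have "t \<noteq> - p" using t(1) G'(2) triple_rotate by auto
        moreover have "t \<noteq> - r" using t(2) arrow_mirror[of x "- p" r] arrow_asym[OF c(2)] by auto
        ultimately have "t \<in> S r p" using tv[OF t(2,3)] t by (auto simp: S_def)
        then show ?thesis using t(1) by (auto simp: T_def)
      qed
    qed
  qed
  have fin: "finite (S a b)" "finite (T a b)" for a b by (auto simp: S_def T_def)
  have TD: "G \<inter> ?D = {game p (- p)}" if "G \<in> T p (- p)" for G using that int(1) unfolding T_def S_def by blast
  have TD2: "G \<inter> ?D = {game (- p) r}" if "G \<in> T (- p) r" for G using that int(2) unfolding T_def S_def by blast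
  have TD3: "G \<inter> ?D = {game r p}" if "G \<in> T r p" for G using that int(3) unfolding T_def S_def by blast
  have dis: "T p (- p) \<inter> T (- p) r = {}" "(T p (- p) \<union> T (- p) r) \<inter> T r p = {}"
    using TD TD2 TD3 dD by (blast, blast)
  have one: "(\<Sum>G\<in>T a b. gen_mult n G * F G) = (\<Sum>t\<in>?W. closing x F a b t)"
    if ab: "arrow x a b" "a \<noteq> - b" "a \<in> {p, - p, r}" "b \<in> {p, - p, r}" for a b
  proof -
    have "inj_on (triple a b) (S a b)"
    proof (rule inj_onI)
      fix t t' assume t: "t \<in> S a b" "t' \<in> S a b" "triple a b t = triple a b t'"
      have ar: "arrow x b t" "arrow x t a" "arrow x b t'" "arrow x t' a" using t by (auto simp: S_def)
      have ne: "t' \<noteq> b" "t' \<noteq> a" using ar arrow_joined joined_neq by blast+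
      have "game a b \<noteq> game b t" using games_distinct_triple[of a b t] ar that arrow_joined by blast
      moreover have "game b t \<in> triple a b t'" using t(3) by (metis insertCI triple_def)
      ultimately have "game b t = game b t' \<or> game b t = game t' a"
        by (auto simp: triple_def)
      then show "t = t'"
        using arrow_game_eqD[OF ar(1,3)] arrow_game_eqD[OF ar(1,4)] that(2) ne by (metis minus_minus)
    qed
    then have "(\<Sum>G\<in>T a b. gen_mult n G * F G) = (\<Sum>t\<in>S a b. gen_mult n (triple a b t) * F (triple a b t))"
      unfolding T_def by (simp add: sum.reindex)
    also have "\<dots> = (\<Sum>t\<in>S a b. F (triple a b t))"
    proof (rule sum.cong)
      fix t assume "t \<in> S a b"
      then have "t \<in> ?W" by (simp add: S_def)
      from Wne[OF this] ab(2-4) have "triple a b t \<notin> clovers n"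
        by (intro triple_not_clover) auto
      then show "gen_mult n (triple a b t) * F (triple a b t) = F (triple a b t)" by (simp add: gen_mult_def)
    qed simp
    also have "\<dots> = (\<Sum>t\<in>?W. closing x F a b t)"
      unfolding S_def closing_def by (rule sum.inter_filter) simp
    finally show ?thesis .
  qed
  have two: "(\<Sum>G\<in>T p (- p). gen_mult n G * F G) = (\<Sum>t\<in>?W. closing x F p (- p) t)"
  proof -
    \<comment> \<open>One representative of each pair \<open>t\<close>, \<open>- t\<close>; in type
      C there is no vertex \<open>0\<close>.\<close>
    define Sp where "Sp = {t \<in> S p (- p). t > 0}"
    have refl: "triple p (- p) (- t) = triple p (- p) t" for t
      using triple_minus[of p "- p" t] triple_flip[of p "- p" "- t"] triple_rotate by (metis minus_minus)
    have sym: "- t \<in> S p (- p)" if "t \<in> S p (- p)" for t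
    proof -
      have "arrow x (- p) (- t)" "arrow x (- t) p"
        using that arrow_mirror[of x p t] arrow_mirror[of x t "- p"] by (auto simp: S_def)
      then show ?thesis using that by (auto simp: S_def)
    qed
    have nzS: "t \<noteq> 0" if "t \<in> S p (- p)" for t using that nz by (auto simp: S_def)
    have Sun: "S p (- p) = Sp \<union> uminus ` Sp"
    proof
      show "S p (- p) \<subseteq> Sp \<union> uminus ` Sp"
      proof
        fix t assume t: "t \<in> S p (- p)"
        then show "t \<in> Sp \<union> uminus ` Sp"
          using sym[OF t] nzS[OF t] by (cases "t > 0") (auto simp: Sp_def image_iff intro!: bexI[of _ "- t"])
      qed
    qed (auto simp: Sp_def sym)
    have Tim: "T p (- p) = triple p (- p) ` Sp"
      unfolding T_def Sun using refl by (auto simp: image_Un image_image)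
    have finSp: "finite Sp" using fin by (simp add: Sp_def)
    have "inj_on (triple p (- p)) Sp"
    proof (rule inj_onI)
      fix t t' assume t: "t \<in> Sp" "t' \<in> Sp" "triple p (- p) t = triple p (- p) t'"
      have W: "t \<in> ?W" "t' \<in> ?W" and pos: "t > 0" "t' > 0" using t by (auto simp: Sp_def S_def)
      have "game t p \<in> triple p (- p) t'" using t(3) by (metis insertCI triple_def)
      then show "t = t'"
        using Wne[OF W(1)] Wne[OF W(2)] pos ne loop by (auto simp: triple_def game_eq_iff)
    qed
    then have "(\<Sum>G\<in>T p (- p). gen_mult n G * F G)
        = (\<Sum>t\<in>Sp. gen_mult n (triple p (- p) t) * F (triple p (- p) t))"
      unfolding Tim by (simp add: sum.reindex)
    also have "\<dots> = (\<Sum>t\<in>Sp. 2 * F (triple p (- p) t))"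
    proof (rule sum.cong)
      fix t assume "t \<in> Sp"
      then have "arrow x (- p) t" "arrow x t p" by (auto simp: Sp_def S_def)
      then have "triple p (- p) t \<in> clovers n"
        using triple_in_clovers[OF j(1)] arrow_joined joined_sym by blast
      then show "gen_mult n (triple p (- p) t) * F (triple p (- p) t) = 2 * F (triple p (- p) t)"
        by (simp add: gen_mult_def)
    qed simp
    also have "\<dots> = (\<Sum>t\<in>Sp. F (triple p (- p) t)) + (\<Sum>t\<in>uminus ` Sp. F (triple p (- p) t))"
      by (simp add: sum.reindex refl flip: sum.distrib)
    also have "\<dots> = (\<Sum>t\<in>S p (- p). F (triple p (- p) t))"
      unfolding Sun by (rule sum.union_disjoint[symmetric]) (use finSp in \<open>auto simp: Sp_def\<close>)
    also have "\<dots> = (\<Sum>t\<in>?W. closing x F p (- p) t)"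
      unfolding S_def closing_def by (rule sum.inter_filter) simp
    finally show ?thesis .
  qed
  have oneB: "(\<Sum>G\<in>T (- p) r. gen_mult n G * F G) = (\<Sum>t\<in>?W. closing x F (- p) r t)"
    "(\<Sum>G\<in>T r p. gen_mult n G * F G) = (\<Sum>t\<in>?W. closing x F r p t)"
    using one c ne by auto
  show ?thesis
    unfolding un closings_def
    by (simp add: sum.union_disjoint fin dis sum.distrib two oneB)
qed

end

lemma triple_swap: "triple q p t = triple p q t"
  using triple_flip[of q p t] triple_rotate by metis

section \<open>Matching the generators of adjacent tournaments\<close>

text \<open>Every element lies in an even number of the four sets, that is, their symmetric
  difference is empty. The model case is the four triangles of a \<open>K4\<close>, each edge lying
  in two of them.\<close>

definition covers_evenly :: "'a set \<Rightarrow> 'a set \<Rightarrow> 'a set \<Rightarrow> 'a set \<Rightarrow> bool" where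
  "covers_evenly D X Y Z \<longleftrightarrow> (\<forall>e. ((e \<in> D) = (e \<in> X)) = ((e \<in> Y) = (e \<in> Z)))"

lemma covers_evenly_swap:
  "covers_evenly D X Y Z \<Longrightarrow> covers_evenly D Y X Z"
  "covers_evenly D X Y Z \<Longrightarrow> covers_evenly D X Z Y"
  unfolding covers_evenly_def by metis+

text \<open>The three antipodal closing vertices in type C: \<open>a1\<close>, \<open>a2\<close>, \<open>a3\<close> are the arrows $p \to -q$,
  $q \to -r$, $r \to -p$ and \<open>lp\<close>, \<open>lq\<close>, \<open>lr\<close> the loops. If \<open>a1\<close>, \<open>a2\<close>, \<open>a3\<close> are not all equal,
  then one triangle and one clover of $x$ have to be matched with one triangle and one clover of $y$
  whose loops differ. The clovers have multiplicity two, and a path between the results of reversing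
  them passes through both triangles; this costs $4\beta + \alpha$ instead of $3\alpha$.\<close>

lemma clover_octahedron_arith:
  fixes \<alpha> \<beta> :: real
  assumes ab: "\<beta> \<le> \<alpha>" "\<alpha> \<le> 2 * \<beta>"
    and tt: "a2 \<and> \<not> a3 \<Longrightarrow> a1 \<and> \<not> a3 \<Longrightarrow> yb - xa \<le> \<alpha>" "a2 \<and> \<not> a3 \<Longrightarrow> a2 \<and> \<not> a1 \<Longrightarrow> yc - xa \<le> \<alpha>"
      "a3 \<and> \<not> a1 \<Longrightarrow> a3 \<and> \<not> a2 \<Longrightarrow> ya - xb \<le> \<alpha>" "a3 \<and> \<not> a1 \<Longrightarrow> a2 \<and> \<not> a1 \<Longrightarrow> yc - xb \<le> \<alpha>"
      "a1 \<and> \<not> a2 \<Longrightarrow> a3 \<and> \<not> a2 \<Longrightarrow> ya - xc \<le> \<alpha>" "a1 \<and> \<not> a2 \<Longrightarrow> a1 \<and> \<not> a3 \<Longrightarrow> yb - xc \<le> \<alpha>"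
    and kt: "a1 \<and> \<not> lp \<Longrightarrow> a1 \<and> \<not> a3 \<Longrightarrow> xp1 - yb \<le> \<beta>" "\<not> a3 \<and> lp \<Longrightarrow> a1 \<and> \<not> a3 \<Longrightarrow> xp2 - yb \<le> \<beta>"
      "\<not> a1 \<and> lq \<Longrightarrow> a2 \<and> \<not> a1 \<Longrightarrow> xq1 - yc \<le> \<beta>" "a2 \<and> \<not> lq \<Longrightarrow> a2 \<and> \<not> a1 \<Longrightarrow> xq2 - yc \<le> \<beta>"
      "\<not> a2 \<and> lr \<Longrightarrow> a3 \<and> \<not> a2 \<Longrightarrow> xr1 - ya \<le> \<beta>" "a3 \<and> \<not> lr \<Longrightarrow> a3 \<and> \<not> a2 \<Longrightarrow> xr2 - ya \<le> \<beta>"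
    and tk: "a3 \<and> \<not> a1 \<Longrightarrow> \<not> a1 \<and> lp \<Longrightarrow> xb - yp1 \<le> \<beta>" "a3 \<and> \<not> a1 \<Longrightarrow> a3 \<and> \<not> lp \<Longrightarrow> xb - yp2 \<le> \<beta>"
      "a1 \<and> \<not> a2 \<Longrightarrow> a1 \<and> \<not> lq \<Longrightarrow> xc - yq1 \<le> \<beta>" "a1 \<and> \<not> a2 \<Longrightarrow> \<not> a2 \<and> lq \<Longrightarrow> xc - yq2 \<le> \<beta>"
      "a2 \<and> \<not> a3 \<Longrightarrow> a2 \<and> \<not> lr \<Longrightarrow> xa - yr1 \<le> \<beta>" "a2 \<and> \<not> a3 \<Longrightarrow> \<not> a3 \<and> lr \<Longrightarrow> xa - yr2 \<le> \<beta>"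
    and kk: "a1 \<and> \<not> lp \<Longrightarrow> a3 \<and> \<not> lp \<Longrightarrow> xp1 - yp2 \<le> \<alpha>" "\<not> a3 \<and> lp \<Longrightarrow> \<not> a1 \<and> lp \<Longrightarrow> xp2 - yp1 \<le> \<alpha>"
      "\<not> a1 \<and> lq \<Longrightarrow> \<not> a2 \<and> lq \<Longrightarrow> xq1 - yq2 \<le> \<alpha>" "a2 \<and> \<not> lq \<Longrightarrow> a1 \<and> \<not> lq \<Longrightarrow> xq2 - yq1 \<le> \<alpha>"
      "\<not> a2 \<and> lr \<Longrightarrow> \<not> a3 \<and> lr \<Longrightarrow> xr1 - yr2 \<le> \<alpha>" "a3 \<and> \<not> lr \<Longrightarrow> a2 \<and> \<not> lr \<Longrightarrow> xr2 - yr1 \<le> \<alpha>"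
  shows "(if a2 \<and> \<not> a3 then xa else 0) + (if a3 \<and> \<not> a1 then xb else 0) + (if a1 \<and> \<not> a2 then xc else 0)
      + 2 * ((if a1 \<and> \<not> lp then xp1 else 0) + (if \<not> a3 \<and> lp then xp2 else 0)
        + (if \<not> a1 \<and> lq then xq1 else 0) + (if a2 \<and> \<not> lq then xq2 else 0)
        + (if \<not> a2 \<and> lr then xr1 else 0) + (if a3 \<and> \<not> lr then xr2 else 0))
    - ((if a3 \<and> \<not> a2 then ya else 0) + (if a1 \<and> \<not> a3 then yb else 0) + (if a2 \<and> \<not> a1 then yc else 0)
      + 2 * ((if \<not> a1 \<and> lp then yp1 else 0) + (if a3 \<and> \<not> lp then yp2 else 0)
        + (if a1 \<and> \<not> lq then yq1 else 0) + (if \<not> a2 \<and> lq then yq2 else 0)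
        + (if a2 \<and> \<not> lr then yr1 else 0) + (if \<not> a3 \<and> lr then yr2 else 0)))
    \<le> \<alpha> * ((if a2 \<and> \<not> a3 then 1 else 0) + (if a3 \<and> \<not> a1 then 1 else 0) + (if a1 \<and> \<not> a2 then 1 else 0)
      + 2 * ((if a1 \<and> \<not> lp then 1 else 0) + (if \<not> a3 \<and> lp then 1 else 0)
        + (if \<not> a1 \<and> lq then 1 else 0) + (if a2 \<and> \<not> lq then 1 else 0)
        + (if \<not> a2 \<and> lr then 1 else 0) + (if a3 \<and> \<not> lr then 1 else 0))) + (4 * \<beta> - 2 * \<alpha>)"
  \<comment> \<open>Each choice of the six truth values leaves a linear problem. Where the matching
    produces no excess, \<open>\<alpha> \<le> 2 * \<beta>\<close> keeps the allowance
    \<open>4 * \<beta> - 2 * \<alpha>\<close> nonnegative.\<close>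
  by (cases a1; cases a2; cases a3; cases lp; cases lq; cases lr; insert assms;
      simp only: simp_thms if_True if_False True_implies_equals False_implies_equals;
      (simp; fail | simp, linarith))

context coxeter
begin

definition gen_weight :: "real \<Rightarrow> real \<Rightarrow> sedge set \<Rightarrow> real" where
  "gen_weight \<alpha> \<beta> G = (if G \<in> clovers n then \<beta> else \<alpha>)"

text \<open>Reversals commute and are involutions. An even cover therefore makes reversing
  \<open>X\<close> and then \<open>Z\<close> the same as reversing \<open>D\<close> and then
  \<open>Y\<close>, so the two tournaments compared are joined by the generator
  \<open>Z\<close>.\<close>

lemma lipschitz_even_cover:
  assumes lip: "lipschitz s \<alpha> \<beta> f" and x: "x \<in> Tour \<Phi> n s"
    and D: "D \<subseteq> games" and X: "X \<subseteq> games" and Z: "Z \<in> generator_games \<Phi> n"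
    and ev: "covers_evenly D X Y Z"
    and V: "reverse_games x X \<in> Tour \<Phi> n s" "reverse_games (reverse_games x D) Y \<in> Tour \<Phi> n s"
  shows "\<bar>f (reverse_games x X) - f (reverse_games (reverse_games x D) Y)\<bar> \<le> gen_weight \<alpha> \<beta> Z"
proof -
  have Zs: "Z \<subseteq> games" by (rule generator_subset_games[OF Z])
  have "reverse_games (reverse_games x X) Z = reverse_games (reverse_games x D) Y"
  proof
    fix e
    have "e \<in> games \<Longrightarrow> x e \<le> 1" using tournament_le_1[OF Tour_tournaments[OF x]] .
    moreover have "((e \<in> D) = (e \<in> X)) = ((e \<in> Y) = (e \<in> Z))" using ev by (simp add: covers_evenly_def)
    ultimately show "reverse_games (reverse_games x X) Z e = reverse_games (reverse_games x D) Y e"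
      using D X Zs unfolding reverse_games_def
      by (cases "e \<in> D"; cases "e \<in> X"; cases "e \<in> Y"; cases "e \<in> Z") auto
  qed
  then show ?thesis
    using lip V Z unfolding lipschitz_def gen_weight_def by (metis)
qed

text \<open>Here \<open>A\<close>, \<open>B\<close>, \<open>C\<close> are the games of a triangle,
  \<open>D\<close>, \<open>E\<close>, \<open>F\<close> those from its corners to a fourth vertex,
  and \<open>d\<close>, \<open>e\<close>, \<open>g\<close> their directions. Around the triangle
  these truth values rise as often as they fall, at most once; so \<open>x\<close> and
  \<open>y\<close> have equally many further cyclic triangles, at most one each. Two such triangles
  are different and are linked by the remaining one. Speaking of games instead of vertices covers
  the antipodal \<open>K4\<close> too.\<close>

lemma K4_core:
  assumes lip: "lipschitz s \<alpha> \<beta> f" and x: "x \<in> Tour \<Phi> n s"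
    and dist: "distinct [A, B, C, D, E, F]" and sub: "{A, B, C} \<subseteq> games"
    and y: "y = reverse_games x {A, B, C}"
    and gen: "{A, D, E} \<in> generator_games \<Phi> n" "{B, E, F} \<in> generator_games \<Phi> n" "{C, F, D} \<in> generator_games \<Phi> n"
    and wt: "gen_weight \<alpha> \<beta> {A, D, E} \<le> \<gamma>" "gen_weight \<alpha> \<beta> {B, E, F} \<le> \<gamma>" "gen_weight \<alpha> \<beta> {C, F, D} \<le> \<gamma>"
    and vx: "e \<and> \<not> d \<Longrightarrow> reverse_games x {A, D, E} \<in> Tour \<Phi> n s"
      "g \<and> \<not> e \<Longrightarrow> reverse_games x {B, E, F} \<in> Tour \<Phi> n s"
      "d \<and> \<not> g \<Longrightarrow> reverse_games x {C, F, D} \<in> Tour \<Phi> n s"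
    and vy: "d \<and> \<not> e \<Longrightarrow> reverse_games y {A, D, E} \<in> Tour \<Phi> n s"
      "e \<and> \<not> g \<Longrightarrow> reverse_games y {B, E, F} \<in> Tour \<Phi> n s"
      "g \<and> \<not> d \<Longrightarrow> reverse_games y {C, F, D} \<in> Tour \<Phi> n s"
  shows "(if e \<and> \<not> d then f (reverse_games x {A, D, E}) else 0)
      + (if g \<and> \<not> e then f (reverse_games x {B, E, F}) else 0)
      + (if d \<and> \<not> g then f (reverse_games x {C, F, D}) else 0)
    - ((if d \<and> \<not> e then f (reverse_games y {A, D, E}) else 0)
      + (if e \<and> \<not> g then f (reverse_games y {B, E, F}) else 0)
      + (if g \<and> \<not> d then f (reverse_games y {C, F, D}) else 0))
    \<le> \<gamma> * ((if e \<and> \<not> d then 1 else 0) + (if g \<and> \<not> e then 1 else 0) + (if d \<and> \<not> g then 1 else 0))"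
proof -
  let ?TA = "{A, D, E}" and ?TB = "{B, E, F}" and ?TC = "{C, F, D}"
  have ev: "covers_evenly {A, B, C} ?TA ?TB ?TC"
    using dist unfolding covers_evenly_def by auto
  note sw = covers_evenly_swap
  note gs = gen[THEN generator_subset_games]
  have l: "\<bar>f (reverse_games x X) - f (reverse_games y Y)\<bar> \<le> \<gamma>"
    if "X \<in> {?TA, ?TB, ?TC}" "Z \<in> {?TA, ?TB, ?TC}" "covers_evenly {A, B, C} X Y Z"
      "reverse_games x X \<in> Tour \<Phi> n s" "reverse_games y Y \<in> Tour \<Phi> n s" for X Y Z
  proof -
    have "X \<subseteq> games" "Z \<in> generator_games \<Phi> n" "gen_weight \<alpha> \<beta> Z \<le> \<gamma>"
      using that(1,2) gs gen wt by blast+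
    then show ?thesis
      using lipschitz_even_cover[OF lip x sub, of X Z Y] that(3-5) unfolding y by fastforce
  qed
  note AB = l[of ?TA ?TC ?TB] l[of ?TA ?TB ?TC] l[of ?TB ?TC ?TA] l[of ?TB ?TA ?TC] l[of ?TC ?TB ?TA] l[of ?TC ?TA ?TB]
  have L: "\<bar>f (reverse_games x ?TA) - f (reverse_games y ?TB)\<bar> \<le> \<gamma>" if "e \<and> \<not> d" "e \<and> \<not> g"
    using AB(1) ev vx vy that by simp
  have L2: "\<bar>f (reverse_games x ?TA) - f (reverse_games y ?TC)\<bar> \<le> \<gamma>" if "e \<and> \<not> d" "g \<and> \<not> d"
    using AB(2) sw(2)[OF ev] vx vy that by simp
  have L3: "\<bar>f (reverse_games x ?TB) - f (reverse_games y ?TA)\<bar> \<le> \<gamma>" if "g \<and> \<not> e" "d \<and> \<not> e"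
    using AB(3) sw(1)[OF ev] vx vy that by simp
  have L4: "\<bar>f (reverse_games x ?TB) - f (reverse_games y ?TC)\<bar> \<le> \<gamma>" if "g \<and> \<not> e" "g \<and> \<not> d"
    using AB(4) sw(2)[OF sw(1)[OF ev]] vx vy that by simp
  have L5: "\<bar>f (reverse_games x ?TC) - f (reverse_games y ?TA)\<bar> \<le> \<gamma>" if "d \<and> \<not> g" "d \<and> \<not> e"
    using AB(5) sw(1)[OF sw(2)[OF ev]] vx vy that by simp
  have L6: "\<bar>f (reverse_games x ?TC) - f (reverse_games y ?TB)\<bar> \<le> \<gamma>" if "d \<and> \<not> g" "e \<and> \<not> g"
    using AB(6) sw(2)[OF sw(1)[OF sw(2)[OF ev]]] vx vy that by simp
  show ?thesis
    by (cases d; cases e; cases g; insert L L2 L3 L4 L5 L6;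
        simp only: simp_thms if_True if_False True_implies_equals False_implies_equals;
      (simp; fail | simp, linarith))
qed

lemma reverse_triple_in_Tour:
  assumes "x \<in> Tour \<Phi> n s" "arrow x a b" "arrow x b t" "arrow x t a"
  shows "reverse_games x (triple a b t) \<in> Tour \<Phi> n s"
  using triple_in_gens[OF assms] by (simp add: gens_def)

lemma arrow_reversed_triple:
  assumes x: "x \<in> Tour \<Phi> n s" and c: "arrow x p q" "arrow x q r" "arrow x r p"
    and y: "y = reverse_games x (triple p q r)"
  shows "arrow y q p" "arrow y r q" "arrow y p r" "y \<in> Tour \<Phi> n s"
    "reverse_games y (triple p q r) = x"
proof -
  note t = Tour_tournaments[OF x]
  have j: "joined q p" "joined r q" "joined p r" using c arrow_joined joined_sym by blast+
  have m: "game q p \<in> triple p q r" "game r q \<in> triple p q r" "game p r \<in> triple p q r"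
    using game_commute by (auto simp: triple_def)
  show "arrow y q p" "arrow y r q" "arrow y p r"
    using arrow_reverse_games[OF t j(1)] arrow_reverse_games[OF t j(2)] arrow_reverse_games[OF t j(3)] c m
    by (simp_all add: y)
  show "y \<in> Tour \<Phi> n s" unfolding y by (rule reverse_triple_in_Tour[OF x c])
  have T: "triple p q r \<subseteq> games" using triple_in_gens[OF x c] generator_subset_games by (auto simp: gens_def)
  show "reverse_games y (triple p q r) = x"
  proof
    fix e
    show "reverse_games y (triple p q r) e = x e"
      using T tournament_le_1[OF t, of e] by (auto simp: y reverse_games_def)
  qed
qed

lemma game_neq_fresh:
  assumes "a \<noteq> t" "b \<noteq> c" "t \<notin> {b, c, - b, - c}"
  shows "game b c \<noteq> game a t"
  using game_eqD[of b c a t] assms by blast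

text \<open>This is \<open>K4_core\<close> with fourth vertex \<open>t\<close>. Reversal turns the
  cycle round, so in \<open>y\<close> the arrows to be closed are those of \<open>r\<close>,
  \<open>q\<close>, \<open>p\<close>. The common bound \<open>\<gamma>\<close> allows clovers and
  ordinary triangles among the three triangles through \<open>t\<close>.\<close>

lemma closings_K4:
  assumes lip: "lipschitz s \<alpha> \<beta> f" and x: "x \<in> Tour \<Phi> n s"
    and c: "arrow x p q" "arrow x q r" "arrow x r p"
    and y: "y = reverse_games x (triple p q r)"
    and t: "t \<in> verts - {p, q, r, - p, - q, - r}"
    and wt: "gen_weight \<alpha> \<beta> (triple p q t) \<le> \<gamma>" "gen_weight \<alpha> \<beta> (triple q r t) \<le> \<gamma>"
      "gen_weight \<alpha> \<beta> (triple r p t) \<le> \<gamma>"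
  shows "closings x (\<lambda>G. f (reverse_games x G)) p q r t - closings y (\<lambda>G. f (reverse_games y G)) r q p t
     \<le> \<gamma> * closings x (\<lambda>_. 1) p q r t"
    and "closings x (\<lambda>_. 1) p q r t \<le> 1" and "0 \<le> closings x (\<lambda>_. 1) p q r t"
proof -
  note xt = Tour_tournaments[OF x]
  note yc = arrow_reversed_triple[OF x c y]
  have j: "joined p q" "joined q r" "joined r p" using c arrow_joined by blast+
  have v: "p \<in> verts" "q \<in> verts" "r \<in> verts" "p \<noteq> q" "q \<noteq> r" "r \<noteq> p" using j by (auto simp: joined_def)
  have ne: "t \<noteq> p" "t \<noteq> q" "t \<noteq> r" "t \<noteq> - p" "t \<noteq> - q" "t \<noteq> - r" "t \<in> verts" using t by auto
  have jt: "joined p t" "joined q t" "joined r t" "joined t p" "joined t q" "joined t r"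
    using ne v by (auto simp: joined_def)
  let ?A = "game p q" and ?B = "game q r" and ?C = "game r p" and ?D = "game p t" and ?E = "game q t" and ?F = "game r t"
  have same: "game a t \<noteq> game b t" if "joined a b" "joined a t" "joined b t" "t \<noteq> - a" for a b
  proof
    assume "game a t = game b t"
    from game_eqD[OF this] that have "t = 0 \<and> b = - a"
      by (auto simp: joined_def)
    then show False using that by (auto simp: coxeter.joined_def coxeter.verts_def)
  qed
  have dist: "distinct [?A, ?B, ?C, ?D, ?E, ?F]"
    using games_distinct_triple[OF j] same[OF j(1) jt(1,2)] same[OF j(2) jt(2,3)] same[OF j(3) jt(3,1)] ne
      game_neq_fresh[of _ t p q] game_neq_fresh[of _ t q r] game_neq_fresh[of _ t r p] v
    by simp
  have tr: "triple p q t = {?A, ?D, ?E}" "triple q r t = {?B, ?E, ?F}" "triple r p t = {?C, ?F, ?D}"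
    using game_commute by (auto simp: triple_def)
  have tr_rev: "triple q p t = {?A, ?D, ?E}" "triple r q t = {?B, ?E, ?F}" "triple p r t = {?C, ?F, ?D}"
    using tr triple_swap by metis+
  have notin: "game a t \<notin> triple p q r" "game t a \<notin> triple p q r" if "a \<in> {p, q, r}" for a
    using that dist game_commute[of t] by (auto simp: triple_def)
  have ya: "arrow y a t = arrow x a t" "arrow y t a = arrow x t a" if "a \<in> {p, q, r}" for a
    using arrow_reverse_games[OF xt, of a t] arrow_reverse_games[OF xt, of t a] notin[OF that] jt that
    by (auto simp: y)
  have neg: "arrow x t p = (\<not> arrow x p t)" "arrow x t q = (\<not> arrow x q t)" "arrow x t r = (\<not> arrow x r t)"
    using not_arrow_iff[OF xt] jt by blast+
  have cx: "closings x G p q r t =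
      (if arrow x q t \<and> \<not> arrow x p t then G {?A, ?D, ?E} else 0)
      + (if arrow x r t \<and> \<not> arrow x q t then G {?B, ?E, ?F} else 0)
      + (if arrow x p t \<and> \<not> arrow x r t then G {?C, ?F, ?D} else 0)" for G :: "sedge set \<Rightarrow> real"
    by (simp add: closings_def closing_def tr neg)
  have cy: "closings y G r q p t =
      (if arrow x p t \<and> \<not> arrow x q t then G {?A, ?D, ?E} else 0)
      + (if arrow x q t \<and> \<not> arrow x r t then G {?B, ?E, ?F} else 0)
      + (if arrow x r t \<and> \<not> arrow x p t then G {?C, ?F, ?D} else 0)" for G :: "sedge set \<Rightarrow> real"
    by (simp add: closings_def closing_def tr_rev neg ya)
  show "closings x (\<lambda>G. f (reverse_games x G)) p q r t - closings y (\<lambda>G. f (reverse_games y G)) r q p t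
     \<le> \<gamma> * closings x (\<lambda>_. 1) p q r t"
    unfolding cx cy
  proof (rule K4_core[OF lip x dist])
    show "{?A, ?B, ?C} \<subseteq> games" using j game_in_games by blast
    show "y = reverse_games x {?A, ?B, ?C}" by (simp add: y triple_def)
    show "{?A, ?D, ?E} \<in> generator_games \<Phi> n" "{?B, ?E, ?F} \<in> generator_games \<Phi> n" "{?C, ?F, ?D} \<in> generator_games \<Phi> n"
      using triple_in_generator_games j jt tr by metis+
    show "gen_weight \<alpha> \<beta> {?A, ?D, ?E} \<le> \<gamma>" "gen_weight \<alpha> \<beta> {?B, ?E, ?F} \<le> \<gamma>" "gen_weight \<alpha> \<beta> {?C, ?F, ?D} \<le> \<gamma>"
      using wt tr by simp_all
    show "reverse_games x {?A, ?D, ?E} \<in> Tour \<Phi> n s" if "arrow x q t \<and> \<not> arrow x p t"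
      using reverse_triple_in_Tour[OF x c(1), of t] that neg tr by simp
    show "reverse_games x {?B, ?E, ?F} \<in> Tour \<Phi> n s" if "arrow x r t \<and> \<not> arrow x q t"
      using reverse_triple_in_Tour[OF x c(2), of t] that neg tr by simp
    show "reverse_games x {?C, ?F, ?D} \<in> Tour \<Phi> n s" if "arrow x p t \<and> \<not> arrow x r t"
      using reverse_triple_in_Tour[OF x c(3), of t] that neg tr by simp
    show "reverse_games y {?A, ?D, ?E} \<in> Tour \<Phi> n s" if "arrow x p t \<and> \<not> arrow x q t"
      using reverse_triple_in_Tour[OF yc(4) yc(1), of t] that neg tr_rev ya by simp
    show "reverse_games y {?B, ?E, ?F} \<in> Tour \<Phi> n s" if "arrow x q t \<and> \<not> arrow x r t"
      using reverse_triple_in_Tour[OF yc(4) yc(2), of t] that neg tr_rev ya by simp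
    show "reverse_games y {?C, ?F, ?D} \<in> Tour \<Phi> n s" if "arrow x r t \<and> \<not> arrow x p t"
      using reverse_triple_in_Tour[OF yc(4) yc(3), of t] that neg tr_rev ya by simp
  qed
  show "closings x (\<lambda>_. 1) p q r t \<le> 1" "0 \<le> closings x (\<lambda>_. 1) p q r t"
    unfolding cx by auto
qed

section \<open>Antipodal closing vertices\<close>

text \<open>Outside type C a vertex is not joined to its antipode, so the antipode of a corner
  cannot close an arrow at that corner. For the opposite arrow, which ends or starts at
  \<open>0\<close>, mirroring shows that the game of the antipode with \<open>0\<close> has the
  wrong direction.\<close>

lemma antipodal_closings_zero:
  assumes c: "arrow x p q" "arrow x q r" "arrow x r p"
    and C: "\<Phi> \<noteq> TypeC" and z: "0 \<in> {p, q, r}" and t: "t \<in> {- p, - q, - r} - {p, q, r}"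
  shows "closings x F p q r t = 0"
proof -
  have nl: "\<not> arrow x a (- a)" "\<not> arrow x (- a) a" for a
    using C arrow_joined[of x a "- a"] arrow_joined[of x "- a" a] by (auto simp: joined_def)
  have main: "closings x F 0 b d u = 0"
    if "arrow x 0 b" "arrow x b d" "arrow x d 0" "u \<in> {- b, - d}" for b d u
  proof -
    have "\<not> arrow x 0 (- b)" "\<not> arrow x (- d) 0"
      using arrow_mirror[of x 0 b] arrow_mirror[of x d 0] arrow_asym that(1,3) by auto
    then show ?thesis using that(4) nl by (auto simp: closings_def closing_def)
  qed
  from z consider "p = 0" | "q = 0" | "r = 0" by auto
  then show ?thesis
  proof cases
    case 1
    then show ?thesis using main[of q r t] c t by auto
  next
    case 2
    then show ?thesis using main[of r p t] c t closings_rotate[of x F q r p t] by auto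
  next
    case 3
    then show ?thesis using main[of p q t] c t closings_rotate[of x F r p q t] closings_rotate[of x F q r p t] by auto
  qed
qed

text \<open>The arrow from \<open>a\<close> to \<open>- b\<close> mirrors to the one from
  \<open>b\<close> to \<open>- a\<close>, so a single truth value governs each of the three games
  with the antipodes.\<close>

lemma antipodal_arrow_facts:
  assumes w: "w \<in> tournaments games" and j: "joined p (- q)" "joined q (- r)" "joined r (- p)"
  shows "arrow w q (- p) = arrow w p (- q)" "arrow w (- p) q = (\<not> arrow w p (- q))" "arrow w (- q) p = (\<not> arrow w p (- q))"
    "arrow w r (- q) = arrow w q (- r)" "arrow w (- q) r = (\<not> arrow w q (- r))" "arrow w (- r) q = (\<not> arrow w q (- r))"
    "arrow w p (- r) = arrow w r (- p)" "arrow w (- r) p = (\<not> arrow w r (- p))" "arrow w (- p) r = (\<not> arrow w r (- p))"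
proof -
  have *: "arrow w b (- a) = arrow w a (- b)" "arrow w (- a) b = (\<not> arrow w a (- b))" "arrow w (- b) a = (\<not> arrow w a (- b))"
    if "joined a (- b)" for a b
  proof -
    show 1: "arrow w b (- a) = arrow w a (- b)" using arrow_mirror[of w "- b" a] by simp
    show 2: "arrow w (- b) a = (\<not> arrow w a (- b))" using not_arrow_iff[OF w that] by simp
    show "arrow w (- a) b = (\<not> arrow w a (- b))" using 2 arrow_mirror[of w "a" "- b"] by simp
  qed
  show "arrow w q (- p) = arrow w p (- q)" "arrow w (- p) q = (\<not> arrow w p (- q))" "arrow w (- q) p = (\<not> arrow w p (- q))"
    by (rule *[OF j(1)])+
  show "arrow w r (- q) = arrow w q (- r)" "arrow w (- q) r = (\<not> arrow w q (- r))" "arrow w (- r) q = (\<not> arrow w q (- r))"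
    by (rule *[OF j(2)])+
  show "arrow w p (- r) = arrow w r (- p)" "arrow w (- r) p = (\<not> arrow w r (- p))" "arrow w (- p) r = (\<not> arrow w r (- p))"
    by (rule *[OF j(3)])+
qed

lemma antipodal_games_distinct:
  assumes "p \<noteq> 0" "q \<noteq> 0" "r \<noteq> 0" "p \<noteq> q" "q \<noteq> r" "r \<noteq> p" "p \<noteq> - q" "q \<noteq> - r" "r \<noteq> - p"
  shows "distinct [game p q, game q r, game r p, game p (- q), game q (- r), game r (- p),
    game p (- p), game q (- q), game r (- r)]"
proof -
  have ne: "q \<noteq> p" "r \<noteq> q" "p \<noteq> r" "q \<noteq> - p" "r \<noteq> - q" "p \<noteq> - r" "- p \<noteq> q" "- q \<noteq> r" "- r \<noteq> p"
    "- q \<noteq> p" "- r \<noteq> q" "- p \<noteq> r" "p \<noteq> - p" "q \<noteq> - q" "r \<noteq> - r" "- p \<noteq> p" "- q \<noteq> q" "- r \<noteq> r"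
    using assms by auto
  show ?thesis using assms ne by (simp add: game_eq_iff)
qed

lemma antipodal_triples:
  "triple p q (- r) = {game p q, game q (- r), game r (- p)}"
  "triple q r (- p) = {game q r, game r (- p), game p (- q)}"
  "triple r p (- q) = {game r p, game p (- q), game q (- r)}"
  "triple p q (- p) = {game p q, game p (- q), game p (- p)}"
  "triple r p (- p) = {game r p, game r (- p), game p (- p)}"
  "triple p q (- q) = {game p q, game p (- q), game q (- q)}"
  "triple q r (- q) = {game q r, game q (- r), game q (- q)}"
  "triple q r (- r) = {game q r, game q (- r), game r (- r)}"
  "triple r p (- r) = {game r p, game r (- p), game r (- r)}"
proof -
  have m: "game (- a) b = game a (- b)" "game b (- a) = game a (- b)" "game (- b) a = game a (- b)" for a b
    using game_minus[of a "- b"] game_commute[of b "- a"] game_commute[of a "- b"] by simp_all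
  show "triple p q (- r) = {game p q, game q (- r), game r (- p)}"
    "triple q r (- p) = {game q r, game r (- p), game p (- q)}"
    "triple r p (- q) = {game r p, game p (- q), game q (- r)}"
    "triple p q (- p) = {game p q, game p (- q), game p (- p)}"
    "triple r p (- p) = {game r p, game r (- p), game p (- p)}"
    "triple p q (- q) = {game p q, game p (- q), game q (- q)}"
    "triple q r (- q) = {game q r, game q (- r), game q (- q)}"
    "triple q r (- r) = {game q r, game q (- r), game r (- r)}"
    "triple r p (- r) = {game r p, game r (- p), game r (- r)}"
    unfolding triple_def m[where a = p and b = q] m[where a = q and b = r] m[where a = r and b = p] m(1)[of p p] m(1)[of q q] m(1)[of r r]
    by (simp_all only: insert_commute)
qed

lemma arrow_outside_triple:
  assumes "x \<in> tournaments games" "joined a b" "game a b \<notin> D"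
  shows "arrow (reverse_games x D) a b = arrow x a b"
  using arrow_reverse_games[OF assms(1,2)] assms(3) by simp

text \<open>Without loops the six games on the three antipodal pairs form a \<open>K4\<close>. The
  only possible antipodal closings are the triples \<open>p q (- r)\<close>,
  \<open>q r (- p)\<close> and \<open>r p (- q)\<close>, which are its other three triangles, and
  \<open>K4_core\<close> applies.\<close>

lemma antipodal_closings_BD:
  assumes lip: "lipschitz s \<alpha> \<beta> f" and ab: "\<beta> \<le> \<alpha>" and x: "x \<in> Tour \<Phi> n s"
    and c: "arrow x p q" "arrow x q r" "arrow x r p" and nc: "p \<noteq> - q" "q \<noteq> - r" "r \<noteq> - p"
    and C: "\<Phi> \<noteq> TypeC" and nz: "p \<noteq> 0" "q \<noteq> 0" "r \<noteq> 0"
    and y: "y = reverse_games x (triple p q r)"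
  shows "(\<Sum>t\<in>{- p, - q, - r}. closings x (\<lambda>G. gen_mult n G * f (reverse_games x G)) p q r t)
    - (\<Sum>t\<in>{- p, - q, - r}. closings y (\<lambda>G. gen_mult n G * f (reverse_games y G)) r q p t)
    \<le> \<alpha> * (\<Sum>t\<in>{- p, - q, - r}. closings x (gen_mult n) p q r t)"
proof -
  note xt = Tour_tournaments[OF x]
  note yc = arrow_reversed_triple[OF x c y]
  note yt = Tour_tournaments[OF yc(4)]
  have j: "joined p q" "joined q r" "joined r p" using c arrow_joined by blast+
  have ne: "p \<noteq> q" "q \<noteq> r" "r \<noteq> p" using j by (auto simp: joined_def)
  have v: "p \<in> verts" "q \<in> verts" "r \<in> verts" using j by (auto simp: joined_def)
  have ja: "joined p (- q)" "joined q (- r)" "joined r (- p)" using v ne nc by (auto simp: joined_def)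
  have ja': "joined q (- r)" "joined r (- p)" "joined p (- q)" "joined (- r) p" "joined (- p) q" "joined (- q) r"
    using ja joined_minus[of r "- p"] joined_minus[of p "- q"] joined_minus[of q "- r"] joined_sym by auto
  let ?A = "game p q" and ?B = "game q r" and ?C = "game r p" and ?D = "game p (- q)" and ?E = "game q (- r)" and ?F = "game r (- p)"
  have dist: "distinct [?A, ?B, ?C, ?E, ?F, ?D]"
    using antipodal_games_distinct[OF nz ne nc] by auto
  note fx = antipodal_arrow_facts[OF xt ja]
  have yx: "arrow y p (- q) = arrow x p (- q)" "arrow y q (- r) = arrow x q (- r)" "arrow y r (- p) = arrow x r (- p)"
    unfolding y using dist by (auto intro!: arrow_outside_triple[OF xt] ja simp: triple_def)
  note fy = antipodal_arrow_facts[OF yt ja, unfolded yx]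
  have nl: "\<not> arrow w a (- a)" "\<not> arrow w (- a) a" for a w
    using C arrow_joined[of w a "- a"] arrow_joined[of w "- a" a] by (auto simp: joined_def)
  have d3: "- p \<noteq> - q" "- q \<noteq> - r" "- p \<noteq> - r" using ne by auto
  have tri: "triple p q (- r) = {?A, ?E, ?F}" "triple q r (- p) = {?B, ?F, ?D}" "triple r p (- q) = {?C, ?D, ?E}"
    by (rule antipodal_triples)+
  have tri': "triple q p (- r) = {?A, ?E, ?F}" "triple r q (- p) = {?B, ?F, ?D}" "triple p r (- q) = {?C, ?D, ?E}"
    using tri triple_swap by metis+
  have g1: "gen_mult n {?A, ?E, ?F} = 1" "gen_mult n {?B, ?F, ?D} = 1" "gen_mult n {?C, ?D, ?E} = 1"
    using triple_not_clover[of p q "- r"] triple_not_clover[of q r "- p"] triple_not_clover[of r p "- q"] nc ne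
    unfolding tri by (auto simp: gen_mult_def)
  define a1 a2 a3 where "a1 = arrow x p (- q)" and "a2 = arrow x q (- r)" and "a3 = arrow x r (- p)"
  \<comment> \<open>The double negations make the formula an instance of \<open>K4_core\<close> with
    \<open>d\<close>, \<open>e\<close>, \<open>g\<close> equal to \<open>\<not> a2\<close>,
    \<open>\<not> a3\<close>, \<open>\<not> a1\<close>.\<close>
  have cx: "(\<Sum>t\<in>{- p, - q, - r}. closings x H p q r t) =
      (if \<not> a3 \<and> \<not> \<not> a2 then H {?A, ?E, ?F} else 0) + (if \<not> a1 \<and> \<not> \<not> a3 then H {?B, ?F, ?D} else 0)
      + (if \<not> a2 \<and> \<not> \<not> a1 then H {?C, ?D, ?E} else 0)" for H :: "sedge set \<Rightarrow> real"
    using d3 nl by (auto simp: closings_def closing_def tri fx a1_def a2_def a3_def)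
  have cy: "(\<Sum>t\<in>{- p, - q, - r}. closings y H r q p t) =
      (if \<not> a2 \<and> \<not> \<not> a3 then H {?A, ?E, ?F} else 0) + (if \<not> a3 \<and> \<not> \<not> a1 then H {?B, ?F, ?D} else 0)
      + (if \<not> a1 \<and> \<not> \<not> a2 then H {?C, ?D, ?E} else 0)" for H :: "sedge set \<Rightarrow> real"
    using d3 nl by (auto simp: closings_def closing_def tri' fy yx a1_def a2_def a3_def)
  have w: "gen_weight \<alpha> \<beta> G \<le> \<alpha>" for G using ab by (simp add: gen_weight_def)
  have ga: "{?A, ?E, ?F} \<in> generator_games \<Phi> n" "{?B, ?F, ?D} \<in> generator_games \<Phi> n" "{?C, ?D, ?E} \<in> generator_games \<Phi> n"
    using triple_in_generator_games[OF j(1) ja'(1,4)] triple_in_generator_games[OF j(2) ja'(2,5)]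
      triple_in_generator_games[OF j(3) ja'(3,6)] unfolding tri by auto
  show ?thesis
    unfolding cx cy g1 mult_1
  proof (rule K4_core[OF lip x dist _ _ ga w w w])
    show "{?A, ?B, ?C} \<subseteq> games" using j game_in_games by blast
    show "y = reverse_games x {?A, ?B, ?C}" by (simp add: y triple_def)
    show "reverse_games x {?A, ?E, ?F} \<in> Tour \<Phi> n s" if "\<not> a3 \<and> \<not> \<not> a2"
      using reverse_triple_in_Tour[OF x c(1), of "- r"] that fx tri by (simp add: a1_def a2_def a3_def)
    show "reverse_games x {?B, ?F, ?D} \<in> Tour \<Phi> n s" if "\<not> a1 \<and> \<not> \<not> a3"
      using reverse_triple_in_Tour[OF x c(2), of "- p"] that fx tri by (simp add: a1_def a2_def a3_def)
    show "reverse_games x {?C, ?D, ?E} \<in> Tour \<Phi> n s" if "\<not> a2 \<and> \<not> \<not> a1"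
      using reverse_triple_in_Tour[OF x c(3), of "- q"] that fx tri by (simp add: a1_def a2_def a3_def)
    show "reverse_games y {?A, ?E, ?F} \<in> Tour \<Phi> n s" if "\<not> a2 \<and> \<not> \<not> a3"
      using reverse_triple_in_Tour[OF yc(4) yc(1), of "- r"] that fy yx tri' by (simp add: a1_def a2_def a3_def)
    show "reverse_games y {?B, ?F, ?D} \<in> Tour \<Phi> n s" if "\<not> a3 \<and> \<not> \<not> a1"
      using reverse_triple_in_Tour[OF yc(4) yc(2), of "- p"] that fy yx tri' by (simp add: a1_def a2_def a3_def)
    show "reverse_games y {?C, ?D, ?E} \<in> Tour \<Phi> n s" if "\<not> a1 \<and> \<not> \<not> a2"
      using reverse_triple_in_Tour[OF yc(4) yc(3), of "- q"] that fy yx tri' by (simp add: a1_def a2_def a3_def)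
  qed
qed

text \<open>With loops each antipodal vertex can close one arrow to an ordinary triangle and two to
  clovers, so nine generators on nine games have to be matched. The Lipschitz links between them are
  collected here, and \<open>clover_octahedron_arith\<close> combines them.\<close>

lemma antipodal_closings_C:
  assumes lip: "lipschitz s \<alpha> \<beta> f" and ab: "\<beta> \<le> \<alpha>" "\<alpha> \<le> 2 * \<beta>" and x: "x \<in> Tour \<Phi> n s"
    and c: "arrow x p q" "arrow x q r" "arrow x r p" and nc: "p \<noteq> - q" "q \<noteq> - r" "r \<noteq> - p"
    and C: "\<Phi> = TypeC"
    and y: "y = reverse_games x (triple p q r)"
  shows "(\<Sum>t\<in>{- p, - q, - r}. closings x (\<lambda>G. gen_mult n G * f (reverse_games x G)) p q r t)
    - (\<Sum>t\<in>{- p, - q, - r}. closings y (\<lambda>G. gen_mult n G * f (reverse_games y G)) r q p t)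
    \<le> \<alpha> * (\<Sum>t\<in>{- p, - q, - r}. closings x (gen_mult n) p q r t) + (4 * \<beta> - 2 * \<alpha>)"
proof -
  note xt = Tour_tournaments[OF x]
  note yc = arrow_reversed_triple[OF x c y]
  note yt = Tour_tournaments[OF yc(4)]
  have j: "joined p q" "joined q r" "joined r p" using c arrow_joined by blast+
  have ne: "p \<noteq> q" "q \<noteq> r" "r \<noteq> p" using j by (auto simp: joined_def)
  have v: "p \<in> verts" "q \<in> verts" "r \<in> verts" using j by (auto simp: joined_def)
  have nz: "p \<noteq> 0" "q \<noteq> 0" "r \<noteq> 0" using v C by (auto simp: coxeter.verts_def)
  have ja: "joined p (- q)" "joined q (- r)" "joined r (- p)" using v ne nc by (auto simp: joined_def)
  have jl: "joined p (- p)" "joined q (- q)" "joined r (- r)" using v nz C by (auto simp: coxeter.joined_def coxeter.uminus_verts)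
  have jj: "joined q p" "joined r q" "joined p r" "joined q (- p)" "joined r (- q)" "joined p (- r)"
    "joined (- p) q" "joined (- q) r" "joined (- r) p" "joined (- q) p" "joined (- r) q" "joined (- p) r"
    "joined (- p) p" "joined (- q) q" "joined (- r) r"
    using j ja jl joined_sym joined_minus[of p "- q"] joined_minus[of q "- r"] joined_minus[of r "- p"] by auto
  let ?A = "game p q" and ?B = "game q r" and ?C = "game r p" and ?D = "game p (- q)" and ?E = "game q (- r)" and ?F = "game r (- p)"
    and ?P = "game p (- p)" and ?Q = "game q (- q)" and ?R = "game r (- r)"
  have dist: "distinct [?A, ?B, ?C, ?D, ?E, ?F, ?P, ?Q, ?R]"
    by (rule antipodal_games_distinct[OF nz ne nc])
  note fx = antipodal_arrow_facts[OF xt ja]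
  have out: "arrow y a b = arrow x a b" if "joined a b" "game a b \<in> {?D, ?E, ?F, ?P, ?Q, ?R}" for a b
    unfolding y using dist that by (intro arrow_outside_triple[OF xt]) (auto simp: triple_def)
  have yx: "arrow y p (- q) = arrow x p (- q)" "arrow y q (- r) = arrow x q (- r)" "arrow y r (- p) = arrow x r (- p)"
    "arrow y p (- p) = arrow x p (- p)" "arrow y q (- q) = arrow x q (- q)" "arrow y r (- r) = arrow x r (- r)"
    using out ja jl by auto
  note fy = antipodal_arrow_facts[OF yt ja, unfolded yx]
  have lx: "arrow x (- p) p = (\<not> arrow x p (- p))" "arrow x (- q) q = (\<not> arrow x q (- q))" "arrow x (- r) r = (\<not> arrow x r (- r))"
    using not_arrow_iff[OF xt] jl by blast+
  have ly: "arrow y (- p) p = (\<not> arrow x p (- p))" "arrow y (- q) q = (\<not> arrow x q (- q))" "arrow y (- r) r = (\<not> arrow x r (- r))"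
    using not_arrow_iff[OF yt] jl yx by blast+
  have d3: "- p \<noteq> - q" "- q \<noteq> - r" "- p \<noteq> - r" using ne by auto
  define TA TB TC where T_def: "TA = triple p q (- r)" "TB = triple q r (- p)" "TC = triple r p (- q)"
  define P1 P2 Q1 Q2 R1 R2 where K_def: "P1 = triple p q (- p)" "P2 = triple r p (- p)" "Q1 = triple p q (- q)"
    "Q2 = triple q r (- q)" "R1 = triple q r (- r)" "R2 = triple r p (- r)"
  note defs = T_def K_def
  have sets: "TA = {?A, ?E, ?F}" "TB = {?B, ?F, ?D}" "TC = {?C, ?D, ?E}" "P1 = {?A, ?D, ?P}" "P2 = {?C, ?F, ?P}"
    "Q1 = {?A, ?D, ?Q}" "Q2 = {?B, ?E, ?Q}" "R1 = {?B, ?E, ?R}" "R2 = {?C, ?F, ?R}"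
    unfolding defs by (rule antipodal_triples)+
  have sw: "triple q p t = triple p q t" "triple r q t = triple q r t" "triple p r t = triple r p t" for t
    by (rule triple_swap)+
  have gT: "gen_mult n TA = 1" "gen_mult n TB = 1" "gen_mult n TC = 1"
    "gen_weight \<alpha> \<beta> TA = \<alpha>" "gen_weight \<alpha> \<beta> TB = \<alpha>" "gen_weight \<alpha> \<beta> TC = \<alpha>"
    using triple_not_clover[of p q "- r"] triple_not_clover[of q r "- p"] triple_not_clover[of r p "- q"] nc ne
    unfolding T_def by (auto simp: gen_mult_def gen_weight_def)
  have clv: "triple a b (- a) \<in> clovers n" "triple b a (- a) \<in> clovers n"
    if "joined a (- a)" "joined a b" "joined b (- a)" for a b
  proof -
    have "triple a (- a) b \<in> clovers n" by (rule triple_in_clovers[OF that])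
    moreover have "triple a b (- a) = triple a (- a) b" "triple b a (- a) = triple a (- a) b"
      using triple_rotate triple_flip by metis+
    ultimately show "triple a b (- a) \<in> clovers n" "triple b a (- a) \<in> clovers n" by simp_all
  qed
  have K: "P1 \<in> clovers n" "P2 \<in> clovers n" "Q1 \<in> clovers n" "Q2 \<in> clovers n" "R1 \<in> clovers n" "R2 \<in> clovers n"
    unfolding K_def using clv j ja jl jj by auto
  have gK: "gen_mult n P1 = 2" "gen_mult n P2 = 2" "gen_mult n Q1 = 2" "gen_mult n Q2 = 2" "gen_mult n R1 = 2" "gen_mult n R2 = 2"
    "gen_weight \<alpha> \<beta> P1 = \<beta>" "gen_weight \<alpha> \<beta> P2 = \<beta>" "gen_weight \<alpha> \<beta> Q1 = \<beta>" "gen_weight \<alpha> \<beta> Q2 = \<beta>"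
    "gen_weight \<alpha> \<beta> R1 = \<beta>" "gen_weight \<alpha> \<beta> R2 = \<beta>"
    using K by (simp_all add: gen_mult_def gen_weight_def)
  have gen: "{TA, TB, TC, P1, P2, Q1, Q2, R1, R2} \<subseteq> generator_games \<Phi> n"
    unfolding defs using triple_in_generator_games j ja jl jj by simp
  define a1 a2 a3 where a_def: "a1 = arrow x p (- q)" "a2 = arrow x q (- r)" "a3 = arrow x r (- p)"
  define lp lq lr where l_def: "lp = arrow x p (- p)" "lq = arrow x q (- q)" "lr = arrow x r (- r)"
  note fold = a_def[symmetric] l_def[symmetric]
  have vx: "reverse_games x TA \<in> Tour \<Phi> n s" if "a2 \<and> \<not> a3"
    using reverse_triple_in_Tour[OF x c(1), of "- r"] that unfolding defs fx fold by simp
  have vx2: "reverse_games x TB \<in> Tour \<Phi> n s" if "a3 \<and> \<not> a1"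
    using reverse_triple_in_Tour[OF x c(2), of "- p"] that unfolding defs fx fold by simp
  have vx3: "reverse_games x TC \<in> Tour \<Phi> n s" if "a1 \<and> \<not> a2"
    using reverse_triple_in_Tour[OF x c(3), of "- q"] that unfolding defs fx fold by simp
  have vp1: "reverse_games x P1 \<in> Tour \<Phi> n s" if "a1 \<and> \<not> lp"
    using reverse_triple_in_Tour[OF x c(1), of "- p"] that unfolding defs fx lx fold by simp
  have vp2: "reverse_games x P2 \<in> Tour \<Phi> n s" if "\<not> a3 \<and> lp"
    using reverse_triple_in_Tour[OF x c(3), of "- p"] that unfolding defs fx lx fold by simp
  have vq1: "reverse_games x Q1 \<in> Tour \<Phi> n s" if "\<not> a1 \<and> lq"
    using reverse_triple_in_Tour[OF x c(1), of "- q"] that unfolding defs fx lx fold by simp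
  have vq2: "reverse_games x Q2 \<in> Tour \<Phi> n s" if "a2 \<and> \<not> lq"
    using reverse_triple_in_Tour[OF x c(2), of "- q"] that unfolding defs fx lx fold by simp
  have vr1: "reverse_games x R1 \<in> Tour \<Phi> n s" if "\<not> a2 \<and> lr"
    using reverse_triple_in_Tour[OF x c(2), of "- r"] that unfolding defs fx lx fold by simp
  have vr2: "reverse_games x R2 \<in> Tour \<Phi> n s" if "a3 \<and> \<not> lr"
    using reverse_triple_in_Tour[OF x c(3), of "- r"] that unfolding defs fx lx fold by simp
  have wa: "reverse_games y TA \<in> Tour \<Phi> n s" if "a3 \<and> \<not> a2"
    using reverse_triple_in_Tour[OF yc(4) yc(1), of "- r"] that unfolding defs sw fy yx fold by simp
  have wb: "reverse_games y TB \<in> Tour \<Phi> n s" if "a1 \<and> \<not> a3"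
    using reverse_triple_in_Tour[OF yc(4) yc(2), of "- p"] that unfolding defs sw fy yx fold by simp
  have wc: "reverse_games y TC \<in> Tour \<Phi> n s" if "a2 \<and> \<not> a1"
    using reverse_triple_in_Tour[OF yc(4) yc(3), of "- q"] that unfolding defs sw fy yx fold by simp
  have wp1: "reverse_games y P1 \<in> Tour \<Phi> n s" if "\<not> a1 \<and> lp"
    using reverse_triple_in_Tour[OF yc(4) yc(1), of "- p"] that unfolding defs sw fy yx ly fold by simp
  have wp2: "reverse_games y P2 \<in> Tour \<Phi> n s" if "a3 \<and> \<not> lp"
    using reverse_triple_in_Tour[OF yc(4) yc(3), of "- p"] that unfolding defs sw fy yx ly fold by simp
  have wq1: "reverse_games y Q1 \<in> Tour \<Phi> n s" if "a1 \<and> \<not> lq"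
    using reverse_triple_in_Tour[OF yc(4) yc(1), of "- q"] that unfolding defs sw fy yx ly fold by simp
  have wq2: "reverse_games y Q2 \<in> Tour \<Phi> n s" if "\<not> a2 \<and> lq"
    using reverse_triple_in_Tour[OF yc(4) yc(2), of "- q"] that unfolding defs sw fy yx ly fold by simp
  have wr1: "reverse_games y R1 \<in> Tour \<Phi> n s" if "a2 \<and> \<not> lr"
    using reverse_triple_in_Tour[OF yc(4) yc(2), of "- r"] that unfolding defs sw fy yx ly fold by simp
  have wr2: "reverse_games y R2 \<in> Tour \<Phi> n s" if "\<not> a3 \<and> lr"
    using reverse_triple_in_Tour[OF yc(4) yc(3), of "- r"] that unfolding defs sw fy yx ly fold by simp
  have sub: "{?A, ?B, ?C} \<subseteq> games" using j game_in_games by blast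
  have yA: "y = reverse_games x {?A, ?B, ?C}" by (simp add: y triple_def)
  have link: "f (reverse_games x X) - f (reverse_games y Y) \<le> gen_weight \<alpha> \<beta> Z \<and>
      f (reverse_games y Y) - f (reverse_games x X) \<le> gen_weight \<alpha> \<beta> Z"
    if "covers_evenly {?A, ?B, ?C} X Y Z" "reverse_games x X \<in> Tour \<Phi> n s" "reverse_games y Y \<in> Tour \<Phi> n s"
      "X \<in> {TA, TB, TC, P1, P2, Q1, Q2, R1, R2}" "Z \<in> {TA, TB, TC, P1, P2, Q1, Q2, R1, R2}" for X Y Z
  proof -
    have "X \<subseteq> games" "Z \<in> generator_games \<Phi> n" using that(4,5) gen generator_subset_games by blast+
    then show ?thesis
      using lipschitz_even_cover[OF lip x sub _ _ that(1)] that(2,3) unfolding yA by (simp add: abs_le_iff)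
  qed
  \<comment> \<open>The first even cover is the \<open>K4\<close> of the loopless types. In each of
    the other three, two clovers with a common loop are completed by one ordinary triangle.\<close>
  have e1: "covers_evenly {?A, ?B, ?C} TA TB TC" using dist unfolding sets covers_evenly_def by auto
  have e2: "covers_evenly {?A, ?B, ?C} P1 P2 TB" using dist unfolding sets covers_evenly_def by auto
  have e3: "covers_evenly {?A, ?B, ?C} Q1 Q2 TC" using dist unfolding sets covers_evenly_def by auto
  have e4: "covers_evenly {?A, ?B, ?C} R1 R2 TA" using dist unfolding sets covers_evenly_def by auto
  note s1 = covers_evenly_swap(1) and s2 = covers_evenly_swap(2)
  have cx: "(\<Sum>t\<in>{- p, - q, - r}. closings x H p q r t) =
      (if a2 \<and> \<not> a3 then H TA else 0) + (if a3 \<and> \<not> a1 then H TB else 0) + (if a1 \<and> \<not> a2 then H TC else 0)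
      + ((if a1 \<and> \<not> lp then H P1 else 0) + (if \<not> a3 \<and> lp then H P2 else 0)
        + (if \<not> a1 \<and> lq then H Q1 else 0) + (if a2 \<and> \<not> lq then H Q2 else 0)
        + (if \<not> a2 \<and> lr then H R1 else 0) + (if a3 \<and> \<not> lr then H R2 else 0))" for H :: "sedge set \<Rightarrow> real"
    using d3 by (simp add: closings_def closing_def fx lx fold defs[symmetric] conj_commute)
  have cy: "(\<Sum>t\<in>{- p, - q, - r}. closings y H r q p t) =
      (if a3 \<and> \<not> a2 then H TA else 0) + (if a1 \<and> \<not> a3 then H TB else 0) + (if a2 \<and> \<not> a1 then H TC else 0)
      + ((if \<not> a1 \<and> lp then H P1 else 0) + (if a3 \<and> \<not> lp then H P2 else 0)
        + (if a1 \<and> \<not> lq then H Q1 else 0) + (if \<not> a2 \<and> lq then H Q2 else 0)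
        + (if a2 \<and> \<not> lr then H R1 else 0) + (if \<not> a3 \<and> lr then H R2 else 0))" for H :: "sedge set \<Rightarrow> real"
    using d3 by (simp add: closings_def closing_def fy yx ly fold sw defs[symmetric] conj_commute)
  \<comment> \<open>The multiplicity of the clovers is pulled out to reach the shape of the
    arithmetic lemma.\<close>
  have two: "(if b then 2 * u else 0) = 2 * (if b then u else 0)" "(if b then 2 else 0) = 2 * (if b then 1 else (0::real))" for b and u :: real
    by simp_all
  show ?thesis
    unfolding cx cy gT gK mult_1 two distrib_left[symmetric]
  proof (rule clover_octahedron_arith[OF ab])
    show "f (reverse_games y TB) - f (reverse_games x TA) \<le> \<alpha>" if "a2 \<and> \<not> a3" "a1 \<and> \<not> a3"
      using link[OF e1 vx wb] that gT by simp
    show "f (reverse_games y TC) - f (reverse_games x TA) \<le> \<alpha>" if "a2 \<and> \<not> a3" "a2 \<and> \<not> a1"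
      using link[OF s2[OF e1] vx wc] that gT by simp
    show "f (reverse_games y TA) - f (reverse_games x TB) \<le> \<alpha>" if "a3 \<and> \<not> a1" "a3 \<and> \<not> a2"
      using link[OF s1[OF e1] vx2 wa] that gT by simp
    show "f (reverse_games y TC) - f (reverse_games x TB) \<le> \<alpha>" if "a3 \<and> \<not> a1" "a2 \<and> \<not> a1"
      using link[OF s2[OF s1[OF e1]] vx2 wc] that gT by simp
    show "f (reverse_games y TA) - f (reverse_games x TC) \<le> \<alpha>" if "a1 \<and> \<not> a2" "a3 \<and> \<not> a2"
      using link[OF s1[OF s2[OF e1]] vx3 wa] that gT by simp
    show "f (reverse_games y TB) - f (reverse_games x TC) \<le> \<alpha>" if "a1 \<and> \<not> a2" "a1 \<and> \<not> a3"
      using link[OF s2[OF s1[OF s2[OF e1]]] vx3 wb] that gT by simp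
    show "f (reverse_games x P1) - f (reverse_games y TB) \<le> \<beta>" if "a1 \<and> \<not> lp" "a1 \<and> \<not> a3"
      using link[OF s2[OF e2] vp1 wb] that gK by simp
    show "f (reverse_games x P2) - f (reverse_games y TB) \<le> \<beta>" if "\<not> a3 \<and> lp" "a1 \<and> \<not> a3"
      using link[OF s2[OF s1[OF e2]] vp2 wb] that gK by simp
    show "f (reverse_games x Q1) - f (reverse_games y TC) \<le> \<beta>" if "\<not> a1 \<and> lq" "a2 \<and> \<not> a1"
      using link[OF s2[OF e3] vq1 wc] that gK by simp
    show "f (reverse_games x Q2) - f (reverse_games y TC) \<le> \<beta>" if "a2 \<and> \<not> lq" "a2 \<and> \<not> a1"
      using link[OF s2[OF s1[OF e3]] vq2 wc] that gK by simp
    show "f (reverse_games x R1) - f (reverse_games y TA) \<le> \<beta>" if "\<not> a2 \<and> lr" "a3 \<and> \<not> a2"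
      using link[OF s2[OF e4] vr1 wa] that gK by simp
    show "f (reverse_games x R2) - f (reverse_games y TA) \<le> \<beta>" if "a3 \<and> \<not> lr" "a3 \<and> \<not> a2"
      using link[OF s2[OF s1[OF e4]] vr2 wa] that gK by simp
    show "f (reverse_games x TB) - f (reverse_games y P1) \<le> \<beta>" if "a3 \<and> \<not> a1" "\<not> a1 \<and> lp"
      using link[OF s1[OF s2[OF e2]] vx2 wp1] that gK by simp
    show "f (reverse_games x TB) - f (reverse_games y P2) \<le> \<beta>" if "a3 \<and> \<not> a1" "a3 \<and> \<not> lp"
      using link[OF s2[OF s1[OF s2[OF e2]]] vx2 wp2] that gK by simp
    show "f (reverse_games x TC) - f (reverse_games y Q1) \<le> \<beta>" if "a1 \<and> \<not> a2" "a1 \<and> \<not> lq"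
      using link[OF s1[OF s2[OF e3]] vx3 wq1] that gK by simp
    show "f (reverse_games x TC) - f (reverse_games y Q2) \<le> \<beta>" if "a1 \<and> \<not> a2" "\<not> a2 \<and> lq"
      using link[OF s2[OF s1[OF s2[OF e3]]] vx3 wq2] that gK by simp
    show "f (reverse_games x TA) - f (reverse_games y R1) \<le> \<beta>" if "a2 \<and> \<not> a3" "a2 \<and> \<not> lr"
      using link[OF s1[OF s2[OF e4]] vx wr1] that gK by simp
    show "f (reverse_games x TA) - f (reverse_games y R2) \<le> \<beta>" if "a2 \<and> \<not> a3" "\<not> a3 \<and> lr"
      using link[OF s2[OF s1[OF s2[OF e4]]] vx wr2] that gK by simp
    show "f (reverse_games x P1) - f (reverse_games y P2) \<le> \<alpha>" if "a1 \<and> \<not> lp" "a3 \<and> \<not> lp"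
      using link[OF e2 vp1 wp2] that gT by simp
    show "f (reverse_games x P2) - f (reverse_games y P1) \<le> \<alpha>" if "\<not> a3 \<and> lp" "\<not> a1 \<and> lp"
      using link[OF s1[OF e2] vp2 wp1] that gT by simp
    show "f (reverse_games x Q1) - f (reverse_games y Q2) \<le> \<alpha>" if "\<not> a1 \<and> lq" "\<not> a2 \<and> lq"
      using link[OF e3 vq1 wq2] that gT by simp
    show "f (reverse_games x Q2) - f (reverse_games y Q1) \<le> \<alpha>" if "a2 \<and> \<not> lq" "a1 \<and> \<not> lq"
      using link[OF s1[OF e3] vq2 wq1] that gT by simp
    show "f (reverse_games x R1) - f (reverse_games y R2) \<le> \<alpha>" if "\<not> a2 \<and> lr" "\<not> a3 \<and> lr"
      using link[OF e4 vr1 wr2] that gT by simp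
    show "f (reverse_games x R2) - f (reverse_games y R1) \<le> \<alpha>" if "a3 \<and> \<not> lr" "a2 \<and> \<not> lr"
      using link[OF s1[OF e4] vr2 wr1] that gT by simp
  qed
qed

section \<open>Contraction of the walk\<close>

lemma gen_weight_le: "\<beta> \<le> \<alpha> \<Longrightarrow> gen_weight \<alpha> \<beta> G \<le> \<alpha>"
  by (simp add: gen_weight_def)

lemma closings_cong:
  assumes "F (triple p q t) = H (triple p q t)" "F (triple q r t) = H (triple q r t)" "F (triple r p t) = H (triple r p t)"
  shows "closings x F p q r t = closings x H p q r t"
  using assms by (simp add: closings_def closing_def)

text \<open>Closing vertices away from all of \<open>p\<close>, \<open>q\<close>, \<open>r\<close>
  and their antipodes are compared one at a time by \<open>closings_K4\<close>. The antipodal ones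
  interact and are compared together.\<close>

lemma touching_diff_triangle:
  assumes lip: "lipschitz s \<alpha> \<beta> f" and ab: "\<beta> \<le> \<alpha>" "\<alpha> \<le> 2 * \<beta>" and x: "x \<in> Tour \<Phi> n s"
    and c: "arrow x p q" "arrow x q r" "arrow x r p" and nc: "p \<noteq> - q" "q \<noteq> - r" "r \<noteq> - p"
    and y: "y = reverse_games x (triple p q r)"
  shows "(\<Sum>G\<in>touching s x (triple p q r). gen_mult n G * f (reverse_games x G))
    - (\<Sum>G\<in>touching s y (triple p q r). gen_mult n G * f (reverse_games y G))
    \<le> \<alpha> * (\<Sum>G\<in>touching s x (triple p q r). gen_mult n G)
      + (if \<Phi> = TypeC then 4 * \<beta> - 2 * \<alpha> else 0)"
proof -
  note yc = arrow_reversed_triple[OF x c y]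
  have v: "p \<in> verts" "q \<in> verts" "r \<in> verts" using c arrow_joined by (auto simp: joined_def)
  define W where "W = verts - {p, q, r, - p, - q, - r}"
  \<comment> \<open>Removing \<open>{p, q, r}\<close> has an effect only if one of them is
    \<open>0\<close>, its own antipode.\<close>
  define A where "A = {- p, - q, - r} - {p, q, r}"
  have split: "verts - {p, q, r} = W \<union> A" "W \<inter> A = {}" "finite W" "finite A"
    using v by (auto simp: W_def A_def)
  have sum: "(\<Sum>t\<in>verts - {p, q, r}. h t) = (\<Sum>t\<in>W. h t) + (\<Sum>t\<in>A. h t)" for h :: "int \<Rightarrow> real"
    unfolding split(1) by (rule sum.union_disjoint) (use split in auto)
  have set: "verts - {r, q, p} = verts - {p, q, r}" by auto
  let ?X = "\<lambda>G. gen_mult n G * f (reverse_games x G)" and ?Y = "\<lambda>G. gen_mult n G * f (reverse_games y G)"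
  have sx: "(\<Sum>G\<in>touching s x (triple p q r). H G) = (\<Sum>t\<in>W. closings x H p q r t) + (\<Sum>t\<in>A. closings x H p q r t)" for H
    unfolding sum_touching_triangle[OF x c nc] sum ..
  have nc': "r \<noteq> - q" "q \<noteq> - p" "p \<noteq> - r" using nc by auto
  have sy: "(\<Sum>G\<in>touching s y (triple p q r). H G) = (\<Sum>t\<in>W. closings y H r q p t) + (\<Sum>t\<in>A. closings y H r q p t)" for H
    using sum_touching_triangle[OF yc(4) yc(2,1,3) nc', of H] unfolding set sum triple_flip[of r q p] .
  have W: "(\<Sum>t\<in>W. closings x ?X p q r t) - (\<Sum>t\<in>W. closings y ?Y r q p t) \<le> \<alpha> * (\<Sum>t\<in>W. closings x (gen_mult n) p q r t)"
  proof -
    have "closings x ?X p q r t - closings y ?Y r q p t \<le> \<alpha> * closings x (gen_mult n) p q r t" if "t \<in> W" for t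
    proof -
      have t: "t \<in> verts - {p, q, r, - p, - q, - r}" using that by (simp add: W_def)
      have g: "gen_mult n (triple a b t) = 1" if "a \<in> {p, q, r}" "b \<in> {p, q, r}" "a \<noteq> - b" for a b
      proof -
        have "triple a b t \<notin> clovers n" by (rule triple_not_clover) (use that t in auto)
        then show ?thesis by (simp add: gen_mult_def)
      qed
      have g6: "gen_mult n (triple p q t) = 1" "gen_mult n (triple q r t) = 1" "gen_mult n (triple r p t) = 1"
        "gen_mult n (triple r q t) = 1" "gen_mult n (triple q p t) = 1" "gen_mult n (triple p r t) = 1"
        using g nc nc' by auto
      have "closings x ?X p q r t = closings x (\<lambda>G. f (reverse_games x G)) p q r t"
        "closings y ?Y r q p t = closings y (\<lambda>G. f (reverse_games y G)) r q p t"
        "closings x (gen_mult n) p q r t = closings x (\<lambda>_. 1) p q r t"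
        by (rule closings_cong; simp add: g6)+
      then show ?thesis
        using closings_K4(1)[OF lip x c y t, of \<alpha>] gen_weight_le[OF ab(1)] by simp
    qed
    then show ?thesis by (simp add: sum_subtractf[symmetric] sum_distrib_left sum_mono)
  qed
  have A: "(\<Sum>t\<in>A. closings x ?X p q r t) - (\<Sum>t\<in>A. closings y ?Y r q p t)
    \<le> \<alpha> * (\<Sum>t\<in>A. closings x (gen_mult n) p q r t) + (if \<Phi> = TypeC then 4 * \<beta> - 2 * \<alpha> else 0)"
  proof (cases "0 \<in> {p, q, r}")
    case True
    then have C: "\<Phi> \<noteq> TypeC" using v by (auto simp: coxeter.verts_def)
    have "closings x H p q r t = 0" "closings y H r q p t = 0" if "t \<in> A" for t H
      using antipodal_closings_zero[OF c C, of t H] antipodal_closings_zero[OF yc(2,1,3) C, of t H] True that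
      by (auto simp: A_def)
    then show ?thesis using C by simp
  next
    case False
    then have nz: "p \<noteq> 0" "q \<noteq> 0" "r \<noteq> 0" by auto
    then have A: "A = {- p, - q, - r}" using nc nc' by (auto simp: A_def)
    show ?thesis
      using antipodal_closings_BD[OF lip ab(1) x c nc _ nz y] antipodal_closings_C[OF lip ab x c nc _ y]
      unfolding A by auto
  qed
  show ?thesis unfolding sx sy using W A by (simp add: distrib_left)
qed

text \<open>Each of the \<open>2 * n - 4\<close> closing vertices gives at most one matched pair,
  and the generator linking the pair may be an ordinary triangle, of weight \<open>\<alpha>\<close>
  in place of \<open>\<beta>\<close>. This is the surcharge \<open>\<alpha> - \<beta>\<close> per
  vertex.\<close>

lemma touching_diff_clover:
  assumes lip: "lipschitz s \<alpha> \<beta> f" and ab: "\<beta> \<le> \<alpha>" and x: "x \<in> Tour \<Phi> n s"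
    and c: "arrow x p (- p)" "arrow x (- p) r" "arrow x r p"
    and y: "y = reverse_games x (triple p (- p) r)"
  shows "(\<Sum>G\<in>touching s x (triple p (- p) r). gen_mult n G * f (reverse_games x G))
    - (\<Sum>G\<in>touching s y (triple p (- p) r). gen_mult n G * f (reverse_games y G))
    \<le> \<beta> * (\<Sum>G\<in>touching s x (triple p (- p) r). gen_mult n G) + (2 * real n - 4) * (\<alpha> - \<beta>)"
proof -
  note yc = arrow_reversed_triple[OF x c y]
  have j: "joined p (- p)" "joined (- p) r" "joined r p" using c arrow_joined by blast+
  then have C: "\<Phi> = TypeC" by (auto simp: joined_def)
  let ?W = "verts - {p, - p, r, - r}"
  have sx: "(\<Sum>G\<in>touching s x (triple p (- p) r). gen_mult n G * H G) = (\<Sum>t\<in>?W. closings x H p (- p) r t)" for H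
    by (rule sum_touching_clover[OF x c])
  \<comment> \<open>In \<open>y\<close> the loop points from \<open>- p\<close> to \<open>p\<close>,
    so the count is taken with \<open>- p\<close> in the place of \<open>p\<close>.\<close>
  have "(\<Sum>G\<in>touching s y (triple (- p) (- (- p)) r). gen_mult n G * H G)
      = (\<Sum>t\<in>verts - {- p, - (- p), r, - r}. closings y H (- p) (- (- p)) r t)" for H
    by (rule sum_touching_clover[OF yc(4)]) (use yc in simp_all)
  note sy' = this[unfolded minus_minus]
  have W: "verts - {- p, p, r, - r} = ?W" by auto
  have sy: "(\<Sum>G\<in>touching s y (triple p (- p) r). gen_mult n G * H G) = (\<Sum>t\<in>?W. closings y H r (- p) p t)" for H
    using sy'[of H] unfolding W triple_swap[of "- p" p r] closings_rotate[of y H "- p" p r] .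
  let ?X = "\<lambda>G. f (reverse_games x G)" and ?Y = "\<lambda>G. f (reverse_games y G)"
  have K: "closings x ?X p (- p) r t - closings y ?Y r (- p) p t \<le> \<beta> * closings x (\<lambda>_. 1) p (- p) r t + (\<alpha> - \<beta>)"
    if "t \<in> ?W" for t
  proof -
    have t: "t \<in> verts - {p, - p, r, - p, - (- p), - r}" using that by auto
    note k = closings_K4[OF lip x c y t, of \<alpha>] and w = gen_weight_le[OF ab]
    have "closings x ?X p (- p) r t - closings y ?Y r (- p) p t
        \<le> \<beta> * closings x (\<lambda>_. 1) p (- p) r t + (\<alpha> - \<beta>) * closings x (\<lambda>_. 1) p (- p) r t"
      using k(1) w by (simp add: algebra_simps)
    moreover have "(\<alpha> - \<beta>) * closings x (\<lambda>_. 1) p (- p) r t \<le> (\<alpha> - \<beta>) * 1"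
      using k(2) w ab by (intro mult_left_mono) auto
    ultimately show ?thesis by simp
  qed
  have "(\<Sum>t\<in>?W. closings x ?X p (- p) r t) - (\<Sum>t\<in>?W. closings y ?Y r (- p) p t)
      \<le> (\<Sum>t\<in>?W. \<beta> * closings x (\<lambda>_. 1) p (- p) r t + (\<alpha> - \<beta>))"
    unfolding sum_subtractf[symmetric] by (rule sum_mono) (rule K)
  also have "\<dots> = \<beta> * (\<Sum>t\<in>?W. closings x (\<lambda>_. 1) p (- p) r t) + real (card ?W) * (\<alpha> - \<beta>)"
    by (simp add: sum.distrib sum_distrib_left)
  also have "real (card ?W) = 2 * real n - 4"
  proof -
    have v: "{p, - p, r, - r} \<subseteq> verts" using j unfolding joined_def by (simp add: coxeter.uminus_verts)
    have "0 \<notin> verts" using C by (auto simp: coxeter.verts_def)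
    then have "p \<noteq> 0" "r \<noteq> 0" using v by auto
    moreover have "p \<noteq> r" "p \<noteq> - r" using joined_neq[OF j(2)] joined_neq[OF j(3)] by auto
    ultimately have c4: "card {p, - p, r, - r} = 4" by (simp add: card_insert_if)
    have "verts = {- int n..int n} - {0}" using C by (auto simp: coxeter.verts_def)
    then have c2: "card verts = 2 * n" by (simp add: card_Diff_singleton)
    have "card ?W = card verts - card {p, - p, r, - r}" by (rule card_Diff_subset) (use v in auto)
    moreover have "card {p, - p, r, - r} \<le> card verts" by (rule card_mono) (use v in auto)
    ultimately show ?thesis using c2 c4 by (simp add: of_nat_diff)
  qed
  finally show ?thesis using sx[of ?X] sy[of ?Y] sx[of "\<lambda>_. 1"] by simp
qed

text \<open>The amount by which the matching of touching generators may exceed the weight of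
  \<open>D\<close> times their number: the links of weight \<open>\<alpha>\<close> if
  \<open>D\<close> is a clover, the antipodal closings if it is a triangle.\<close>

definition excess :: "real \<Rightarrow> real \<Rightarrow> sedge set \<Rightarrow> real" where
  "excess \<alpha> \<beta> D = (if \<Phi> \<noteq> TypeC then 0 else if D \<in> clovers n then (2 * real n - 4) * (\<alpha> - \<beta>) else 4 * \<beta> - 2 * \<alpha>)"

lemma touching_diff:
  assumes lip: "lipschitz s \<alpha> \<beta> f" and ab: "\<beta> \<le> \<alpha>" "\<alpha> \<le> 2 * \<beta>" and x: "x \<in> Tour \<Phi> n s"
    and D: "D \<in> gens s x" and y: "y = reverse_games x D"
  shows "(\<Sum>G\<in>touching s x D. gen_mult n G * f (reverse_games x G))
    - (\<Sum>G\<in>touching s y D. gen_mult n G * f (reverse_games y G))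
    \<le> gen_weight \<alpha> \<beta> D * (\<Sum>G\<in>touching s x D. gen_mult n G) + excess \<alpha> \<beta> D"
proof -
  obtain p q r where c: "arrow x p q" "arrow x q r" "arrow x r p" "D = triple p q r"
    using gensE[OF x D] by blast
  have clover: ?thesis if "arrow x a (- a)" "arrow x (- a) b" "arrow x b a" "D = triple a (- a) b" for a b
  proof -
    have "\<Phi> = TypeC" using arrow_joined[OF that(1)] by (auto simp: joined_def)
    moreover have "D \<in> clovers n"
      unfolding that(4) using triple_in_clovers[of a b] that arrow_joined joined_sym by blast
    ultimately show ?thesis
      using touching_diff_clover[OF lip ab(1) x that(1-3), of y] y that(4) by (simp add: gen_weight_def coxeter.excess_def)
  qed
  consider "p = - q" | "q = - r" | "r = - p" | "p \<noteq> - q" "q \<noteq> - r" "r \<noteq> - p" by blast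
  then show ?thesis
  proof cases
    case 1
    then show ?thesis using clover[of p r] c by simp
  next
    case 2
    then show ?thesis using clover[of q p] c triple_rotate by simp
  next
    case 3
    then show ?thesis using clover[of r q] c triple_rotate by simp
  next
    case 4
    then have "D \<notin> clovers n" unfolding c(4) by (rule triple_not_clover)
    then have "gen_weight \<alpha> \<beta> D = \<alpha>" "excess \<alpha> \<beta> D = (if \<Phi> = TypeC then 4 * \<beta> - 2 * \<alpha> else 0)"
      by (auto simp: gen_weight_def excess_def)
    then show ?thesis
      using touching_diff_triangle[OF lip ab x c(1-3) 4 y[unfolded c(4)]] unfolding c(4) by (simp only:)
  qed
qed

section \<open>Comparing the neighbours of adjacent tournaments; regularity\<close>

lemma reverse_reverse_games:
  assumes "x \<in> Tour \<Phi> n s" "D \<subseteq> games"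
  shows "reverse_games (reverse_games x D) D = x"
proof
  fix e
  show "reverse_games (reverse_games x D) D e = x e"
    using assms tournament_le_1[OF Tour_tournaments[OF assms(1)], of e] by (auto simp: reverse_games_def)
qed

lemma gens_reverse:
  assumes "x \<in> Tour \<Phi> n s" "D \<in> gens s x"
  shows "reverse_games x D \<in> Tour \<Phi> n s" "D \<in> gens s (reverse_games x D)"
    "reverse_games (reverse_games x D) D = x" "D \<subseteq> games" "D \<noteq> {}"
proof -
  show s: "D \<subseteq> games" using assms(2) generator_subset_games by (auto simp: gens_def)
  then show r: "reverse_games (reverse_games x D) D = x" using reverse_reverse_games[OF assms(1)] by simp
  show "reverse_games x D \<in> Tour \<Phi> n s" using assms(2) by (simp add: gens_def)
  show "D \<in> gens s (reverse_games x D)" using assms r by (simp add: gens_def)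
  show "D \<noteq> {}" using gensE[OF assms] by (metis insert_not_empty triple_def)
qed

lemma gen_mult_pos: "gen_mult n G > 0"
  by (simp add: gen_mult_def)

text \<open>The generators of \<open>x\<close> are \<open>D\<close>, those disjoint from
  \<open>D\<close>, and those touching it. The first exchanges \<open>x\<close> and
  \<open>y\<close>. The second kind is common to \<open>x\<close> and \<open>y\<close> and commutes
  with \<open>D\<close>, so the results remain joined by \<open>D\<close>. The third kind is handled
  by \<open>touching_diff\<close>.\<close>

lemma gen_sum_diff:
  assumes lip: "lipschitz s \<alpha> \<beta> f" and ab: "\<beta> \<le> \<alpha>" "\<alpha> \<le> 2 * \<beta>" and x: "x \<in> Tour \<Phi> n s"
    and D: "D \<in> gens s x" and y: "y = reverse_games x D"
  shows "gen_sum s f x - gen_sum s f y \<le>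
    gen_mult n D * (f y - f x) + gen_weight \<alpha> \<beta> D * (gen_sum s (\<lambda>_. 1) x - gen_mult n D) + excess \<alpha> \<beta> D"
proof -
  note gx = gens_reverse[OF x D, folded y]
  define A where "A u = {G \<in> gens s u. G \<inter> D = {}}" for u
  have split: "(\<Sum>G\<in>gens s u. H G) = H D + (\<Sum>G\<in>A u. H G) + (\<Sum>G\<in>touching s u D. H G)"
    if "D \<in> gens s u" for u and H :: "sedge set \<Rightarrow> real"
  proof -
    have "gens s u = insert D (A u \<union> touching s u D)" using that by (auto simp: A_def touching_def)
    moreover have "D \<notin> A u \<union> touching s u D" using gx(5) by (auto simp: A_def touching_def)
    moreover have "finite (A u)" "A u \<inter> touching s u D = {}" by (auto simp: A_def touching_def)
    ultimately show ?thesis by (simp add: sum.union_disjoint)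
  qed
  have Axy: "A y = A x"
  proof -
    have "G \<in> gens s y \<longleftrightarrow> G \<in> gens s x" if "G \<inter> D = {}" for G
    proof (cases "G \<in> generator_games \<Phi> n")
      case True
      have "score_on G y = score_on G x"
        unfolding score_on_def using that by (intro ext sum.cong) (auto simp: y reverse_games_def)
      then show ?thesis
        using reverse_in_Tour_iff[OF x generator_subset_games[OF True]]
          reverse_in_Tour_iff[OF gx(1) generator_subset_games[OF True]] by (simp add: gens_def neutral_def)
    qed (simp add: gens_def)
    then show ?thesis by (auto simp: A_def)
  qed
  have dis: "(\<Sum>G\<in>A x. gen_mult n G * f (reverse_games x G)) - (\<Sum>G\<in>A x. gen_mult n G * f (reverse_games y G))
      \<le> gen_weight \<alpha> \<beta> D * (\<Sum>G\<in>A x. gen_mult n G)"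
  proof -
    have "gen_mult n G * f (reverse_games x G) - gen_mult n G * f (reverse_games y G) \<le> gen_weight \<alpha> \<beta> D * gen_mult n G"
      if "G \<in> A x" for G
    proof -
      have V: "reverse_games x G \<in> Tour \<Phi> n s" "reverse_games y G \<in> Tour \<Phi> n s" and G: "G \<inter> D = {}"
        using that Axy by (auto simp: A_def gens_def)
      have "reverse_games (reverse_games x G) D = reverse_games y G"
        using G by (auto simp: y reverse_games_def fun_eq_iff)
      then have "f (reverse_games x G) - f (reverse_games y G) \<le> gen_weight \<alpha> \<beta> D"
        using lip V D unfolding lipschitz_def gen_weight_def gens_def by (smt (verit) mem_Collect_eq)
      from mult_left_mono[OF this less_imp_le[OF gen_mult_pos[of G]]] show ?thesis by (simp add: algebra_simps)
    qed
    then show ?thesis by (simp add: sum_subtractf[symmetric] sum_distrib_left sum_mono)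
  qed
  have tx: "gen_sum s f x = gen_mult n D * f y + (\<Sum>G\<in>A x. gen_mult n G * f (reverse_games x G))
      + (\<Sum>G\<in>touching s x D. gen_mult n G * f (reverse_games x G))"
    unfolding gen_sum_def using split[OF D] y by simp
  have ty: "gen_sum s f y = gen_mult n D * f x + (\<Sum>G\<in>A x. gen_mult n G * f (reverse_games y G))
      + (\<Sum>G\<in>touching s y D. gen_mult n G * f (reverse_games y G))"
    unfolding gen_sum_def using split[OF gx(2)] gx(3) Axy by simp
  have t1: "gen_sum s (\<lambda>_. 1) x = gen_mult n D + (\<Sum>G\<in>A x. gen_mult n G) + (\<Sum>G\<in>touching s x D. gen_mult n G)"
    unfolding gen_sum_def using split[OF D, of "gen_mult n"] by simp
  show ?thesis
    unfolding tx ty t1 using dis touching_diff[OF lip ab x D y] by (simp add: algebra_simps)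
qed

text \<open>The constant one is Lipschitz with both weights zero, and the excess is then zero as
  well; so \<open>gen_sum_diff\<close> bounds the degree by that of any neighbour. By symmetry the
  degree is itself Lipschitz with weights zero, and connectivity makes it constant.\<close>

lemma gen_sum_1_eq:
  assumes x: "x \<in> Tour \<Phi> n s" and y: "y \<in> Tour \<Phi> n s"
  shows "gen_sum s (\<lambda>_. 1) x = gen_sum s (\<lambda>_. 1) y"
proof -
  have le: "gen_sum s (\<lambda>_. 1) u \<le> gen_sum s (\<lambda>_. 1) (reverse_games u G)" if "u \<in> Tour \<Phi> n s" "G \<in> gens s u" for u G
  proof -
    have "excess 0 0 G = 0" by (simp add: excess_def)
    then show ?thesis
      using gen_sum_diff[of s 0 0 "\<lambda>_. 1", OF _ _ _ that refl] by (simp add: lipschitz_def gen_weight_def)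
  qed
  have "lipschitz s 0 0 (gen_sum s (\<lambda>_. 1))"
    unfolding lipschitz_def
  proof (intro ballI impI)
    fix u G assume u: "u \<in> Tour \<Phi> n s" "G \<in> generator_games \<Phi> n" "reverse_games u G \<in> Tour \<Phi> n s"
    then have G: "G \<in> gens s u" by (simp add: gens_def)
    note g = gens_reverse[OF u(1) G]
    show "\<bar>gen_sum s (\<lambda>_. 1) u - gen_sum s (\<lambda>_. 1) (reverse_games u G)\<bar> \<le> (if G \<in> clovers n then 0 else 0)"
      using le[OF u(1) G] le[OF g(1,2)] g(3) by simp
  qed
  from lipschitz_imp_diam[OF this order_refl x y] show ?thesis by simp
qed

section \<open>The interchange multigraph and its lazy walk\<close>

lemma inj_on_reverse_games:
  assumes "x \<in> tournaments games"
  shows "inj_on (reverse_games x) (Pow games)"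
proof (rule inj_onI)
  fix G G' assume G: "G \<in> Pow games" "G' \<in> Pow games" "reverse_games x G = reverse_games x G'"
  have mem: "e \<in> H \<longleftrightarrow> reverse_games x H e \<noteq> x e" if "e \<in> games" for e H
    using tournament_le_1[OF assms that] by (cases "e \<in> H"; simp add: reverse_games_def; arith)
  show "G = G'" using G(1,2) mem[of _ G] mem[of _ G'] unfolding G(3) by blast
qed

text \<open>Different generators lead to different tournaments, so the quantifiers in
  \<open>int_mult\<close> can only pick out \<open>G\<close>.\<close>

lemma int_mult_reverse:
  assumes x: "x \<in> Tour \<Phi> n s" and G: "G \<in> gens s x"
  shows "real (int_mult \<Phi> n x (reverse_games x G)) = gen_mult n G"
proof -
  have cop: "H \<in> generator_copies \<Phi> n x \<longleftrightarrow> H \<in> gens s x" for H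
    using reverse_in_Tour_iff[OF x generator_subset_games[of H]] by (auto simp: generator_copies_def gens_def)
  have uniq: "H = G" if "H \<in> gens s x" "reverse_games x G = reverse_games x H" for H
    using inj_onD[OF inj_on_reverse_games[OF Tour_tournaments[OF x]]] gens_reverse(4)[OF x] that G by auto
  have "\<exists>H\<in>generator_copies \<Phi> n x. reverse_games x G = reverse_games x H"
    "(\<exists>H\<in>generator_copies \<Phi> n x. reverse_games x G = reverse_games x H \<and> H \<in> clovers n) \<longleftrightarrow> G \<in> clovers n"
    using G uniq cop by blast+
  then show ?thesis by (simp add: int_mult_def gen_mult_def)
qed

lemma int_mult_nonzeroD:
  assumes "x \<in> Tour \<Phi> n s" "int_mult \<Phi> n x z \<noteq> 0"
  obtains G where "G \<in> gens s x" "z = reverse_games x G"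
proof -
  have "H \<in> generator_copies \<Phi> n x \<longleftrightarrow> H \<in> gens s x" for H
    using reverse_in_Tour_iff[OF assms(1) generator_subset_games[of H]] by (auto simp: generator_copies_def gens_def)
  then show thesis using assms(2) that by (auto simp: int_mult_def split: if_splits)
qed

lemma finite_Tour [simp]: "finite (Tour \<Phi> n s)"
  by (rule finite_subset[of _ "tournaments games"])
    (auto simp: Tour_def tournaments_def finite_games intro!: finite_PiE)

lemma sum_int_mult:
  assumes x: "x \<in> Tour \<Phi> n s"
  shows "(\<Sum>z\<in>Tour \<Phi> n s. real (int_mult \<Phi> n x z) * f z) = gen_sum s f x"
proof -
  have inj: "inj_on (reverse_games x) (gens s x)"
    by (rule inj_on_subset[OF inj_on_reverse_games[OF Tour_tournaments[OF x]]]) (use gens_reverse(4)[OF x] in auto)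
  have "(\<Sum>z\<in>Tour \<Phi> n s. real (int_mult \<Phi> n x z) * f z)
      = (\<Sum>z\<in>reverse_games x ` gens s x. real (int_mult \<Phi> n x z) * f z)"
  proof (rule sum.mono_neutral_right)
    show "\<forall>z\<in>Tour \<Phi> n s - reverse_games x ` gens s x. real (int_mult \<Phi> n x z) * f z = 0"
    proof
      fix z assume "z \<in> Tour \<Phi> n s - reverse_games x ` gens s x"
      then have "int_mult \<Phi> n x z = 0" using int_mult_nonzeroD[OF x, of z] by blast
      then show "real (int_mult \<Phi> n x z) * f z = 0" by simp
    qed
  qed (use gens_reverse(1)[OF x] in auto)
  also have "\<dots> = gen_sum s f x"
    by (simp add: sum.reindex[OF inj] gen_sum_def int_mult_reverse[OF x])
  finally show ?thesis .
qed

lemma int_mult_sym: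
  assumes "x \<in> Tour \<Phi> n s" "y \<in> Tour \<Phi> n s"
  shows "int_mult \<Phi> n x y = int_mult \<Phi> n y x"
proof -
  have *: "int_mult \<Phi> n v u = int_mult \<Phi> n u v" if uv: "u \<in> Tour \<Phi> n s" "int_mult \<Phi> n u v \<noteq> 0" for u v
  proof -
    obtain G where G: "G \<in> gens s u" "v = reverse_games u G" using int_mult_nonzeroD[OF uv] by blast
    note g = gens_reverse[OF that(1) G(1), folded G(2)]
    show ?thesis
      using int_mult_reverse[OF that(1) G(1)] int_mult_reverse[OF g(1,2)] g(3) G(2) by simp
  qed
  show ?thesis using *[OF assms(1)] *[OF assms(2)] by (metis)
qed

lemma card_verts_le:
  assumes "n \<ge> 1"
  shows "card verts \<le> 3 * n"
proof -
  have "verts \<subseteq> {- int n..int n}" by (auto simp: verts_def)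
  then have "card verts \<le> card {- int n..int n}" by (rule card_mono[rotated]) simp
  then show ?thesis using assms by simp
qed

text \<open>Generators come from triples of at most \<open>3 * n\<close> signed vertices and have
  multiplicity at most two, whence \<open>2 * 27 = 54\<close>.\<close>

lemma gen_sum_1_bounds:
  shows "G \<in> gens s x \<Longrightarrow> gen_mult n G \<le> gen_sum s (\<lambda>_. 1) x"
    and "n \<ge> 1 \<Longrightarrow> gen_sum s (\<lambda>_. 1) x \<le> 54 * real n ^ 3"
proof -
  show "gen_mult n G \<le> gen_sum s (\<lambda>_. 1) x" if "G \<in> gens s x"
    unfolding gen_sum_def mult_1_right by (rule member_le_sum[OF that]) (simp_all add: gen_mult_def)
  show "gen_sum s (\<lambda>_. 1) x \<le> 54 * real n ^ 3" if n: "n \<ge> 1"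
  proof -
    note cv = card_verts_le[OF n]
    have "gens s x \<subseteq> (\<lambda>(p, q, r). triple p q r) ` (verts \<times> verts \<times> verts)"
    proof
      fix G assume "G \<in> gens s x"
      then obtain p q r where "joined p q" "joined q r" "G = triple p q r"
        using generator_gamesE unfolding gens_def by blast
      then show "G \<in> (\<lambda>(p, q, r). triple p q r) ` (verts \<times> verts \<times> verts)"
        by (intro image_eqI[of _ _ "(p, q, r)"]) (auto simp: coxeter.joined_def)
    qed
    then have "card (gens s x) \<le> card ((\<lambda>(p, q, r). triple p q r) ` (verts \<times> verts \<times> verts))"
      by (rule card_mono[rotated]) simp
    also have "\<dots> \<le> card (verts \<times> verts \<times> verts)" by (rule card_image_le) simp
    also have "\<dots> = card verts ^ 3" by (simp add: card_cartesian_product power3_eq_cube)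
    also have "\<dots> \<le> (3 * n) ^ 3" by (rule power_mono[OF cv]) simp
    finally have "real (card (gens s x)) \<le> real ((3 * n) ^ 3)" by (simp only: of_nat_le_iff)
    then have "real (card (gens s x)) \<le> 27 * real n ^ 3" by (simp add: power_mult_distrib)
    moreover have "gen_sum s (\<lambda>_. 1) x \<le> (\<Sum>G\<in>gens s x. 2)"
      unfolding gen_sum_def by (rule sum_mono) (simp add: gen_mult_def)
    ultimately show ?thesis by simp
  qed
qed

lemma card_diff_le:
  assumes "n \<ge> 1"
  shows "real (card {e \<in> games. x e \<noteq> y e}) \<le> 9 * real n ^ 2"
proof -
  note cv = card_verts_le[OF assms]
  have sub: "{e \<in> games. x e \<noteq> y e} \<subseteq> (\<lambda>(p, q). game p q) ` (verts \<times> verts)"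
    by (auto simp: mem_complete_graph joined_def)
  have "card {e \<in> games. x e \<noteq> y e} \<le> card ((\<lambda>(p, q). game p q) ` (verts \<times> verts))"
    by (rule card_mono[OF _ sub]) simp
  also have "\<dots> \<le> card (verts \<times> verts)" by (rule card_image_le) simp
  also have "\<dots> = card verts ^ 2" by (simp add: card_cartesian_product power2_eq_square)
  also have "\<dots> \<le> (3 * n) ^ 2" by (rule power_mono[OF cv]) simp
  finally have "real (card {e \<in> games. x e \<noteq> y e}) \<le> real ((3 * n) ^ 2)" by (simp only: of_nat_le_iff)
  then show ?thesis by (simp add: power_mult_distrib)
qed

abbreviation "walk s \<equiv> lazy_walk (Tour \<Phi> n s) (int_mult \<Phi> n)"

lemma walk_eq:
  assumes x: "x \<in> Tour \<Phi> n s" and d: "gen_sum s (\<lambda>_. 1) x = d" "d > 0"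
  shows "walk s x y = 1 / 2 * of_bool (x = y) + 1 / 2 * (real (int_mult \<Phi> n x y) / d)"
proof -
  have "real (\<Sum>z\<in>Tour \<Phi> n s. int_mult \<Phi> n x z) = d"
    using sum_int_mult[OF x, of "\<lambda>_. 1"] d by simp
  then show ?thesis using d(2) by (auto simp: lazy_walk_def Let_def)
qed

lemma markov_op_walk:
  assumes x: "x \<in> Tour \<Phi> n s" and d: "gen_sum s (\<lambda>_. 1) x = d" "d > 0"
  shows "markov_op (Tour \<Phi> n s) (walk s) f x = f x / 2 + gen_sum s f x / (2 * d)"
proof -
  have "markov_op (Tour \<Phi> n s) (walk s) f x
     = (\<Sum>y\<in>Tour \<Phi> n s. (if x = y then f y / 2 else 0) + real (int_mult \<Phi> n x y) * f y / (2 * d))"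
    unfolding markov_op_def walk_eq[OF assms] by (rule sum.cong) (auto simp: field_simps)
  also have "\<dots> = f x / 2 + gen_sum s f x / (2 * d)"
    using x by (simp add: sum.distrib sum_divide_distrib[symmetric] sum_int_mult)
  finally show ?thesis .
qed

text \<open>Laziness contributes \<open>d * (f u - f v)\<close>, which absorbs the swapped term
  \<open>m * (f v - f u)\<close> because \<open>m \<le> d\<close>; what is gained is
  \<open>2 * m * w\<close> minus the excess. In types B and D there is no excess. In type C the
  weights leave \<open>4 * c\<close> for a triangle and \<open>2 * c * n\<close> for a clover,
  whereas \<open>2 * d * \<kappa> * w\<close> is at most \<open>2 * c\<close>.\<close>

lemma lipschitz_contract:
  assumes n: "n \<ge> 2" and c: "0 \<le> c" and lip: "lipschitz s (c * real n) (c * (real n - 1)) f"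
    and d: "\<And>x. x \<in> Tour \<Phi> n s \<Longrightarrow> gen_sum s (\<lambda>_. 1) x = d" "d > 0"
    and kappa: "\<kappa> = (if \<Phi> = TypeC then 1 / (real n * d) else 1 / d)"
  shows "lipschitz s ((1 - \<kappa>) * c * real n) ((1 - \<kappa>) * c * (real n - 1)) (markov_op (Tour \<Phi> n s) (walk s) f)"
proof -
  let ?a = "c * real n" and ?b = "c * (real n - 1)"
  \<comment> \<open>The second inequality amounts to \<open>n \<le> 2 * (n - 1)\<close>, hence
    \<open>n \<ge> 2\<close>.\<close>
  have ab: "?b \<le> ?a" "?a \<le> 2 * ?b"
    using c n mult_left_mono[of 2 "real n" c] by (auto simp: algebra_simps)
  have half: "markov_op (Tour \<Phi> n s) (walk s) f u - markov_op (Tour \<Phi> n s) (walk s) f v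
      \<le> (1 - \<kappa>) * gen_weight ?a ?b G"
    if u: "u \<in> Tour \<Phi> n s" and G: "G \<in> gens s u" and v: "v = reverse_games u G" for u v G
  proof -
    define w m where "w = gen_weight ?a ?b G" and "m = gen_mult n G"
    note g = gens_reverse[OF u G, folded v]
    have md: "m \<le> d" using gen_sum_1_bounds(1)[OF G] d(1)[OF u] by (simp add: m_def)
    have fw: "f u - f v \<le> w"
      using lip u G g(1) v unfolding lipschitz_def w_def gen_weight_def gens_def by (smt (verit) mem_Collect_eq)
    have gs: "gen_sum s f u - gen_sum s f v \<le> m * (f v - f u) + w * (d - m) + excess ?a ?b G"
      using gen_sum_diff[OF lip ab u G v] d(1)[OF u] by (simp add: w_def m_def)
    have gain: "2 * d * \<kappa> * w \<le> 2 * m * w - excess ?a ?b G"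
    proof (cases "\<Phi> = TypeC")
      case False
      moreover have "G \<notin> clovers n"
      proof
        assume "G \<in> clovers n"
        then obtain i where "Loop i \<in> G" by (auto simp: clovers_def)
        moreover have "Loop i \<notin> games" using False by (cases \<Phi>) (auto simp: complete_D_def)
        ultimately show False using g(4) by blast
      qed
      ultimately show ?thesis using d(2) by (simp add: kappa m_def gen_mult_def coxeter.excess_def)
    next
      case True
      then have k: "2 * d * \<kappa> = 2 / real n" using d(2) by (simp add: kappa)
      show ?thesis
      proof (cases "G \<in> clovers n")
        case True
        have "2 / real n * ?b \<le> 2 / real n * ?a" using ab(1) by (rule mult_left_mono) simp
        also have "\<dots> = 2 * c" using n by simp
        also have "\<dots> \<le> 4 * ?b - (2 * real n - 4) * (?a - ?b)"
          using c n mult_left_mono[of 1 "real n" c] by (simp add: algebra_simps)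
        finally show ?thesis
          unfolding k using True \<open>\<Phi> = TypeC\<close> by (simp add: w_def m_def gen_weight_def gen_mult_def coxeter.excess_def)
      next
        case False
        have "2 / real n * ?a = 2 * c" using n by simp
        also have "\<dots> \<le> 2 * ?a - (4 * ?b - 2 * ?a)" using c by (simp add: algebra_simps)
        finally show ?thesis
          unfolding k using False \<open>\<Phi> = TypeC\<close> by (simp add: w_def m_def gen_weight_def gen_mult_def coxeter.excess_def)
      qed
    qed
    have "markov_op (Tour \<Phi> n s) (walk s) f u - markov_op (Tour \<Phi> n s) (walk s) f v
        = (f u - f v) / 2 + (gen_sum s f u - gen_sum s f v) / (2 * d)"
      unfolding markov_op_walk[OF u d(1)[OF u] d(2)] markov_op_walk[OF g(1) d(1)[OF g(1)] d(2)]
      by (simp add: diff_divide_distrib)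
    also have "\<dots> = (d * (f u - f v) + (gen_sum s f u - gen_sum s f v)) / (2 * d)"
      using d(2) by (simp add: field_simps)
    also have "\<dots> \<le> ((2 * d - 2 * d * \<kappa>) * w) / (2 * d)"
    proof (rule divide_right_mono)
      have "(d - m) * (f u - f v) \<le> (d - m) * w" using fw md by (intro mult_left_mono) auto
      then show "d * (f u - f v) + (gen_sum s f u - gen_sum s f v) \<le> (2 * d - 2 * d * \<kappa>) * w"
        using gs gain by (simp add: algebra_simps)
    qed (use d(2) in simp)
    also have "\<dots> = (1 - \<kappa>) * w" using d(2) by (simp add: field_simps)
    finally show ?thesis by (simp add: w_def)
  qed
  have w: "gen_weight ((1 - \<kappa>) * c * real n) ((1 - \<kappa>) * c * (real n - 1)) G = (1 - \<kappa>) * gen_weight ?a ?b G" for G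
    by (simp add: gen_weight_def)
  show ?thesis
    unfolding lipschitz_def
  proof (intro ballI impI)
    fix u G assume u: "u \<in> Tour \<Phi> n s" "G \<in> generator_games \<Phi> n" "reverse_games u G \<in> Tour \<Phi> n s"
    then have G: "G \<in> gens s u" by (simp add: gens_def)
    note g = gens_reverse[OF u(1) G]
    show "\<bar>markov_op (Tour \<Phi> n s) (walk s) f u - markov_op (Tour \<Phi> n s) (walk s) f (reverse_games u G)\<bar>
      \<le> (if G \<in> clovers n then (1 - \<kappa>) * c * (real n - 1) else (1 - \<kappa>) * c * real n)"
      using half[OF u(1) G refl] half[OF g(1,2) g(3)[symmetric]] w[of G] unfolding gen_weight_def
      by (simp add: abs_le_iff)
  qed
qed

section \<open>The bounds on the mixing time\<close>

lemma mixing_time_zero: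
  assumes s: "s \<in> Score \<Phi> n" and g: "\<And>x. x \<in> Tour \<Phi> n s \<Longrightarrow> gens s x = {}"
  shows "t_mix \<Phi> n s = 0"
proof -
  have ne: "Tour \<Phi> n s \<noteq> {}" using s by (auto simp: Score_def Tour_def)
  \<comment> \<open>Without generators every function is Lipschitz with weights zero, so by
    connectivity the fibre is a single tournament.\<close>
  have lip: "lipschitz s 0 0 f" for f using g unfolding lipschitz_def gens_def by auto
  have "x = y" if "x \<in> Tour \<Phi> n s" "y \<in> Tour \<Phi> n s" for x y
    using lipschitz_imp_diam[OF lip[of "\<lambda>z. of_bool (z = x)"] order_refl that]
    by (cases "y = x") auto
  then obtain x where V: "Tour \<Phi> n s = {x}" using ne by blast
  have "gen_sum s (\<lambda>_. 1) x = 0" using g[of x] V by (simp add: gen_sum_def)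
  then have "real (\<Sum>z\<in>Tour \<Phi> n s. int_mult \<Phi> n x z) = 0"
    using sum_int_mult[of x s "\<lambda>_. 1"] V by simp
  then have P: "walk s x x = 1" by (simp add: lazy_walk_def V)
  have "mixing_time (Tour \<Phi> n s) (walk s) \<le> enat 0"
    by (rule mixing_time_le_contraction[where \<kappa> = 1 and D = 0 and L = "\<lambda>_ _. True"]) (use V P in auto)
  then show ?thesis by (simp add: t_mix_def zero_enat_def[symmetric])
qed

lemma t_mix_le:
  assumes n: "n \<ge> 2" and s: "s \<in> Score \<Phi> n"
    and N: "N = (if \<Phi> = TypeC then real n ^ 4 else real n ^ 3)"
  shows "ereal_of_enat (t_mix \<Phi> n s) \<le> ereal (488 * (N * ln (real n)))"
proof -
  have ne: "Tour \<Phi> n s \<noteq> {}" using s by (auto simp: Score_def Tour_def)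
  then obtain x0 where x0: "x0 \<in> Tour \<Phi> n s" by blast
  define d where "d = gen_sum s (\<lambda>_. 1) x0"
  have d: "gen_sum s (\<lambda>_. 1) x = d" if "x \<in> Tour \<Phi> n s" for x
    using gen_sum_1_eq[OF that x0] by (simp add: d_def)
  have lnpos: "ln (real n) \<ge> 0" using n by simp
  have N1: "N \<ge> 1" using n by (simp add: N)
  show ?thesis
  proof (cases "\<exists>x\<in>Tour \<Phi> n s. gens s x \<noteq> {}")
    case False
    then have "t_mix \<Phi> n s = 0" using mixing_time_zero[OF s] by blast
    then show ?thesis using N1 lnpos by simp
  next
    case True
    then obtain x G where "x \<in> Tour \<Phi> n s" "G \<in> gens s x" by blast
    then have d1: "d \<ge> 1" using gen_sum_1_bounds(1)[of G s x] d[of x] by (simp add: gen_mult_def split: if_splits)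
    then have d0: "d > 0" by simp
    define \<kappa> where "\<kappa> = (if \<Phi> = TypeC then 1 / (real n * d) else 1 / d)"
    have nd: "real n * d \<ge> 1" using n d1 mult_mono[of 1 "real n" 1 d] by simp
    have k: "0 < \<kappa>" "\<kappa> \<le> 1" using d1 n nd by (auto simp: \<kappa>_def)
    have kN: "1 / \<kappa> \<le> 54 * N"
    proof -
      have "d \<le> 54 * real n ^ 3" using gen_sum_1_bounds(2)[of s x0] n by (simp add: d_def)
      then show ?thesis using mult_left_mono[of d "54 * real n ^ 3" "real n"]
        by (auto simp: \<kappa>_def N power_numeral_reduce algebra_simps)
    qed
    \<comment> \<open>Four times the diameter bound \<open>9 * n ^ 3\<close> is
      \<open>36 * n ^ 3\<close>; after this many steps it has shrunk to a quarter.\<close>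
    define t where "t = nat \<lceil>1 / \<kappa> * ln (36 * real n ^ 3)\<rceil>"
    have n3: "real n ^ 3 \<ge> 1" using n by simp
    have t1: "1 / \<kappa> * ln (36 * real n ^ 3) \<le> real t" unfolding t_def by linarith
    have lnn: "ln (36 * real n ^ 3) \<ge> 0" using n3 by simp
    have "real t \<le> 1 / \<kappa> * ln (36 * real n ^ 3) + 1"
      unfolding t_def using lnn k(1) by simp
    \<comment> \<open>From \<open>36 \<le> 2 ^ 6 \<le> n ^ 6\<close> the logarithm is at most
      \<open>9 * ln n\<close>, and rounding up costs \<open>1 \<le> 2 * ln 2\<close>. The constant
      is \<open>54 * 9 + 2 = 488\<close>.\<close>
    also have "\<dots> \<le> 54 * N * (9 * ln (real n)) + 2 * (N * ln (real n))"
    proof (rule add_mono)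
      have "(36::real) \<le> 2 ^ 6" by simp
      also have "\<dots> \<le> real n ^ 6" using n by (intro power_mono) auto
      finally have "36 * real n ^ 3 \<le> real n ^ 6 * real n ^ 3" by (intro mult_right_mono) auto
      then have "36 * real n ^ 3 \<le> real n ^ 9" by (simp add: power_add[symmetric])
      then have "ln (36 * real n ^ 3) \<le> ln (real n ^ 9)" using n by (intro ln_mono) auto
      also have "\<dots> = 9 * ln (real n)" using n by (simp add: ln_realpow)
      finally show "1 / \<kappa> * ln (36 * real n ^ 3) \<le> 54 * N * (9 * ln (real n))"
        using kN lnn N1 by (intro mult_mono) auto
      have "1 / 2 \<le> ln (2::real)" using ln_add_one_self_le_self2[of "- 1 / 2"] by (simp add: ln_div)
      also have "\<dots> \<le> ln (real n)" using n by (intro ln_mono) auto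
      finally have "1 \<le> 2 * (1 * ln (real n))" by simp
      also have "\<dots> \<le> 2 * (N * ln (real n))" using N1 lnpos by (intro mult_left_mono mult_right_mono) auto
      finally show "1 \<le> 2 * (N * ln (real n))" .
    qed
    also have "\<dots> = 488 * (N * ln (real n))" by simp
    finally have tb: "real t \<le> 488 * (N * ln (real n))" .
    have small: "(1 - \<kappa>) ^ t * (9 * real n ^ 3) \<le> 1 / 4"
    proof -
      have "(1 - \<kappa>) ^ t \<le> exp (- \<kappa>) ^ t"
        using exp_ge_add_one_self[of "- \<kappa>"] k by (intro power_mono) auto
      also have "\<dots> = exp (- (\<kappa> * real t))" by (simp add: exp_of_nat_mult[symmetric] mult.commute)
      also have "\<dots> \<le> exp (- ln (36 * real n ^ 3))"
      proof -
        have "ln (36 * real n ^ 3) \<le> \<kappa> * real t" using t1 k(1) by (simp add: field_simps)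
        then show ?thesis by simp
      qed
      also have "\<dots> = 1 / (36 * real n ^ 3)" using n by (simp add: exp_minus inverse_eq_divide)
      finally have "(1 - \<kappa>) ^ t * (9 * real n ^ 3) \<le> 1 / (36 * real n ^ 3) * (9 * real n ^ 3)"
        by (intro mult_right_mono) auto
      also have "\<dots> = 1 / 4" using n by simp
      finally show ?thesis .
    qed
    have "mixing_time (Tour \<Phi> n s) (walk s) \<le> enat t"
    proof (rule mixing_time_le_contraction[OF finite_Tour ne _ _ k _ _ _ small,
          where L = "\<lambda>c f. lipschitz s (c * real n) (c * (real n - 1)) f"])
      show rows: "(\<Sum>y\<in>Tour \<Phi> n s. walk s x y) = 1" if "x \<in> Tour \<Phi> n s" for x
        using markov_op_walk[OF that d[OF that] d0, of "\<lambda>_. 1"] d[OF that] d0 by (simp add: markov_op_def)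
      show "(\<Sum>x\<in>Tour \<Phi> n s. walk s x y) = 1" if y: "y \<in> Tour \<Phi> n s" for y
      proof -
        have "walk s x y = walk s y x" if "x \<in> Tour \<Phi> n s" for x
          using walk_eq[OF that d[OF that] d0] walk_eq[OF y d[OF y] d0] int_mult_sym[OF that y] by auto
        then show ?thesis using rows[OF y] by simp
      qed
      show "lipschitz s ((1 - \<kappa>) * c * real n) ((1 - \<kappa>) * c * (real n - 1)) (markov_op (Tour \<Phi> n s) (walk s) f)"
        if "0 \<le> c" "lipschitz s (c * real n) (c * (real n - 1)) f" for c f
        by (rule lipschitz_contract[OF n that d d0 \<kappa>_def])
      \<comment> \<open>At most \<open>9 * n ^ 2\<close> games differ, and each costs at most
        \<open>c * n\<close>.\<close>
      show "\<bar>f x - f y\<bar> \<le> 9 * real n ^ 3 * c"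
        if "0 \<le> c" "lipschitz s (c * real n) (c * (real n - 1)) f" "x \<in> Tour \<Phi> n s" "y \<in> Tour \<Phi> n s" for c f x y
      proof -
        have "\<bar>f x - f y\<bar> \<le> c * real n * real (card {e \<in> games. x e \<noteq> y e})"
          using that by (intro lipschitz_imp_diam) (auto intro: mult_left_mono)
        also have "\<dots> \<le> c * real n * (9 * real n ^ 2)"
          using card_diff_le[of x y] n that(1) by (intro mult_left_mono) auto
        finally show ?thesis by (simp add: power2_eq_square power3_eq_cube algebra_simps)
      qed
      \<comment> \<open>An indicator changes by at most one, which is within the smaller weight
        \<open>n - 1\<close> since \<open>n \<ge> 2\<close>.\<close>
      show "lipschitz s (1 * real n) (1 * (real n - 1)) (\<lambda>x. of_bool (x \<in> A))" for A
        using n unfolding lipschitz_def by (auto simp: of_bool_def)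
    qed
    then have "ereal_of_enat (t_mix \<Phi> n s) \<le> ereal_of_enat (enat t)"
      by (simp only: t_mix_def ereal_of_enat_le_iff)
    also have "\<dots> \<le> ereal (488 * (N * ln (real n)))" using tb by simp
    finally show ?thesis .
  qed
qed

text \<open>For \<open>n = 1\<close> the claimed bound is zero, since \<open>ln 1 = 0\<close>. Three
  different signed vertices among -1, 0, 1 contain both \<open>0\<close> and an antipodal pair,
  which no single type allows, so there are no generators.\<close>

lemma t_mix_one:
  assumes n: "n = 1" and s: "s \<in> Score \<Phi> n"
  shows "t_mix \<Phi> n s = 0"
proof (rule mixing_time_zero[OF s])
  fix x assume x: "x \<in> Tour \<Phi> n s"
  have False if G: "G \<in> gens s x" for G
  proof -
    obtain p q r where "arrow x p q" "arrow x q r" "arrow x r p" "G = triple p q r" using gensE[OF x G] by blast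
    then have j: "joined p q" "joined q r" "joined r p" using arrow_joined by blast+
    then have "p \<noteq> q" "q \<noteq> r" "r \<noteq> p" "\<bar>p\<bar> \<le> 1" "\<bar>q\<bar> \<le> 1" "\<bar>r\<bar> \<le> 1"
      using n by (simp_all add: coxeter.joined_def coxeter.verts_def)
    then have "p = - q \<or> q = - r \<or> r = - p" "p = 0 \<or> q = 0 \<or> r = 0" by arith+
    then have "\<Phi> = TypeC" "\<Phi> = TypeB" using j unfolding joined_def verts_def by auto
    then show False by simp
  qed
  then show "gens s x = {}" by blast
qed

end

theorem theorem4:
  fixes \<Phi> :: coxeter_type
  shows "(\<Phi> = TypeB \<or> \<Phi> = TypeD \<longrightarrow>
            (\<exists>c::real. \<forall>n\<ge>1. \<forall>s\<in>Score \<Phi> n.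
               ereal_of_enat (t_mix \<Phi> n s) \<le> ereal (c * (real n ^ 3 * ln (real n)))))
       \<and> (\<Phi> = TypeC \<longrightarrow>
            (\<exists>c::real. \<forall>n\<ge>1. \<forall>s\<in>Score \<Phi> n.
               ereal_of_enat (t_mix \<Phi> n s) \<le> ereal (c * (real n ^ 4 * ln (real n)))))"
proof -
  have main: "ereal_of_enat (t_mix \<Phi> n s) \<le> ereal (488 * ((if \<Phi> = TypeC then real n ^ 4 else real n ^ 3) * ln (real n)))"
    if "n \<ge> 1" "s \<in> Score \<Phi> n" for n s
  proof (cases "n = 1")
    case True
    then show ?thesis using coxeter.t_mix_one[OF True that(2)] by simp
  next
    case False
    then show ?thesis using coxeter.t_mix_le[OF _ that(2) refl] that(1) by simp
  qed
  show ?thesis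
  proof (intro conjI impI)
    assume "\<Phi> = TypeB \<or> \<Phi> = TypeD"
    then have "\<Phi> \<noteq> TypeC" by auto
    then show "\<exists>c::real. \<forall>n\<ge>1. \<forall>s\<in>Score \<Phi> n.
               ereal_of_enat (t_mix \<Phi> n s) \<le> ereal (c * (real n ^ 3 * ln (real n)))"
      using main by (intro exI[of _ 488]) simp
  next
    assume "\<Phi> = TypeC"
    then show "\<exists>c::real. \<forall>n\<ge>1. \<forall>s\<in>Score \<Phi> n.
               ereal_of_enat (t_mix \<Phi> n s) \<le> ereal (c * (real n ^ 4 * ln (real n)))"
      using main by (intro exI[of _ 488]) simp
  qed
qed

end
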